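(* Let $\mathcal D>0$ with $\mathcal D\ne-\operatorname{Im}m_\infty(i)$, and consider all Schrödinger L-systems $\Theta_{\mu,h}$ ($\mu\in\mathbb R\cup\{\infty\}$) with coefficient of dissipation $\operatorname{Im}h=\mathcal D$ whose impedance function satisfies $V_{\Theta_{\mu,h}}(z)\in\mathfrak M_\kappa^{-1}$ for some $0<\kappa<1$. An L-system $\Theta_{\mu,h}$ of this class has the maximum finite c-entropy $\mathcal S_{max}$ (among all L-systems of this class) if and only if it is determined by the parameters $$h=-\operatorname{Re}m_\infty(i)+i\mathcal D\quad\text{and}\quad \mu=\begin{cases}\infty, & \text{if }\mathcal D>-\operatorname{Im}m_\infty(i);\\ -\operatorname{Re}m_\infty(i), & \text{if }\mathcal D<-\operatorname{Im}m_\infty(i).\end{cases}$$ In this case $$\mathcal S_{max}=\ln|\mathcal D-\operatorname{Im}m_\infty(i)|-\ln|\mathcal D+\operatorname{Im}m_\infty(i)|.$$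
   Context: Setting. Let $\ell\in\mathbb R$, let $q$ be a (fixed) real locally summable function on $[\ell,+\infty)$, $l(y)=-y''+q(x)y$, $\mathcal H=L_2(\ell,+\infty)$. Let $D^*$ be the set of $y\in\mathcal H$ that are locally absolutely continuous together with $y'$ and satisfy $l(y)\in\mathcal H$. The minimal symmetric operator $\dot A y=l(y)$ with boundary conditions $y(\ell)=y'(\ell)=0$ is assumed to have deficiency indices $(1,1)$; $\operatorname{Dom}(\dot A^* )=D^*$, $\dot A^*y=l(y)$. For $h\in\mathbb C$ with $\operatorname{Im}h>0$, $T_h y=l(y)$ with domain $\{y\in D^*: y'(\ell)=hy(\ell)\}$. Weyl function. Let $\varphi_1,\varphi_2$ solve $l(\varphi_k)=\lambda\varphi_k$ with $\varphi_1(\ell,\lambda)=0,\varphi_1'(\ell,\lambda)=1$, $\varphi_2(\ell,\lambda)=-1,\varphi_2'(\ell,\lambda)=0$. The Weyl function $m_\infty(\lambda)$ is such that $\varphi_2(\cdot,\lambda)+m_\infty(\lambda)\varphi_1(\cdot,\lambda)\in L_2(\ell,+\infty)$. One has $\operatorname{Im}m_\infty(i)<0$. Schrödinger L-systems. $\mathcal H_+=D^*$ with $(y,z)_+=\int_\ell^\infty (y\bar z+l(y)\overline{l(z)})dx$, and $\mathcal H_+\subset\mathcal H\subset\mathcal H_-$ is the corresponding rigged triplet; $\delta(x-\ell),\delta'(x-\ell)\in\mathcal H_-$ act by $(y,\delta)=y(\ell)$, $(y,\delta')=-y'(\ell)$. For $\mu\in\mathbb R\cup\{\infty\}$ put $\mathbb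 A_{\mu,h}y=-y''+q y-\frac1{\mu-h}[y'(\ell)-hy(\ell)][\mu\delta(x-\ell)+\delta'(x-\ell)]$ and $g=\frac{(\operatorname{Im}h)^{1/2}}{|\mu-h|}[\mu\delta(x-\ell)+\delta'(x-\ell)]$ (limits as $\mu\to\infty$ if $\mu=\infty$), $Kc=cg$ for $c\in\mathbb C$; then $\operatorname{Im}\mathbb A_{\mu,h}=KK^*$. The array $\Theta_{\mu,h}=(\mathbb A_{\mu,h},K,1;\ \mathcal H_+\subset\mathcal H\subset\mathcal H_-,\mathbb C)$ is the Schrödinger L-system with main operator $T_h$ and state-space operator $\mathbb A_{\mu,h}$. Its transfer function is $W_{\Theta_{\mu,h}}(z)=I-2iK^*(\mathbb A_{\mu,h}-zI)^{-1}K=\frac{\mu-h}{\mu-\bar h}\cdot\frac{m_\infty(z)+\bar h}{m_\infty(z)+h}$ and its impedance function is $V_{\Theta_{\mu,h}}(z)=K^*(\operatorname{Re}\mathbb A_{\mu,h}-zI)^{-1}K=\frac{(m_\infty(z)+\mu)\operatorname{Im}h}{(\mu-\operatorname{Re}h)m_\infty(z)+\mu\operatorname{Re}h-|h|^2}$ (limits as $\mu\to\infty$ if $\mu=\infty$). The coefficient of dissipation of $\Theta_{\mu,h}$ (and of $T_h$) is $\mathcal D=\operatorname{Im}h$. The c-entropy of $\Theta_{\mu,h}$ is $\mathcal S=-\ln|W_{\Theta_{\mu,h}}(-i)|$; it equals $-\ln|\kappa|$ where $|\kappa|=\left|\frac{m_\infty(i)+h}{m_\infty(i)+\bar h}\right|<1$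 is the modulus of von Neumann's parameter of $T_h$. Generalized Donoghue class. For $0\le\kappa<1$, $\mathfrak M_\kappa^{-1}$ is the class of all Herglotz-Nevanlinna functions $M(z)=\int_{\mathbb R}\left(\frac1{\lambda-z}-\frac{\lambda}{1+\lambda^2}\right)d\sigma(\lambda)$, $\sigma$ an infinite Borel measure with $\int_{\mathbb R}\frac{d\sigma(\lambda)}{1+\lambda^2}=\frac{1+\kappa}{1-\kappa}$ (equivalently, $M(i)=i\frac{1+\kappa}{1-\kappa}$). *)

theory Defs
  imports "HOL-Analysis.Analysis"
begin

definition abs_continuous_between :: "real \<Rightarrow> real \<Rightarrow> (real \<Rightarrow> complex) \<Rightarrow> bool" where
  "abs_continuous_between a b f \<longleftrightarrow>
     (\<forall>\<epsilon>>0. \<exists>\<delta>>0. \<forall>(n::nat) u v.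
        (\<forall>i<n. a \<le> u i \<and> u i \<le> v i \<and> v i \<le> b) \<and>
        disjoint_family_on (\<lambda>i. {u i<..<v i}) {..<n} \<and>
        (\<Sum>i<n. v i - u i) < \<delta> \<longrightarrow>
        (\<Sum>i<n. norm (f (v i) - f (u i))) < \<epsilon>)"

definition locally_abs_continuous :: "real \<Rightarrow> (real \<Rightarrow> complex) \<Rightarrow> bool" where
  "locally_abs_continuous l f \<longleftrightarrow> (\<forall>b\<ge>l. abs_continuous_between l b f)"

definition locally_summable :: "real \<Rightarrow> (real \<Rightarrow> real) \<Rightarrow> bool" where
  "locally_summable l q \<longleftrightarrow> (\<forall>b\<ge>l. q absolutely_integrable_on {l..b})"

text \<open>The derivative on the half-line; it is one-sided at the end point.\<close>

definition hderiv :: "real \<Rightarrow> (real \<Rightarrow> complex) \<Rightarrow> real \<Rightarrow> complex" where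
  "hderiv l y x = vector_derivative y (at x within {l..})"

text \<open>Functions whose derivative exists everywhere on the half-line and which are locally
  absolutely continuous together with it. The second derivative then exists almost everywhere;
  its values elsewhere are irrelevant.\<close>

definition smooth_enough :: "real \<Rightarrow> (real \<Rightarrow> complex) \<Rightarrow> bool" where
  "smooth_enough l y \<longleftrightarrow>
     (\<forall>x\<ge>l. y differentiable (at x within {l..})) \<and>
     locally_abs_continuous l y \<and> locally_abs_continuous l (hderiv l y)"

definition schroedinger_expr ::
    "real \<Rightarrow> (real \<Rightarrow> real) \<Rightarrow> (real \<Rightarrow> complex) \<Rightarrow> real \<Rightarrow> complex" where
  "schroedinger_expr l q y x = - hderiv l (hderiv l y) x + of_real (q x) * y x"

text \<open>Elements are represented by functions, with equality almost everywhere on \<open>{l..}\<close>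
  used explicitly where it matters.\<close>

definition L2 :: "real \<Rightarrow> (real \<Rightarrow> complex) set" where
  "L2 l = {f. f \<in> borel_measurable (lebesgue_on {l..}) \<and>
              integrable (lebesgue_on {l..}) (\<lambda>x. (norm (f x))\<^sup>2)}"

definition L2_inner :: "real \<Rightarrow> (real \<Rightarrow> complex) \<Rightarrow> (real \<Rightarrow> complex) \<Rightarrow> complex" where
  "L2_inner l f g = (\<integral>x. f x * cnj (g x) \<partial>(lebesgue_on {l..}))"

definition L2_dense :: "real \<Rightarrow> (real \<Rightarrow> complex) set \<Rightarrow> bool" where
  "L2_dense l S \<longleftrightarrow>
     (\<forall>f\<in>L2 l. \<forall>\<epsilon>>0. \<exists>y\<in>S. (\<integral>x. (norm (f x - y x))\<^sup>2 \<partial>(lebesgue_on {l..})) < \<epsilon>)"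

definition has_L2_dimension :: "real \<Rightarrow> (real \<Rightarrow> complex) set \<Rightarrow> nat \<Rightarrow> bool" where
  "has_L2_dimension l N n \<longleftrightarrow>
     (\<exists>b. (\<forall>i<n. b i \<in> N) \<and>
          (\<forall>c::nat \<Rightarrow> complex.
              (AE x in lebesgue_on {l..}. (\<Sum>i<n. c i * b i x) = 0) \<longrightarrow> (\<forall>i<n. c i = 0)) \<and>
          (\<forall>f\<in>N. \<exists>c::nat \<Rightarrow> complex.
              AE x in lebesgue_on {l..}. f x = (\<Sum>i<n. c i * b i x)))"

definition symmetric_operator ::
    "real \<Rightarrow> (real \<Rightarrow> complex) set \<Rightarrow> ((real \<Rightarrow> complex) \<Rightarrow> (real \<Rightarrow> complex)) \<Rightarrow> bool" where
  "symmetric_operator l S A \<longleftrightarrow>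
     S \<subseteq> L2 l \<and> A ` S \<subseteq> L2 l \<and> L2_dense l S \<and>
     (\<forall>y\<in>S. \<forall>z\<in>S. L2_inner l (A y) z = L2_inner l y (A z))"

definition adjoint_graph ::
    "real \<Rightarrow> (real \<Rightarrow> complex) set \<Rightarrow> ((real \<Rightarrow> complex) \<Rightarrow> (real \<Rightarrow> complex)) \<Rightarrow>
     ((real \<Rightarrow> complex) \<times> (real \<Rightarrow> complex)) set" where
  "adjoint_graph l S A =
     {(f, g). f \<in> L2 l \<and> g \<in> L2 l \<and> (\<forall>y\<in>S. L2_inner l (A y) f = L2_inner l y g)}"

definition defect_space ::
    "real \<Rightarrow> (real \<Rightarrow> complex) set \<Rightarrow> ((real \<Rightarrow> complex) \<Rightarrow> (real \<Rightarrow> complex)) \<Rightarrow> complex \<Rightarrow>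
     (real \<Rightarrow> complex) set" where
  "defect_space l S A z = {f. (f, \<lambda>x. z * f x) \<in> adjoint_graph l S A}"

definition has_deficiency_indices ::
    "real \<Rightarrow> (real \<Rightarrow> complex) set \<Rightarrow> ((real \<Rightarrow> complex) \<Rightarrow> (real \<Rightarrow> complex)) \<Rightarrow>
     nat \<Rightarrow> nat \<Rightarrow> bool" where
  "has_deficiency_indices l S A n1 n2 \<longleftrightarrow>
     symmetric_operator l S A \<and>
     has_L2_dimension l (defect_space l S A \<i>) n1 \<and>
     has_L2_dimension l (defect_space l S A (- \<i>)) n2"

text \<open>The maximal domain, which is also the space \<open>\<H>\<^sub>+\<close>. Its elements are normalised to vanish
  to the left of \<open>l\<close>, so that each has a unique representing function.\<close>

definition max_domain :: "real \<Rightarrow> (real \<Rightarrow> real) \<Rightarrow> (real \<Rightarrow> complex) set" where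
  "max_domain l q =
     {y \<in> L2 l. smooth_enough l y \<and> schroedinger_expr l q y \<in> L2 l \<and> (\<forall>x<l. y x = 0)}"

definition min_domain :: "real \<Rightarrow> (real \<Rightarrow> real) \<Rightarrow> (real \<Rightarrow> complex) set" where
  "min_domain l q = {y \<in> max_domain l q. y l = 0 \<and> hderiv l y l = 0}"

definition is_solution ::
    "real \<Rightarrow> (real \<Rightarrow> real) \<Rightarrow> complex \<Rightarrow> (real \<Rightarrow> complex) \<Rightarrow> bool" where
  "is_solution l q z y \<longleftrightarrow>
     smooth_enough l y \<and> (AE x in lebesgue_on {l..}. schroedinger_expr l q y x = z * y x)"

definition weyl_function :: "real \<Rightarrow> (real \<Rightarrow> real) \<Rightarrow> (complex \<Rightarrow> complex) \<Rightarrow> bool" where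
  "weyl_function l q m \<longleftrightarrow>
     (\<forall>z. Im z \<noteq> 0 \<longrightarrow>
        (\<exists>\<phi>1 \<phi>2. is_solution l q z \<phi>1 \<and> \<phi>1 l = 0 \<and> hderiv l \<phi>1 l = 1 \<and>
                 is_solution l q z \<phi>2 \<and> \<phi>2 l = -1 \<and> hderiv l \<phi>2 l = 0 \<and>
                 (\<lambda>x. \<phi>2 x + m z * \<phi>1 x) \<in> L2 l))"

text \<open>An element \<open>F\<close> of \<open>\<H>\<^sub>-\<close> is represented by the antilinear functional
  \<open>v \<mapsto> (F, v) = cnj (v, F)\<close> on \<open>\<H>\<^sub>+\<close>, so that the linear structure is pointwise and
  \<open>f \<in> \<H>\<close> corresponds to \<open>L2_inner l f\<close>. The graph norm of \<open>\<H>\<^sub>+\<close> only decides which functionals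
  are bounded and is not needed to evaluate the operators below.\<close>

type_synonym functional = "(real \<Rightarrow> complex) \<Rightarrow> complex"

record lsystem =
  plus_space :: "(real \<Rightarrow> complex) set"
  inner_H :: "(real \<Rightarrow> complex) \<Rightarrow> functional"
  state_op :: "(real \<Rightarrow> complex) \<Rightarrow> functional"
  channel_op :: "complex \<Rightarrow> functional"

text \<open>The adjoint of \<open>\<A> : \<H>\<^sub>+ \<rightarrow> \<H>\<^sub>-\<close> satisfies \<open>(\<A>\<^sup>* y, v) = cnj (\<A> v, y)\<close>.\<close>

definition adjoint_op ::
    "((real \<Rightarrow> complex) \<Rightarrow> functional) \<Rightarrow> (real \<Rightarrow> complex) \<Rightarrow> functional" where
  "adjoint_op A y v = cnj (A v y)"

definition real_part_op ::
    "((real \<Rightarrow> complex) \<Rightarrow> functional) \<Rightarrow> (real \<Rightarrow> complex) \<Rightarrow> functional" where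
  "real_part_op A y v = (A y v + adjoint_op A y v) / 2"

text \<open>The adjoint \<open>K\<^sup>* : \<H>\<^sub>+ \<rightarrow> \<complex>\<close> satisfies \<open>(K c, y) = c * cnj (K\<^sup>* y)\<close>.\<close>

definition channel_adjoint :: "lsystem \<Rightarrow> (real \<Rightarrow> complex) \<Rightarrow> complex" where
  "channel_adjoint \<Theta> y = cnj (channel_op \<Theta> 1 y)"

text \<open>The solution in \<open>\<H>\<^sub>+\<close> of \<open>(B - z I) y = F\<close>, an equation in \<open>\<H>\<^sub>-\<close>.\<close>

definition resolvent_op ::
    "lsystem \<Rightarrow> ((real \<Rightarrow> complex) \<Rightarrow> functional) \<Rightarrow> complex \<Rightarrow> functional \<Rightarrow> (real \<Rightarrow> complex)" where
  "resolvent_op \<Theta> B z F =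
     (THE y. y \<in> plus_space \<Theta> \<and>
             (\<forall>v\<in>plus_space \<Theta>. B y v - z * inner_H \<Theta> y v = F v))"

definition transfer_function :: "lsystem \<Rightarrow> complex \<Rightarrow> complex" where
  "transfer_function \<Theta> z =
     1 - 2 * \<i> * channel_adjoint \<Theta> (resolvent_op \<Theta> (state_op \<Theta>) z (channel_op \<Theta> 1))"

definition impedance_function :: "lsystem \<Rightarrow> complex \<Rightarrow> complex" where
  "impedance_function \<Theta> z =
     channel_adjoint \<Theta> (resolvent_op \<Theta> (real_part_op (state_op \<Theta>)) z (channel_op \<Theta> 1))"

definition c_entropy :: "lsystem \<Rightarrow> ereal" where
  "c_entropy \<Theta> =
     (if transfer_function \<Theta> (- \<i>) = 0 then \<infinity>
      else ereal (- ln (norm (transfer_function \<Theta> (- \<i>)))))"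

datatype boundary_param = Fin real | Infty

definition delta :: "real \<Rightarrow> functional" where
  "delta l v = cnj (v l)"

definition delta' :: "real \<Rightarrow> functional" where
  "delta' l v = - cnj (hderiv l v l)"

text \<open>For \<open>Infty\<close> the formulas are the limits of those for \<open>Fin \<mu>\<close> as \<open>\<mu> \<rightarrow> +\<infinity>\<close>.\<close>

fun schroedinger_state_op ::
    "real \<Rightarrow> (real \<Rightarrow> real) \<Rightarrow> boundary_param \<Rightarrow> complex \<Rightarrow> (real \<Rightarrow> complex) \<Rightarrow> functional" where
  "schroedinger_state_op l q (Fin \<mu>) h y v =
     L2_inner l (schroedinger_expr l q y) v
     - 1 / (of_real \<mu> - h) * (hderiv l y l - h * y l) * (of_real \<mu> * delta l v + delta' l v)"
| "schroedinger_state_op l q Infty h y v =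
     L2_inner l (schroedinger_expr l q y) v - (hderiv l y l - h * y l) * delta l v"

fun channel_vector :: "real \<Rightarrow> boundary_param \<Rightarrow> complex \<Rightarrow> functional" where
  "channel_vector l (Fin \<mu>) h v =
     of_real (sqrt (Im h) / norm (of_real \<mu> - h)) * (of_real \<mu> * delta l v + delta' l v)"
| "channel_vector l Infty h v = of_real (sqrt (Im h)) * delta l v"

definition schroedinger_lsystem ::
    "real \<Rightarrow> (real \<Rightarrow> real) \<Rightarrow> boundary_param \<Rightarrow> complex \<Rightarrow> lsystem" where
  "schroedinger_lsystem l q \<mu> h =
     \<lparr> plus_space = max_domain l q,
       inner_H = L2_inner l,
       state_op = schroedinger_state_op l q \<mu> h,
       channel_op = (\<lambda>c v. c * channel_vector l \<mu> h v) \<rparr>"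

text \<open>Herglotz--Nevanlinna functions are functions on the non-real complex numbers; the values
  on the real axis are irrelevant.\<close>

definition herglotz_nevanlinna :: "(complex \<Rightarrow> complex) \<Rightarrow> bool" where
  "herglotz_nevanlinna M \<longleftrightarrow>
     M holomorphic_on {z. Im z \<noteq> 0} \<and>
     (\<forall>z. Im z \<noteq> 0 \<longrightarrow> M (cnj z) = cnj (M z)) \<and>
     (\<forall>z. Im z > 0 \<longrightarrow> Im (M z) \<ge> 0)"

definition donoghue_class_inv :: "real \<Rightarrow> (complex \<Rightarrow> complex) set" where
  "donoghue_class_inv \<kappa> =
     {M. herglotz_nevanlinna M \<and>
         0 \<le> \<kappa> \<and> \<kappa> < 1 \<and>
         (\<exists>\<sigma>::real measure. sets \<sigma> = sets borel \<and> emeasure \<sigma> UNIV = \<infinity> \<and>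
            has_bochner_integral \<sigma> (\<lambda>t. 1 / (1 + t\<^sup>2)) ((1 + \<kappa>) / (1 - \<kappa>)) \<and>
            (\<forall>z. Im z \<noteq> 0 \<longrightarrow>
               M z = (\<integral>t. (1 / (of_real t - z) - of_real (t / (1 + t\<^sup>2))) \<partial>\<sigma>)))}"

definition admissible_params ::
    "real \<Rightarrow> (real \<Rightarrow> real) \<Rightarrow> real \<Rightarrow> (boundary_param \<times> complex) set" where
  "admissible_params l q D =
     {(\<mu>, h). Im h = D \<and>
        (\<exists>\<kappa>. 0 < \<kappa> \<and> \<kappa> < 1 \<and>
           impedance_function (schroedinger_lsystem l q \<mu> h) \<in> donoghue_class_inv \<kappa>)}"

definition has_max_finite_c_entropy ::
    "real \<Rightarrow> (real \<Rightarrow> real) \<Rightarrow> real \<Rightarrow> boundary_param \<Rightarrow> complex \<Rightarrow> bool" where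
  "has_max_finite_c_entropy l q D \<mu> h \<longleftrightarrow>
     (\<mu>, h) \<in> admissible_params l q D \<and>
     c_entropy (schroedinger_lsystem l q \<mu> h) < \<infinity> \<and>
     (\<forall>(\<mu>', h') \<in> admissible_params l q D.
        c_entropy (schroedinger_lsystem l q \<mu>' h') \<le> c_entropy (schroedinger_lsystem l q \<mu> h))"

end

theory Submission
  imports Defs "HOL-Probability.Probability" "HOL-Complex_Analysis.Complex_Analysis"
begin

text \<open>Everything is expressed through the Weyl function \<open>m\<close>. The Weyl solution
\<open>\<psi>\<^sub>z = \<phi>\<^sub>2 + m z \<phi>\<^sub>1\<close> lies in the maximal domain and satisfies \<open>l(\<psi>\<^sub>z) = z \<psi>\<^sub>z\<close>, so the
resolvent equation of an L-system, whose right-hand side is a boundary functional, is solved by a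
multiple of \<open>\<psi>\<^sub>z\<close>; the solution is unique because the real part of the state operator is symmetric
and its imaginary part is non-negative. Hence impedance and transfer function are fractional linear
functions of \<open>m z\<close> (lemmas \<open>impedance_value\<close> and \<open>transfer_value\<close>), and
\<open>\<bar>W(- \<i>)\<bar> = \<bar>m \<i> + h\<bar> / \<bar>m \<i> + cnj h\<bar>\<close>. For fixed \<open>Im h = D\<close> this makes the c-entropy a strictly
decreasing function of \<open>(Re (m \<i>) + Re h)\<^sup>2\<close> that does not depend on \<open>\<mu>\<close>; it is finite everywhere
since \<open>D \<noteq> - Im (m \<i>)\<close>. So the maximum can only sit at \<open>Re h = - Re (m \<i>)\<close>. There a function in the
generalised Donoghue class has the value \<open>V \<i> = \<i> (1 + \<kappa>) / (1 - \<kappa>)\<close>, and comparing real and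
imaginary parts leaves a single \<open>\<mu>\<close>, decided by the sign of \<open>D + Im (m \<i>)\<close> (lemma
\<open>admissible_at_critical_h\<close>).

The analytic work is to show that this one system does belong to the class (lemma
\<open>critical_lsystem_admissible\<close>). Its impedance is \<open>- (m z - Re (m \<i>)) / D\<close> or
\<open>D / (m z - Re (m \<i>))\<close>, and such a function needs an integral representation without linear term by
an infinite measure. The representation is Herglotz's theorem, obtained from the Schwarz formula on
the disc and Helly's selection theorem. The two remaining properties are growth conditions along
the imaginary axis, \<open>Im N(\<i>y) = o(y)\<close> and \<open>y Im N(\<i>y)\<close> unbounded (theorem
\<open>Donoghue_class_criterion\<close>). Both follow without any asymptotics of solutions from the identity
\<open>(z - cnj w) \<langle>u\<^sub>z, u\<^sub>w\<rangle> = N z - cnj (N w)\<close>, satisfied by \<open>\<psi>\<^sub>z\<close> with \<open>N = - m\<close> and by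
\<open>\<psi>\<^sub>z / (m z - a)\<close> with \<open>N = 1 / (m - a)\<close>: since the minimal domain is dense, bounded families of
multiples of \<open>u\<^sub>\<i>\<^sub>y\<close> tend weakly to zero. For the first condition this is applied to \<open>u\<^sub>\<i>\<^sub>y\<close>
itself. If the second failed, it would also apply to \<open>\<i>y u\<^sub>\<i>\<^sub>y\<close>, and Green's formula against a
fixed function would force a boundary form to vanish that is constantly one.

Green's formula without a boundary term at infinity holds because every function of the maximal
domain is the sum of one in the minimal domain and one of compact support; the former pair off by
symmetry of the minimal operator, the latter by integration by parts. Integration by parts rests on
the fundamental theorem of calculus for absolutely continuous functions, which is derived from the
Radon-Nikodym and Lebesgue differentiation theorems.\<close>

section \<open>Absolutely continuous functions\<close>

abbreviation increments :: "(real \<Rightarrow> 'a::real_normed_vector) \<Rightarrow> 'i set \<Rightarrow> ('i \<Rightarrow> real) \<Rightarrow> ('i \<Rightarrow> real) \<Rightarrow> real" where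
  "increments f I u v \<equiv> (\<Sum>i\<in>I. norm (f (v i) - f (u i)))"

abbreviation total_length :: "'i set \<Rightarrow> ('i \<Rightarrow> real) \<Rightarrow> ('i \<Rightarrow> real) \<Rightarrow> real" where
  "total_length I u v \<equiv> (\<Sum>i\<in>I. v i - u i)"

abbreviation disjoint_intervals :: "'i set \<Rightarrow> ('i \<Rightarrow> real) \<Rightarrow> ('i \<Rightarrow> real) \<Rightarrow> bool" where
  "disjoint_intervals I u v \<equiv> disjoint_family_on (\<lambda>i. {u i<..<v i}) I"

definition interval_family :: "real \<Rightarrow> real \<Rightarrow> nat \<Rightarrow> (nat \<Rightarrow> real) \<Rightarrow> (nat \<Rightarrow> real) \<Rightarrow> bool" where
  "interval_family c d n u v \<longleftrightarrow>
     (\<forall>i<n. c \<le> u i \<and> u i \<le> v i \<and> v i \<le> d) \<and>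
     disjoint_intervals {..<n} u v"

text \<open>Absolute continuity on the whole line. A function on an interval is extended by constants, so
that no end points have to be tracked in the construction of its density.\<close>

definition globally_ac :: "(real \<Rightarrow> 'a::real_normed_vector) \<Rightarrow> bool" where
  "globally_ac f \<longleftrightarrow>
     (\<forall>\<epsilon>>0. \<exists>\<delta>>0. \<forall>(n::nat) u v.
        (\<forall>i<n. u i \<le> v i) \<and> disjoint_intervals {..<n} u v \<and>
        total_length {..<n} u v < \<delta> \<longrightarrow> increments f {..<n} u v < \<epsilon>)"

lemma disjoint_family_on_mono_sets:
  assumes "disjoint_family_on A I" "\<And>i. i \<in> I \<Longrightarrow> B i \<subseteq> A i"
  shows "disjoint_family_on B I"
  using assms unfolding disjoint_family_on_def by blast

text \<open>The definition speaks of families indexed by numbers; double sums and countable coverings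
call for other index types, over which a definition cannot quantify.\<close>

lemma globally_ac_finite:
  assumes "globally_ac f" "\<epsilon> > 0"
  shows "\<exists>\<delta>>0. \<forall>(I::'i set) u v. finite I \<and> (\<forall>i\<in>I. u i \<le> v i) \<and>
        disjoint_intervals I u v \<and> total_length I u v < \<delta> \<longrightarrow>
        increments f I u v < \<epsilon>"
proof -
  from assms obtain \<delta> where d: "\<delta> > 0" and H: "\<And>(n::nat) u v.
        (\<forall>i<n. u i \<le> v i) \<and> disjoint_intervals {..<n} u v \<and>
        total_length {..<n} u v < \<delta> \<Longrightarrow> increments f {..<n} u v < \<epsilon>"
    unfolding globally_ac_def by meson
  show ?thesis
  proof (intro exI conjI allI impI; (elim conjE)?)
    show "\<delta> > 0" by (rule d)
    fix I :: "'i set" and u v :: "'i \<Rightarrow> real"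
    assume fin: "finite I" and uv: "\<forall>i\<in>I. u i \<le> v i"
      and dis: "disjoint_intervals I u v" and small: "total_length I u v < \<delta>"
    obtain e where e: "bij_betw e {..<card I} I"
      using fin bij_betw_from_nat_into_finite by blast
    have eI: "e i \<in> I" if "i < card I" for i
      using e that by (auto simp: bij_betw_def)
    have "(\<Sum>i<card I. norm (f ((v \<circ> e) i) - f ((u \<circ> e) i))) < \<epsilon>"
    proof (rule H, intro conjI allI impI)
      show "(u \<circ> e) i \<le> (v \<circ> e) i" if "i < card I" for i using uv eI that by auto
      show "disjoint_family_on (\<lambda>i. {(u \<circ> e) i<..<(v \<circ> e) i}) {..<card I}"
        unfolding disjoint_family_on_def
      proof (intro ballI impI)
        fix i j assume ij: "i \<in> {..<card I}" "j \<in> {..<card I}" "i \<noteq> j"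
        then have "e i \<noteq> e j" "e i \<in> I" "e j \<in> I"
          using e eI by (auto simp: bij_betw_def inj_on_def)
        then have "{u (e i)<..<v (e i)} \<inter> {u (e j)<..<v (e j)} = {}"
          using dis unfolding disjoint_family_on_def by blast
        then show "{(u \<circ> e) i<..<(v \<circ> e) i} \<inter> {(u \<circ> e) j<..<(v \<circ> e) j} = {}" by simp
      qed
      have "(\<Sum>i<card I. (v \<circ> e) i - (u \<circ> e) i) = total_length I u v"
        using sum.reindex_bij_betw[OF e, of "\<lambda>i. v i - u i"] by simp
      then show "(\<Sum>i<card I. (v \<circ> e) i - (u \<circ> e) i) < \<delta>" using small by simp
    qed
    moreover have "(\<Sum>i<card I. norm (f ((v \<circ> e) i) - f ((u \<circ> e) i))) =
        increments f I u v"
      using sum.reindex_bij_betw[OF e, of "\<lambda>i. norm (f (v i) - f (u i))"] by simp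
    ultimately show "increments f I u v < \<epsilon>" by simp
  qed
qed

lemma globally_ac_continuous:
  assumes "globally_ac f"
  shows "continuous_on UNIV f"
  unfolding continuous_on_iff
proof (intro ballI allI impI)
  fix x \<epsilon> :: real assume "\<epsilon> > 0"
  obtain \<delta> where d: "\<delta> > 0" and H: "\<forall>(I::unit set) u v. finite I \<and> (\<forall>i\<in>I. u i \<le> v i) \<and>
        disjoint_intervals I u v \<and> total_length I u v < \<delta> \<longrightarrow>
        increments f I u v < \<epsilon>"
      using globally_ac_finite[OF assms \<open>\<epsilon> > 0\<close>, where 'i=unit] by blast
  have "dist (f x') (f x) < \<epsilon>" if "dist x' x < \<delta>" for x'
  proof -
    have "max x x' - min x x' < \<delta>"
      using that by (auto simp: dist_real_def min_def max_def abs_if split: if_splits)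
    then have "norm (f (max x x') - f (min x x')) < \<epsilon>"
      using H[rule_format, of UNIV "\<lambda>_. min x x'" "\<lambda>_. max x x'"]
      by (auto simp: disjoint_family_on_def)
    then show ?thesis by (cases "x \<le> x'") (auto simp: dist_norm norm_minus_commute)
  qed
  then show "\<exists>d>0. \<forall>x'\<in>UNIV. dist x' x < d \<longrightarrow> dist (f x') (f x) < \<epsilon>"
    using d by blast
qed

lemma sum_lengths_disjoint_intervals:
  assumes "finite I" "\<And>i. i \<in> I \<Longrightarrow> c \<le> u i \<and> u i \<le> v i \<and> v i \<le> (d::real)"
    and "disjoint_intervals I u v" "c \<le> d"
  shows "total_length I u v \<le> d - c"
proof -
  have "total_length I u v = (\<Sum>i\<in>I. measure lborel {u i<..<v i})"
    using assms by (intro sum.cong) auto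
  also have "\<dots> = measure lborel (\<Union>i\<in>I. {u i<..<v i})"
    using assms by (intro measure_finite_Union[symmetric]) auto
  also have "\<dots> \<le> measure lborel {c..d}"
  proof (rule measure_mono_fmeasurable)
    show "(\<Union>i\<in>I. {u i<..<v i}) \<subseteq> {c..d}" using assms(2) by force
    show "{c..d} \<in> fmeasurable lborel" using fmeasurable_cbox[of c d] by simp
  qed (use assms in auto)
  finally show ?thesis using assms by simp
qed

definition variation :: "(real \<Rightarrow> 'a::real_normed_vector) \<Rightarrow> real \<Rightarrow> real \<Rightarrow> real" where
  "variation f c d = Sup {increments f {..<n} u v | n u v. interval_family c d n u v}"

definition variation_bounded :: "(real \<Rightarrow> 'a::real_normed_vector) \<Rightarrow> real \<Rightarrow> real \<Rightarrow> real \<Rightarrow> bool" where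
  "variation_bounded f c d B \<longleftrightarrow>
     (\<forall>n u v. interval_family c d n u v \<longrightarrow> increments f {..<n} u v \<le> B)"

lemma variation_set_nonempty:
  "{increments f {..<n} u v | n u v. interval_family c d n u v} \<noteq> {}"
proof -
  have "interval_family c d 0 (\<lambda>_. 0) (\<lambda>_. 0)"
    by (simp add: interval_family_def disjoint_family_on_def)
  then show ?thesis by blast
qed

lemma variation_le:
  assumes "variation_bounded f c d B"
  shows "variation f c d \<le> B"
  unfolding variation_def
proof (rule cSup_least[OF variation_set_nonempty])
  fix x assume "x \<in> {increments f {..<n} u v | n u v. interval_family c d n u v}"
  then show "x \<le> B" using assms by (auto simp: variation_bounded_def)
qed

lemma variation_bounded_variation:
  assumes "variation_bounded f c d B"
  shows "variation_bounded f c d (variation f c d)"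
  unfolding variation_bounded_def variation_def
proof (intro allI impI cSup_upper)
  show "bdd_above {increments f {..<n} u v | n u v. interval_family c d n u v}"
    using assms by (auto simp: variation_bounded_def bdd_above_def)
qed blast

text \<open>Every interval of a family is cut at \<open>e\<close> by taking minima and maxima with \<open>e\<close>. Intervals that
do not contain \<open>e\<close> contribute a degenerate piece, so no case distinction on the family arises.\<close>

lemma variation_bounded_split:
  assumes "variation_bounded f c e B1" "variation_bounded f e d B2" "c \<le> e" "e \<le> d"
  shows "variation_bounded f c d (B1 + B2)"
  unfolding variation_bounded_def
proof (intro allI impI)
  fix n u v assume F: "interval_family c d n u v"
  have "interval_family c e n (\<lambda>i. min (u i) e) (\<lambda>i. min (v i) e)"
    using F assms unfolding interval_family_def
    by (auto elim!: disjoint_family_on_mono_sets simp: min_def split: if_splits)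
  then have 1: "(\<Sum>i<n. norm (f (min (v i) e) - f (min (u i) e))) \<le> B1"
    using assms(1) by (simp add: variation_bounded_def)
  have "interval_family e d n (\<lambda>i. max (u i) e) (\<lambda>i. max (v i) e)"
    using F assms unfolding interval_family_def
    by (auto elim!: disjoint_family_on_mono_sets simp: max_def split: if_splits)
  then have 2: "(\<Sum>i<n. norm (f (max (v i) e) - f (max (u i) e))) \<le> B2"
    using assms(2) by (simp add: variation_bounded_def)
  have "norm (f (v i) - f (u i)) \<le>
      norm (f (min (v i) e) - f (min (u i) e)) + norm (f (max (v i) e) - f (max (u i) e))"
    if "i < n" for i
  proof -
    have "u i \<le> v i" using F that by (auto simp: interval_family_def)
    then show ?thesis
      using norm_triangle_ineq[of "f e - f (u i)" "f (v i) - f e"]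
      by (auto simp: min_def max_def)
  qed
  then have "increments f {..<n} u v \<le> (\<Sum>i<n. norm (f (min (v i) e) - f (min (u i) e))) +
      (\<Sum>i<n. norm (f (max (v i) e) - f (max (u i) e)))"
    unfolding sum.distrib[symmetric] by (intro sum_mono) auto
  with 1 2 show "increments f {..<n} u v \<le> B1 + B2" by linarith
qed

text \<open>On intervals shorter than the \<open>\<delta>\<close> belonging to \<open>\<epsilon> = 1\<close> the variation is at most one, and
finitely many of these cover \<open>{c..d}\<close>.\<close>

lemma variation_bounded_exists:
  assumes "globally_ac f" "c \<le> d"
  shows "\<exists>B. variation_bounded f c d B"
proof -
  obtain \<delta> where d: "\<delta> > 0" and H: "\<forall>(I::nat set) u v. finite I \<and> (\<forall>i\<in>I. u i \<le> v i) \<and>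
        disjoint_intervals I u v \<and> total_length I u v < \<delta> \<longrightarrow>
        increments f I u v < 1"
      using globally_ac_finite[OF assms(1) zero_less_one, where 'i="nat"] by blast
  have short: "variation_bounded f x y 1" if "x \<le> y" "y - x < \<delta>" for x y
    unfolding variation_bounded_def
  proof (intro allI impI)
    fix n u v assume F: "interval_family x y n u v"
    have "total_length {..<n} u v \<le> y - x"
      by (rule sum_lengths_disjoint_intervals) (use F that in \<open>auto simp: interval_family_def\<close>)
    then have "increments f {..<n} u v < 1"
      using F that by (intro H[rule_format]) (auto simp: interval_family_def)
    then show "increments f {..<n} u v \<le> 1" by simp
  qed
  have "\<exists>B. variation_bounded f c y B" if "c \<le> y" "y \<le> c + real k * (\<delta> / 2)" for k y
    using that
  proof (induction k arbitrary: y)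
    case 0
    then show ?case using short[of c y] d by auto
  next
    case (Suc k)
    define x where "x = max c (y - \<delta> / 2)"
    have x: "c \<le> x" "x \<le> y" "y - x < \<delta>" "x \<le> c + real k * (\<delta> / 2)"
      using Suc.prems d by (auto simp: x_def algebra_simps add_divide_distrib)
    with Suc.IH[of x] short[of x y] variation_bounded_split[of f c x _ y 1] show ?case by blast
  qed
  moreover obtain k :: nat where "(d - c) / (\<delta> / 2) \<le> real k" using real_arch_simple by blast
  then have "d \<le> c + real k * (\<delta> / 2)" using d by (simp add: field_simps)
  ultimately show ?thesis using assms by blast
qed

lemma variation_additive_le:
  assumes "globally_ac f" "c \<le> e" "e \<le> d"
  shows "variation f c d \<le> variation f c e + variation f e d"
  using assms variation_bounded_exists variation_bounded_variation variation_bounded_split variation_le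
  by metis

lemma variation_add_increment:
  assumes "globally_ac f" "c \<le> x" "x \<le> y"
  shows "variation f c x + norm (f y - f x) \<le> variation f c y"
proof -
  have "variation_bounded f c x (variation f c y - norm (f y - f x))"
    unfolding variation_bounded_def
  proof (intro allI impI)
    fix n u v assume F: "interval_family c x n u v"
    define u' v' where "u' = (\<lambda>i. if i < n then u i else x)" and "v' = (\<lambda>i. if i < n then v i else y)"
    have dis: "disjoint_family_on (\<lambda>i. {u' i<..<v' i}) {..<Suc n}"
      unfolding disjoint_family_on_def
    proof (intro ballI impI)
      fix i j assume ij: "i \<in> {..<Suc n}" "j \<in> {..<Suc n}" "i \<noteq> j"
      consider "i < n" "j < n" | "i < n" "j = n" | "i = n" "j < n"
        using ij by fastforce
      then show "{u' i<..<v' i} \<inter> {u' j<..<v' j} = {}"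
      proof cases
        case 1
        then have "{u i<..<v i} \<inter> {u j<..<v j} = {}"
          using F \<open>i \<noteq> j\<close> unfolding interval_family_def disjoint_family_on_def by blast
        then show ?thesis using 1 by (simp add: u'_def v'_def)
      next
        case 2
        then have "v i \<le> x" using F by (simp add: interval_family_def)
        then show ?thesis using 2 by (auto simp: u'_def v'_def)
      next
        case 3
        then have "v j \<le> x" using F by (simp add: interval_family_def)
        then show ?thesis using 3 by (auto simp: u'_def v'_def)
      qed
    qed
    have "interval_family c y (Suc n) u' v'"
      using F assms dis by (force simp: interval_family_def u'_def v'_def)
    then have "(\<Sum>i<Suc n. norm (f (v' i) - f (u' i))) \<le> variation f c y"
      using variation_bounded_exists[OF assms(1), of c y] variation_bounded_variation assms
      by (metis order.trans variation_bounded_def)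
    then show "increments f {..<n} u v \<le> variation f c y - norm (f y - f x)"
      by (simp add: u'_def v'_def)
  qed
  then show ?thesis using variation_le by fastforce
qed

text \<open>Choosing a nearly optimal family inside each of finitely many disjoint intervals gives again
one disjoint family whose total length is not larger. So the variation inherits absolute continuity.\<close>

lemma variation_small_on_small_families:
  assumes f: "globally_ac f" and "\<epsilon> > 0"
  obtains \<delta> where "\<delta> > 0"
    "\<And>(n::nat) u v. (\<And>i. i < n \<Longrightarrow> u i \<le> v i) \<Longrightarrow>
        disjoint_intervals {..<n} u v \<Longrightarrow> total_length {..<n} u v < \<delta> \<Longrightarrow>
        (\<Sum>i<n. variation f (u i) (v i)) \<le> \<epsilon>"
proof -
  obtain \<delta> where d: "\<delta> > 0" and H: "\<forall>(I::(nat\<times>nat) set) u v. finite I \<and> (\<forall>i\<in>I. u i \<le> v i) \<and>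
        disjoint_intervals I u v \<and> total_length I u v < \<delta> \<longrightarrow>
        increments f I u v < \<epsilon>"
      using globally_ac_finite[OF f \<open>\<epsilon> > 0\<close>, where 'i="(nat\<times>nat)"] by blast
  show thesis
  proof (rule that[OF d])
    fix n :: nat and u v :: "nat \<Rightarrow> real"
    assume uv: "\<And>i. i < n \<Longrightarrow> u i \<le> v i" and dis: "disjoint_intervals {..<n} u v"
      and small: "total_length {..<n} u v < \<delta>"
    show "(\<Sum>i<n. variation f (u i) (v i)) \<le> \<epsilon>"
    proof (rule field_le_epsilon)
      fix \<eta> :: real assume "\<eta> > 0"
      define \<eta>' where "\<eta>' = \<eta> / (real n + 1)"
      have eta': "\<eta>' > 0" using \<open>\<eta> > 0\<close> by (simp add: \<eta>'_def)
      have "\<exists>k x y. interval_family (u i) (v i) k x y \<and>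
          variation f (u i) (v i) - \<eta>' < (\<Sum>j<k. norm (f (y j) - f (x j)))" for i
      proof -
        have "variation f (u i) (v i) - \<eta>' < Sup {\<Sum>i<k. norm (f (y i) - f (x i)) | k x y. interval_family (u i) (v i) k x y}"
          using eta' by (simp add: variation_def)
        from less_cSupD[OF variation_set_nonempty this] show ?thesis by blast
      qed
      then obtain k x y where F: "\<And>i. interval_family (u i) (v i) (k i) (x i) (y i)"
        and G: "\<And>i. variation f (u i) (v i) - \<eta>' < (\<Sum>j<k i. norm (f (y i j) - f (x i j)))"
        by metis
      let ?I = "Sigma {..<n} (\<lambda>i. {..<k i})"
      define X Y where "X p = x (fst p) (snd p)" and "Y p = y (fst p) (snd p)" for p
      have sub: "u (fst p) \<le> X p" "X p \<le> Y p" "Y p \<le> v (fst p)" if "p \<in> ?I" for p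
        using F[of "fst p"] that by (auto simp: interval_family_def X_def Y_def)
      have dis2: "disjoint_family_on (\<lambda>p. {X p<..<Y p}) ?I"
        unfolding disjoint_family_on_def
      proof (intro ballI impI)
        fix p p' assume A: "p \<in> ?I" "p' \<in> ?I" "p \<noteq> p'"
        show "{X p<..<Y p} \<inter> {X p'<..<Y p'} = {}"
        proof (cases "fst p = fst p'")
          case True
          then have "snd p \<noteq> snd p'" using A by (auto simp: prod_eq_iff)
          moreover have "snd p \<in> {..<k (fst p)}" "snd p' \<in> {..<k (fst p)}"
            using A True by auto
          ultimately show ?thesis
            using F[of "fst p"] True unfolding interval_family_def disjoint_family_on_def X_def Y_def
            by metis
        next
          case False
          have "{X p<..<Y p} \<subseteq> {u (fst p)<..<v (fst p)}" "{X p'<..<Y p'} \<subseteq> {u (fst p')<..<v (fst p')}"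
            using sub[OF A(1)] sub[OF A(2)] by auto
          moreover have "{u (fst p)<..<v (fst p)} \<inter> {u (fst p')<..<v (fst p')} = {}"
            using dis A False unfolding disjoint_family_on_def by auto
          ultimately show ?thesis by blast
        qed
      qed
      have "(\<Sum>p\<in>?I. Y p - X p) = (\<Sum>i<n. \<Sum>j<k i. y i j - x i j)"
        by (subst sum.Sigma) (auto intro!: sum.cong simp: X_def Y_def)
      also have "\<dots> \<le> total_length {..<n} u v"
        using F uv by (intro sum_mono sum_lengths_disjoint_intervals) (auto simp: interval_family_def)
      finally have small2: "(\<Sum>p\<in>?I. Y p - X p) < \<delta>" using small by simp
      have "(\<Sum>p\<in>?I. norm (f (Y p) - f (X p))) < \<epsilon>"
        using H[rule_format, of ?I X Y] dis2 small2 sub by auto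
      moreover have "(\<Sum>p\<in>?I. norm (f (Y p) - f (X p))) =
          (\<Sum>i<n. \<Sum>j<k i. norm (f (y i j) - f (x i j)))"
        by (subst sum.Sigma) (auto intro!: sum.cong simp: X_def Y_def)
      ultimately have "(\<Sum>i<n. \<Sum>j<k i. norm (f (y i j) - f (x i j))) < \<epsilon>" by simp
      moreover have "(\<Sum>i<n. variation f (u i) (v i) - \<eta>') \<le> (\<Sum>i<n. \<Sum>j<k i. norm (f (y i j) - f (x i j)))"
        using G by (intro sum_mono) (simp add: less_imp_le)
      ultimately have "(\<Sum>i<n. variation f (u i) (v i)) \<le> \<epsilon> + real n * \<eta>'"
        by (simp add: sum_subtractf)
      also have "real n * \<eta>' \<le> \<eta>" using \<open>\<eta> > 0\<close> by (simp add: \<eta>'_def field_simps)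
      finally show "(\<Sum>i<n. variation f (u i) (v i)) \<le> \<epsilon> + \<eta>" by simp
    qed
  qed
qed

definition variation_from :: "real \<Rightarrow> (real \<Rightarrow> 'a::real_normed_vector) \<Rightarrow> real \<Rightarrow> real" where
  "variation_from a f x = (if a \<le> x then variation f a x else 0)"

lemma variation_nonneg: "globally_ac f \<Longrightarrow> a \<le> x \<Longrightarrow> 0 \<le> variation f a x"
proof -
  assume "globally_ac f" "a \<le> x"
  then obtain B where "variation_bounded f a x B" using variation_bounded_exists by blast
  then have "variation_bounded f a x (variation f a x)" by (rule variation_bounded_variation)
  moreover have "interval_family a x 0 (\<lambda>_. 0) (\<lambda>_. 0)"
    by (simp add: interval_family_def disjoint_family_on_def)
  ultimately show ?thesis unfolding variation_bounded_def by fastforce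
qed

text \<open>The variation is what makes a function a difference of monotone ones: adding it compensates
every decrease.\<close>

lemma variation_from_dominates:
  assumes f: "globally_ac f" and const: "\<And>x. x \<le> a \<Longrightarrow> f x = f a" and "x \<le> y"
  shows "norm (f y - f x) \<le> variation_from a f y - variation_from a f x"
proof -
  consider "a \<le> x" | "x < a" "a \<le> y" | "x < a" "y < a" by linarith
  then show ?thesis
  proof cases
    case 1
    then show ?thesis using variation_add_increment[OF f, of a x y] \<open>x \<le> y\<close> by (simp add: variation_from_def)
  next
    case 2
    then show ?thesis using variation_add_increment[OF f, of a a y] const[of x] variation_nonneg[OF f, of a a]
      by (simp add: variation_from_def)
  next
    case 3
    then show ?thesis using const[of x] const[of y] by (simp add: variation_from_def)
  qed
qed

lemma variation_from_increment_le:
  assumes f: "globally_ac f" and "x \<le> y"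
  shows "variation_from a f y - variation_from a f x \<le> variation f (max a x) (max a y)"
proof -
  consider "a \<le> x" | "x < a" "a \<le> y" | "x < a" "y < a" by linarith
  then show ?thesis
  proof cases
    case 1
    then show ?thesis using variation_additive_le[OF f, of a x y] \<open>x \<le> y\<close> by (simp add: variation_from_def)
  next
    case 2
    then show ?thesis by (simp add: variation_from_def)
  next
    case 3
    then show ?thesis using variation_nonneg[OF f, of a a] by (simp add: variation_from_def)
  qed
qed

lemma variation_from_globally_ac:
  assumes f: "globally_ac f" and const: "\<And>x. x \<le> a \<Longrightarrow> f x = f a"
  shows "globally_ac (variation_from a f)"
  unfolding globally_ac_def
proof (intro allI impI)
  fix \<epsilon> :: real assume "\<epsilon> > 0"
  then have "\<epsilon> / 2 > 0" by simp
  from variation_small_on_small_families[OF f this] obtain \<delta> where d: "\<delta> > 0"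
    and H: "\<And>(n::nat) u v. (\<And>i. i < n \<Longrightarrow> u i \<le> v i) \<Longrightarrow>
        disjoint_intervals {..<n} u v \<Longrightarrow> total_length {..<n} u v < \<delta> \<Longrightarrow>
        (\<Sum>i<n. variation f (u i) (v i)) \<le> \<epsilon> / 2" by blast
  show "\<exists>\<delta>>0. \<forall>(n::nat) u v.
        (\<forall>i<n. u i \<le> v i) \<and> disjoint_intervals {..<n} u v \<and>
        total_length {..<n} u v < \<delta> \<longrightarrow> (\<Sum>i<n. norm (variation_from a f (v i) - variation_from a f (u i))) < \<epsilon>"
  proof (intro exI conjI allI impI)
    fix n :: nat and u v :: "nat \<Rightarrow> real"
    assume A: "(\<forall>i<n. u i \<le> v i) \<and> disjoint_intervals {..<n} u v \<and> total_length {..<n} u v < \<delta>"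
    have "(\<Sum>i<n. norm (variation_from a f (v i) - variation_from a f (u i))) \<le>
        (\<Sum>i<n. variation f (max a (u i)) (max a (v i)))"
    proof (rule sum_mono)
      fix i assume "i \<in> {..<n}"
      then have "u i \<le> v i" using A by auto
      with variation_from_dominates[OF f const this] variation_from_increment_le[OF f this, of a]
      show "norm (variation_from a f (v i) - variation_from a f (u i)) \<le> variation f (max a (u i)) (max a (v i))"
        by (smt (verit) norm_ge_zero real_norm_def)
    qed
    also have "\<dots> \<le> \<epsilon> / 2"
    proof (rule H)
      show "disjoint_family_on (\<lambda>i. {max a (u i)<..<max a (v i)}) {..<n}"
        using A by (elim conjE disjoint_family_on_mono_sets) auto
      have "(\<Sum>i<n. max a (v i) - max a (u i)) \<le> total_length {..<n} u v"
        using A by (intro sum_mono) auto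
      then show "(\<Sum>i<n. max a (v i) - max a (u i)) < \<delta>" using A by linarith
    qed (use A in auto)
    finally show "(\<Sum>i<n. norm (variation_from a f (v i) - variation_from a f (u i))) < \<epsilon>"
      using \<open>\<epsilon> > 0\<close> by simp
  qed (use d in auto)
qed

lemma globally_ac_dominated:
  assumes G: "globally_ac G"
    and dom: "\<And>x y. x \<le> y \<Longrightarrow> norm (F y - F x) \<le> C * norm (G y - G x)" and "C > 0"
  shows "globally_ac F"
  unfolding globally_ac_def
proof (intro allI impI)
  fix \<epsilon> :: real assume "\<epsilon> > 0"
  then have "\<epsilon> / C > 0" using \<open>C > 0\<close> by simp
  with G obtain \<delta> where d: "\<delta> > 0" and H: "\<And>(n::nat) u v.
        (\<forall>i<n. u i \<le> v i) \<and> disjoint_intervals {..<n} u v \<and>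
        total_length {..<n} u v < \<delta> \<Longrightarrow> increments G {..<n} u v < \<epsilon> / C"
    unfolding globally_ac_def by meson
  show "\<exists>\<delta>>0. \<forall>(n::nat) u v.
        (\<forall>i<n. u i \<le> v i) \<and> disjoint_intervals {..<n} u v \<and>
        total_length {..<n} u v < \<delta> \<longrightarrow> increments F {..<n} u v < \<epsilon>"
  proof (intro exI conjI allI impI)
    fix n :: nat and u v :: "nat \<Rightarrow> real"
    assume A: "(\<forall>i<n. u i \<le> v i) \<and> disjoint_intervals {..<n} u v \<and> total_length {..<n} u v < \<delta>"
    have "increments F {..<n} u v \<le> (\<Sum>i<n. C * norm (G (v i) - G (u i)))"
      using A dom by (intro sum_mono) auto
    also have "\<dots> < \<epsilon>"
      using H[OF A] \<open>C > 0\<close> by (simp add: sum_distrib_left[symmetric] field_simps)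
    finally show "increments F {..<n} u v < \<epsilon>" .
  qed (use d in auto)
qed

text \<open>A Lebesgue null set lies in an open set of small measure, and the covering lemma turns this
into countably many non-overlapping intervals. Absolute continuity bounds the increments of \<open>F\<close>,
that is the Stieltjes measure, over any finitely many of them.\<close>

lemma interval_measure_absolutely_continuous:
  assumes F: "globally_ac F" and mono: "\<And>x y. x \<le> y \<Longrightarrow> F x \<le> (F y :: real)"
  shows "absolutely_continuous lborel (interval_measure F)"
  unfolding absolutely_continuous_def
proof
  fix N :: "real set" assume N: "N \<in> null_sets lborel"
  then have Nb: "N \<in> sets borel" and N0: "emeasure lborel N = 0" by auto
  let ?\<nu> = "interval_measure F"
  have contF: "continuous_on UNIV F" by (rule globally_ac_continuous[OF F])
  have Icc: "emeasure ?\<nu> {c..d} = ennreal (F d - F c)" if "c \<le> d" for c d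
    by (rule emeasure_interval_measure_Icc[OF that mono contF])
  have part: "emeasure ?\<nu> (N \<inter> {- real k..real k}) = 0" if "k > 0" for k :: nat
  proof -
    have "emeasure ?\<nu> (N \<inter> {- real k..real k}) \<le> ennreal \<epsilon>" if "\<epsilon> > 0" for \<epsilon>
    proof -
      obtain \<delta> where d: "\<delta> > 0" and H: "\<forall>(I::real set set) u v. finite I \<and> (\<forall>i\<in>I. u i \<le> v i) \<and>
        disjoint_intervals I u v \<and> total_length I u v < \<delta> \<longrightarrow>
        increments F I u v < \<epsilon>"
      using globally_ac_finite[OF F \<open>\<epsilon> > 0\<close>, where 'i="real set"] by blast
      obtain U where U: "open U" "N \<subseteq> U" "emeasure lborel (U - N) < ennreal \<delta>"
        by (rule outer_regular_lborel[OF Nb d])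
      have "emeasure lborel U \<le> emeasure lborel (U - N) + emeasure lborel N"
        using U Nb emeasure_subadditive[of "U - N" lborel N] by (simp add: Un_absorb2)
      then have Ud: "emeasure lborel U < ennreal \<delta>" using U N0 by simp
      \<comment> \<open>The gauge keeps every interval tagged in \<open>N\<close> inside \<open>U\<close>; off \<open>U\<close> any ball will do.\<close>
      define g where "g x = (if x \<in> U then U else ball x 1)" for x
      have "gauge g" using U by (auto simp: gauge_def g_def)
      have ne: "box (- real k) (real k) \<noteq> {}" using \<open>k > 0\<close> by simp
      have sub: "N \<inter> {- real k..real k} \<subseteq> cbox (- real k) (real k)" by simp
      have "\<exists>\<D>. countable \<D> \<and> (\<forall>K\<in>\<D>. interior K \<noteq> {} \<and> (\<exists>c d. K = cbox c d)) \<and>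
          pairwise (\<lambda>A B. interior A \<inter> interior B = {}) \<D> \<and>
          (\<forall>K\<in>\<D>. \<exists>x \<in> (N \<inter> {- real k..real k}) \<inter> K. K \<subseteq> g x) \<and>
          N \<inter> {- real k..real k} \<subseteq> \<Union>\<D>"
      proof (rule covering_lemma[OF sub ne \<open>gauge g\<close>])
        fix \<D> :: "real set set"
        assume D: "countable \<D>" "\<And>K. K \<in> \<D> \<Longrightarrow> interior K \<noteq> {} \<and> (\<exists>c d. K = cbox c d)"
          "pairwise (\<lambda>A B. interior A \<inter> interior B = {}) \<D>"
          "\<And>K. K \<in> \<D> \<Longrightarrow> \<exists>x \<in> (N \<inter> {- real k..real k}) \<inter> K. K \<subseteq> g x"
          "N \<inter> {- real k..real k} \<subseteq> \<Union>\<D>"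
        show ?thesis
          by (rule exI[of _ \<D>]) (rule conjI[OF D(1) conjI[OF ballI[OF D(2)] conjI[OF D(3) conjI[OF ballI[OF D(4)] D(5)]]]])
      qed
      then obtain \<D> where D: "countable \<D>"
          "\<forall>K\<in>\<D>. interior K \<noteq> {} \<and> (\<exists>c d. K = cbox c d)"
          "pairwise (\<lambda>A B. interior A \<inter> interior B = {}) \<D>"
          "\<forall>K\<in>\<D>. \<exists>x \<in> (N \<inter> {- real k..real k}) \<inter> K. K \<subseteq> g x"
          "N \<inter> {- real k..real k} \<subseteq> \<Union>\<D>"
        by (elim exE conjE)
      define c d :: "real set \<Rightarrow> real" where "c = Inf" and "d = Sup"
      have Kcd: "K = {c K..d K} \<and> c K \<le> d K" if "K \<in> \<D>" for K
      proof -
        have "interior K \<noteq> {}" "\<exists>x y. K = cbox x y" using bspec[OF D(2) that] by simp_all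
        then obtain x y where xy: "K = cbox x y" "interior K \<noteq> {}" by (elim exE)
        then have "x \<le> y" by (cases "x \<le> y") auto
        with xy(1) show ?thesis by (simp add: c_def d_def)
      qed
      have K: "K = {c K..d K}" if "K \<in> \<D>" for K
        by (rule conjunct1[OF Kcd[OF that]])
      have cd: "c K \<le> d K" if "K \<in> \<D>" for K
        by (rule conjunct2[OF Kcd[OF that]])
      have DU: "K \<subseteq> U" if "K \<in> \<D>" for K
        proof -
        have "\<exists>x. x \<in> N \<and> K \<subseteq> g x" using bspec[OF D(4) that] by auto
        then obtain x where "x \<in> N" "K \<subseteq> g x" by (elim exE conjE)
        moreover have "x \<in> U" using \<open>x \<in> N\<close> U(2) by blast
        ultimately show ?thesis by (simp add: g_def)
      qed
      have fsum: "(\<Sum>K\<in>I. emeasure ?\<nu> K) \<le> ennreal \<epsilon>" if I: "finite I" "I \<subseteq> \<D>" for I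
      proof -
        have dis: "disjoint_family_on (\<lambda>K. {c K<..<d K}) I"
          unfolding disjoint_family_on_def
        proof (intro ballI impI)
          fix A B assume "A \<in> I" "B \<in> I" "A \<noteq> B"
          then have "interior A \<inter> interior B = {}" using D(3) I unfolding pairwise_def by blast
          moreover have "interior A = {c A<..<d A}"
            by (subst K[OF subsetD[OF I(2) \<open>A \<in> I\<close>]]) simp
          moreover have "interior B = {c B<..<d B}"
            by (subst K[OF subsetD[OF I(2) \<open>B \<in> I\<close>]]) simp
          ultimately show "{c A<..<d A} \<inter> {c B<..<d B} = {}" by simp
        qed
        have "ennreal (\<Sum>K\<in>I. d K - c K) = (\<Sum>K\<in>I. emeasure lborel {c K<..<d K})"
          using cd I by (subst sum_ennreal[symmetric]) (auto intro!: sum.cong)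
        also have "\<dots> = emeasure lborel (\<Union>K\<in>I. {c K<..<d K})"
          using I dis by (intro sum_emeasure) auto
        also have "\<dots> \<le> emeasure lborel U"
        proof (rule emeasure_mono)
          have "{c K<..<d K} \<subseteq> K" if "K \<in> \<D>" for K by (subst (2) K[OF that]) auto
          then show "(\<Union>K\<in>I. {c K<..<d K}) \<subseteq> U" using DU I by blast
        qed (use U in auto)
        finally have "ennreal (\<Sum>K\<in>I. d K - c K) < ennreal \<delta>" using Ud by simp
        then have "(\<Sum>K\<in>I. d K - c K) < \<delta>" by (meson ennreal_leI leD not_le)
        then have "(\<Sum>K\<in>I. norm (F (d K) - F (c K))) < \<epsilon>"
          using I cd dis by (intro H[rule_format]) auto
        moreover have "(\<Sum>K\<in>I. emeasure ?\<nu> K) = ennreal (\<Sum>K\<in>I. norm (F (d K) - F (c K)))"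
        proof (subst sum_ennreal[symmetric])
          show "(\<Sum>K\<in>I. emeasure ?\<nu> K) = (\<Sum>K\<in>I. ennreal (norm (F (d K) - F (c K))))"
          proof (rule sum.cong)
            fix K' assume "K' \<in> I"
            then have kD: "K' \<in> \<D>" using I by blast
            note k = K[OF kD] cd[OF kD]
            have "emeasure ?\<nu> K' = emeasure ?\<nu> {c K'..d K'}" by (subst k(1)) (rule refl)
            also have "\<dots> = ennreal (F (d K') - F (c K'))" by (rule Icc[OF k(2)])
            finally show "emeasure ?\<nu> K' = ennreal (norm (F (d K') - F (c K')))"
              using mono[OF k(2)] by simp
          qed simp
        qed auto
        ultimately show ?thesis by (simp add: ennreal_leI)
      qed
      have meas: "K \<in> sets ?\<nu>" if "K \<in> \<D>" for K by (subst K[OF that]) simp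
      have "emeasure ?\<nu> (N \<inter> {- real k..real k}) \<le> emeasure ?\<nu> (\<Union>K\<in>\<D>. K)"
        using D(5) meas D(1) by (intro emeasure_mono sets.countable_UN'') auto
      also have "\<dots> \<le> ennreal \<epsilon>"
      proof (cases "\<D> = {}")
        case False
        define A where "A = from_nat_into \<D>"
        have A: "range A = \<D>" unfolding A_def by (rule range_from_nat_into[OF False D(1)])
        have mA: "A i \<in> sets ?\<nu>" for i by (rule meas) (use A in blast)
        have "incseq (\<lambda>n. \<Union>K\<in>A ` {..<n}. K)"
          unfolding incseq_def by (intro allI impI UN_mono image_mono) auto
        moreover have "(\<Union>K\<in>\<D>. K) = (\<Union>n. \<Union>K\<in>A ` {..<n}. K)" unfolding A[symmetric] by auto
        ultimately have "emeasure ?\<nu> (\<Union>K\<in>\<D>. K) = (SUP n. emeasure ?\<nu> (\<Union>K\<in>A ` {..<n}. K))"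
          using mA by (simp add: SUP_emeasure_incseq image_subset_iff)
        also have "\<dots> \<le> ennreal \<epsilon>"
        proof (rule SUP_least)
          fix n :: nat
          have "emeasure ?\<nu> (\<Union>K\<in>A ` {..<n}. K) \<le> (\<Sum>K\<in>A ` {..<n}. emeasure ?\<nu> K)"
            using mA by (intro emeasure_subadditive_finite) auto
          also have "\<dots> \<le> ennreal \<epsilon>" using A by (intro fsum) auto
          finally show "emeasure ?\<nu> (\<Union>K\<in>A ` {..<n}. K) \<le> ennreal \<epsilon>" .
        qed
        finally show ?thesis .
      qed simp
      finally show ?thesis .
    qed
    then show ?thesis
      by (metis ennreal_0 ennreal_le_epsilon le_zero_eq add.left_neutral)
  qed
  have "N = (\<Union>k\<in>{0<..}. N \<inter> {- real k..real k})"
  proof safe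
    fix x assume "x \<in> N"
    obtain k :: nat where "\<bar>x\<bar> < real k" using reals_Archimedean2 by blast
    then show "x \<in> (\<Union>k\<in>{0<..}. N \<inter> {- real k..real k})"
      using \<open>x \<in> N\<close> by (auto intro!: bexI[of _ k])
  qed
  moreover have "(\<Union>k\<in>{0::nat<..}. N \<inter> {- real k..real k}) \<in> null_sets ?\<nu>"
    using part Nb by (intro null_sets_UN') auto
  ultimately show "N \<in> null_sets ?\<nu>" by simp
qed

text \<open>The density is the Radon-Nikodym derivative of the Stieltjes measure of \<open>F\<close>.\<close>

lemma globally_ac_mono_is_integral:
  fixes F :: "real \<Rightarrow> real"
  assumes F: "globally_ac F" and mono: "\<And>x y. x \<le> y \<Longrightarrow> F x \<le> F y"
  shows "\<exists>g. \<forall>c d. c \<le> d \<longrightarrow> has_bochner_integral lborel (\<lambda>x. indicator {c..d} x * g x) (F d - F c)"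
proof -
  let ?\<nu> = "interval_measure F"
  from interval_measure_absolutely_continuous[OF F mono]
  obtain f where f[measurable]: "f \<in> borel_measurable lborel" and dens: "density lborel f = ?\<nu>"
    using sigma_finite_measure.Radon_Nikodym[OF sigma_finite_lborel, of ?\<nu>] by auto
  have "has_bochner_integral lborel (\<lambda>x. indicator {c..d} x * enn2real (f x)) (F d - F c)" if "c \<le> d" for c d
  proof -
    have "(\<integral>\<^sup>+x. f x * indicator {c..d} x \<partial>lborel) = emeasure ?\<nu> {c..d}"
      unfolding dens[symmetric] by (subst emeasure_density) auto
    also have "\<dots> = ennreal (F d - F c)"
      by (rule emeasure_interval_measure_Icc[OF that mono globally_ac_continuous[OF F]])
    finally have I: "(\<integral>\<^sup>+x. f x * indicator {c..d} x \<partial>lborel) = ennreal (F d - F c)" .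
    then have "AE x in lborel. f x * indicator {c..d} x \<noteq> \<infinity>"
      by (intro nn_integral_PInf_AE) auto
    then have "AE x in lborel. ennreal (indicator {c..d} x * enn2real (f x)) = f x * indicator {c..d} x"
      by eventually_elim (auto simp: indicator_def less_top)
    then have "(\<integral>\<^sup>+x. ennreal (indicator {c..d} x * enn2real (f x)) \<partial>lborel) = ennreal (F d - F c)"
      unfolding I[symmetric] by (rule nn_integral_cong_AE)
    then show ?thesis
      using mono[OF that] by (intro has_bochner_integral_nn_integral) auto
  qed
  then show ?thesis by (intro exI[of _ "\<lambda>x. enn2real (f x)"]) blast
qed

text \<open>Real and imaginary part become monotone once the variation is added, so the monotone case
applies to them and to the variation.\<close>

lemma globally_ac_is_integral:
  fixes f :: "real \<Rightarrow> complex"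
  assumes f: "globally_ac f" and const: "\<And>x. x \<le> a \<Longrightarrow> f x = f a"
  shows "\<exists>g. \<forall>c d. c \<le> d \<longrightarrow> set_integrable lborel {c..d} g \<and> (LINT x:{c..d}|lborel. g x) = f d - f c"
proof -
  define G where "G = variation_from a f"
  have G: "globally_ac G" unfolding G_def by (rule variation_from_globally_ac[OF f const])
  have dom: "cmod (f y - f x) \<le> G y - G x" if "x \<le> y" for x y
    unfolding G_def by (rule variation_from_dominates[OF f const that])
  have ReIm: "\<bar>Re (f y) - Re (f x)\<bar> \<le> G y - G x" "\<bar>Im (f y) - Im (f x)\<bar> \<le> G y - G x" if "x \<le> y" for x y
    using dom[OF that] abs_Re_le_cmod[of "f y - f x"] abs_Im_le_cmod[of "f y - f x"] by auto
  have G1: "globally_ac (\<lambda>x. Re (f x) + G x)"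
    by (rule globally_ac_dominated[OF G, of _ 2]) (use ReIm in \<open>fastforce simp: abs_le_iff\<close>)+
  have G2: "globally_ac (\<lambda>x. Im (f x) + G x)"
    by (rule globally_ac_dominated[OF G, of _ 2]) (use ReIm in \<open>fastforce simp: abs_le_iff\<close>)+
  obtain g0 where g0: "\<And>c d. c \<le> d \<Longrightarrow> has_bochner_integral lborel (\<lambda>x. indicator {c..d} x * g0 x) (G d - G c)"
    using globally_ac_mono_is_integral[OF G] dom by (smt (verit) norm_ge_zero)
  obtain g1 where g1: "\<And>c d. c \<le> d \<Longrightarrow> has_bochner_integral lborel (\<lambda>x. indicator {c..d} x * g1 x)
      ((Re (f d) + G d) - (Re (f c) + G c))"
    using globally_ac_mono_is_integral[OF G1] ReIm by (smt (verit))
  obtain g2 where g2: "\<And>c d. c \<le> d \<Longrightarrow> has_bochner_integral lborel (\<lambda>x. indicator {c..d} x * g2 x)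
      ((Im (f d) + G d) - (Im (f c) + G c))"
    using globally_ac_mono_is_integral[OF G2] ReIm by (smt (verit))
  define g where "g x = of_real (g1 x - g0 x) + \<i> * of_real (g2 x - g0 x)" for x
  have "has_bochner_integral lborel (\<lambda>x. indicator {c..d} x *\<^sub>R g x) (f d - f c)" if "c \<le> d" for c d
  proof -
    have "has_bochner_integral lborel (\<lambda>x. complex_of_real (indicator {c..d} x * g1 x - indicator {c..d} x * g0 x)
        + \<i> * complex_of_real (indicator {c..d} x * g2 x - indicator {c..d} x * g0 x))
      (complex_of_real (((Re (f d) + G d) - (Re (f c) + G c)) - (G d - G c))
        + \<i> * complex_of_real (((Im (f d) + G d) - (Im (f c) + G c)) - (G d - G c)))"
      by (intro has_bochner_integral_add has_bochner_integral_of_real has_bochner_integral_mult_right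
           has_bochner_integral_diff g0 g1 g2 that)
    moreover have "complex_of_real (indicator {c..d} x * g1 x - indicator {c..d} x * g0 x)
        + \<i> * complex_of_real (indicator {c..d} x * g2 x - indicator {c..d} x * g0 x) = indicator {c..d} x *\<^sub>R g x" for x
      by (auto simp: g_def indicator_def)
    moreover have "complex_of_real (((Re (f d) + G d) - (Re (f c) + G c)) - (G d - G c))
        + \<i> * complex_of_real (((Im (f d) + G d) - (Im (f c) + G c)) - (G d - G c)) = f d - f c"
      by (simp add: complex_eq_iff)
    ultimately show ?thesis by simp
  qed
  then show ?thesis
    by (intro exI[of _ g])
       (auto simp: set_integrable_def set_lebesgue_integral_def has_bochner_integral_iff)
qed

text \<open>Lebesgue's differentiation theorem gives the right derivative at almost every point; applied
to the reflected function it gives the left derivative.\<close>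

lemma indefinite_integral_derivative_ae:
  fixes g :: "real \<Rightarrow> complex"
  assumes int: "\<And>c d. c \<le> d \<Longrightarrow> (g has_integral (f d - f c)) {c..d}"
  shows "\<exists>N. negligible N \<and> (\<forall>x. x \<notin> N \<longrightarrow> (f has_vector_derivative g x) (at x))"
proof -
  have gi: "g integrable_on cbox c d" for c d
    using int[of c d] by (cases "c \<le> d") auto
  have gi': "(\<lambda>x. g (- x)) integrable_on cbox c d" for c d
    using gi[of "-d" "-c"] Henstock_Kurzweil_Integration.integrable_reflect_real[where f=g and a="-d" and b="-c"] by simp
  obtain N1 where N1: "negligible N1" and R: "\<And>x e. \<lbrakk>x \<notin> N1; 0 < e\<rbrakk> \<Longrightarrow>
      \<exists>d>0. \<forall>h. 0 < h \<and> h < d \<longrightarrow> norm (integral (cbox x (x + h *\<^sub>R One)) g /\<^sub>R h ^ DIM(real) - g x) < e"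
    using integrable_ccontinuous_explicit[OF gi] by metis
  obtain N2 where N2: "negligible N2" and L: "\<And>x e. \<lbrakk>x \<notin> N2; 0 < e\<rbrakk> \<Longrightarrow>
      \<exists>d>0. \<forall>h. 0 < h \<and> h < d \<longrightarrow> norm (integral (cbox x (x + h *\<^sub>R One)) (\<lambda>x. g (- x)) /\<^sub>R h ^ DIM(real) - g (- x)) < e"
    using integrable_ccontinuous_explicit[OF gi'] by metis
  have "negligible (N1 \<union> uminus ` N2)"
    using N1 N2 by (intro negligible_Un negligible_differentiable_image_negligible)
      (auto intro!: derivative_intros)
  moreover have "(f has_vector_derivative g x) (at x)" if "x \<notin> N1 \<union> uminus ` N2" for x
    unfolding has_vector_derivative_def has_derivative_at_alt
  proof (intro conjI allI impI)
    fix e :: real assume "e > 0"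
    have "x \<notin> N1" "- x \<notin> N2" using that by (auto intro: image_eqI[of _ _ "-x"])
    obtain d1 where d1: "d1 > 0" "\<And>h. 0 < h \<Longrightarrow> h < d1 \<Longrightarrow> norm (integral {x..x + h} g /\<^sub>R h - g x) < e"
      using R[OF \<open>x \<notin> N1\<close> \<open>e > 0\<close>] by auto
    obtain d2 where d2: "d2 > 0" "\<And>h. 0 < h \<Longrightarrow> h < d2 \<Longrightarrow> norm (integral {-x..-x + h} (\<lambda>x. g (- x)) /\<^sub>R h - g x) < e"
      using L[OF \<open>- x \<notin> N2\<close> \<open>e > 0\<close>] by auto
    have "norm (f y - f x - (y - x) *\<^sub>R g x) \<le> e * norm (y - x)" if "norm (y - x) < min d1 d2" for y
    proof -
      consider "y = x" | "y > x" | "y < x" by linarith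
      then show ?thesis
      proof cases
        case 2
        define h where "h = y - x"
        have h: "0 < h" "h < d1" "y = x + h" using 2 that by (auto simp: h_def)
        have "integral {x..x + h} g = f y - f x" using int[of x y] 2 h by (simp add: integral_unique)
        then have "norm ((f y - f x) /\<^sub>R h - g x) < e" using d1(2)[OF h(1,2)] by simp
        moreover have "f y - f x - h *\<^sub>R g x = h *\<^sub>R ((f y - f x) /\<^sub>R h - g x)"
          using h by (simp add: scaleR_diff_right)
        ultimately show ?thesis using h by (simp add: mult.commute)
      next
        case 3
        define h where "h = x - y"
        have h: "0 < h" "h < d2" "y = x - h" using 3 that by (auto simp: h_def)
        have "integral {-x..-x + h} (\<lambda>x. g (- x)) = integral {y..x} g"
          using Henstock_Kurzweil_Integration.integral_reflect_real[where a=y and b=x and f=g] h by simp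
        also have "\<dots> = f x - f y" using int[of y x] 3 by (simp add: integral_unique)
        finally have "norm ((f x - f y) /\<^sub>R h - g x) < e" using d2(2)[OF h(1,2)] by simp
        moreover have "y - x = - h" using h by simp
        then have "f y - f x - (y - x) *\<^sub>R g x = - (h *\<^sub>R ((f x - f y) /\<^sub>R h - g x))"
          using h(1) by (simp add: scaleR_diff_right)
        ultimately show ?thesis using h by (simp add: mult.commute)
      qed simp
    qed
    then show "\<exists>d>0. \<forall>y. norm (y - x) < d \<longrightarrow> norm (f y - f x - (y - x) *\<^sub>R g x) \<le> e * norm (y - x)"
      using d1(1) d2(1) by (intro exI[of _ "min d1 d2"]) auto
  qed (rule bounded_linear_scaleR_left)
  ultimately show ?thesis by blast
qed

lemma clamped_globally_ac:
  assumes "abs_continuous_between l b f" "l \<le> b"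
  shows "globally_ac (\<lambda>x. f (max l (min b x)))"
  unfolding globally_ac_def
proof (intro allI impI)
  fix \<epsilon> :: real assume "\<epsilon> > 0"
  with assms obtain \<delta> where d: "\<delta> > 0" and H: "\<And>(n::nat) u v.
        (\<forall>i<n. l \<le> u i \<and> u i \<le> v i \<and> v i \<le> b) \<and> disjoint_intervals {..<n} u v \<and>
        total_length {..<n} u v < \<delta> \<Longrightarrow> increments f {..<n} u v < \<epsilon>"
    unfolding abs_continuous_between_def by meson
  show "\<exists>\<delta>>0. \<forall>(n::nat) u v.
        (\<forall>i<n. u i \<le> v i) \<and> disjoint_intervals {..<n} u v \<and>
        total_length {..<n} u v < \<delta> \<longrightarrow>
        (\<Sum>i<n. norm (f (max l (min b (v i))) - f (max l (min b (u i))))) < \<epsilon>"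
  proof (intro exI conjI allI impI)
    fix n :: nat and u v :: "nat \<Rightarrow> real"
    assume A: "(\<forall>i<n. u i \<le> v i) \<and> disjoint_intervals {..<n} u v \<and> total_length {..<n} u v < \<delta>"
    show "(\<Sum>i<n. norm (f (max l (min b (v i))) - f (max l (min b (u i))))) < \<epsilon>"
    proof (rule H, intro conjI)
      show "disjoint_family_on (\<lambda>i. {max l (min b (u i))<..<max l (min b (v i))}) {..<n}"
        using A assms(2) by (elim conjE disjoint_family_on_mono_sets) auto
      have "(\<Sum>i<n. max l (min b (v i)) - max l (min b (u i))) \<le> total_length {..<n} u v"
        using A by (intro sum_mono) auto
      then show "(\<Sum>i<n. max l (min b (v i)) - max l (min b (u i))) < \<delta>" using A by linarith
      show "\<forall>i<n. l \<le> max l (min b (u i)) \<and> max l (min b (u i)) \<le> max l (min b (v i)) \<and> max l (min b (v i)) \<le> b"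
        using A assms(2) by force
    qed
  qed (use d in auto)
qed

text \<open>The operator \<^const>\<open>hderiv\<close> has an arbitrary value where no derivative exists. For absolutely
continuous functions this happens only on a null set, and \<^const>\<open>hderiv\<close> is a genuine density.\<close>

lemma abs_continuous_ftc:
  assumes ac: "abs_continuous_between l b f" and "l \<le> b"
  shows "hderiv l f absolutely_integrable_on {l..b}"
    and "(hderiv l f has_integral (f b - f l)) {l..b}"
    and "negligible {x\<in>{l..b}. \<not> (f has_vector_derivative hderiv l f x) (at x within {l..})}"
proof -
  define F where "F = (\<lambda>x. f (max l (min b x)))"
  have F: "globally_ac F" unfolding F_def by (rule clamped_globally_ac[OF assms])
  have const: "F x = F l" if "x \<le> l" for x using that \<open>l \<le> b\<close> by (simp add: F_def max_def min_def)
  obtain g where gi: "\<And>c d. c \<le> d \<Longrightarrow> set_integrable lborel {c..d} g"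
    and gv: "\<And>c d. c \<le> d \<Longrightarrow> (LINT x:{c..d}|lborel. g x) = F d - F c"
    using globally_ac_is_integral[OF F const] by metis
  have gI: "(g has_integral (F d - F c)) {c..d}" if "c \<le> d" for c d
    using has_integral_set_lebesgue[of "{c..d}" g] gi[OF that] gv[OF that]
    by (simp add: set_integrable_def set_lebesgue_integral_def integrable_completion integral_completion)
  obtain N where N: "negligible N" "\<And>x. x \<notin> N \<Longrightarrow> (F has_vector_derivative g x) (at x)"
    using indefinite_integral_derivative_ae[OF gI] by blast
  define N' where "N' = N \<union> {l, b}"
  have N': "negligible N'" unfolding N'_def by (rule negligible_Un[OF N(1)]) simp
  have der: "(f has_vector_derivative g x) (at x within {l..})" "hderiv l f x = g x"
    if "x \<in> {l..b} - N'" for x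
  proof -
    have x: "l < x" "x < b" using that by (auto simp: N'_def)
    have "(F has_vector_derivative g x) (at x)" using N(2) that by (auto simp: N'_def)
    then have "(f has_vector_derivative g x) (at x)"
      by (rule has_vector_derivative_transform_within_open[of _ _ _ "{l<..<b}"]) (use x in \<open>auto simp: F_def\<close>)
    then show 1: "(f has_vector_derivative g x) (at x within {l..})"
      by (rule has_vector_derivative_at_within)
    have "at x within {l..} = at x"
      using x by (intro at_within_open_subset[of x "{l<..}"]) auto
    then have "at x within {l..} \<noteq> bot" by simp
    then show "hderiv l f x = g x"
      unfolding hderiv_def using vector_derivative_within[OF _ 1] by simp
  qed
  have "set_integrable lebesgue {l..b} g"
    using gi[OF \<open>l \<le> b\<close>] unfolding set_integrable_def by (subst integrable_completion) (auto simp: borel_measurable_integrable)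
  then show "hderiv l f absolutely_integrable_on {l..b}"
    using absolutely_integrable_spike[where T="{l..b}" and g="hderiv l f", OF _ N'] der(2) by auto
  have "F b - F l = f b - f l" using \<open>l \<le> b\<close> by (simp add: F_def)
  then show "(hderiv l f has_integral (f b - f l)) {l..b}"
    using has_integral_spike[where T="{l..b}" and g="hderiv l f", OF N' _ gI[OF \<open>l \<le> b\<close>]] der(2) by simp
  show "negligible {x\<in>{l..b}. \<not> (f has_vector_derivative hderiv l f x) (at x within {l..})}"
    by (rule negligible_subset[OF N']) (use der in fastforce)
qed

section \<open>Square-integrable functions on the half-line\<close>

abbreviation half_line :: "real \<Rightarrow> real measure" where
  "half_line l \<equiv> lebesgue_on {l..}"

lemma measurable_cnj[measurable]:
  "f \<in> borel_measurable M \<Longrightarrow> (\<lambda>x. cnj (f x)) \<in> borel_measurable M"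
  by (rule measurable_compose[OF _ borel_measurable_continuous_onI]) (auto intro: continuous_intros)

text \<open>Completeness of Lebesgue measure. It makes \<^const>\<open>schroedinger_expr\<close> of a solution measurable,
although nothing is known about its values on the exceptional null set.\<close>

lemma half_line_measurable_AE:
  fixes f g :: "real \<Rightarrow> complex"
  assumes f: "f \<in> borel_measurable (half_line l)" and eq: "AE x in half_line l. g x = f x"
  shows "g \<in> borel_measurable (half_line l)"
proof (rule measurableI)
  fix A :: "complex set" assume A: "A \<in> sets borel"
  from eq obtain N where N: "N \<in> null_sets (half_line l)" "{x \<in> space (half_line l). g x \<noteq> f x} \<subseteq> N"
    unfolding eventually_ae_filter by (rule bexE)
  note N = N(2,1)
  have N0: "N \<in> null_sets lebesgue" and Nl: "N \<subseteq> {l..}"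
    using N(2) null_sets_restrict_space[of "{l..}" lebesgue N] by simp_all
  have "f -` A \<inter> {l..} - N \<in> sets lebesgue"
    using measurable_sets[OF f A] N0 by (auto simp: sets_restrict_space_iff)
  moreover have "g -` A \<inter> {l..} \<inter> N \<in> null_sets lebesgue"
    by (rule null_sets_completion_subset[OF _ N0]) simp
  ultimately have "(f -` A \<inter> {l..} - N) \<union> (g -` A \<inter> {l..} \<inter> N) \<in> sets lebesgue"
    by (intro sets.Un) (simp_all only: null_setsD2)
  moreover have "(f -` A \<inter> {l..} - N) \<union> (g -` A \<inter> {l..} \<inter> N) = g -` A \<inter> {l..}"
    using N(1) by auto
  ultimately show "g -` A \<inter> space (half_line l) \<in> sets (half_line l)"
    by (auto simp: sets_restrict_space_iff)
qed auto

definition L2_norm2 :: "real \<Rightarrow> (real \<Rightarrow> complex) \<Rightarrow> real" where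
  "L2_norm2 l f = (\<integral>x. (norm (f x))\<^sup>2 \<partial>half_line l)"

lemma L2_cong_AE:
  assumes "f \<in> L2 l" "AE x in half_line l. g x = f x"
  shows "g \<in> L2 l"
proof -
  have m: "g \<in> borel_measurable (half_line l)" using half_line_measurable_AE[OF _ assms(2)] assms(1) by (simp add: L2_def)
  moreover have "integrable (half_line l) (\<lambda>x. (norm (g x))\<^sup>2)"
  proof (rule integrable_cong_AE_imp)
    show "integrable (half_line l) (\<lambda>x. (norm (f x))\<^sup>2)" using assms by (simp add: L2_def)
    show "(\<lambda>x. (norm (g x))\<^sup>2) \<in> borel_measurable (half_line l)" using m by measurable
    show "AE x in half_line l. (norm (f x))\<^sup>2 = (norm (g x))\<^sup>2" using assms(2) by eventually_elim simp
  qed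
  ultimately show ?thesis by (simp add: L2_def)
qed

lemma L2_integrable_mult:
  assumes "f \<in> L2 l" "g \<in> L2 l"
  shows "integrable (half_line l) (\<lambda>x. f x * cnj (g x))"
proof (rule Bochner_Integration.integrable_bound)
  show "integrable (half_line l) (\<lambda>x. (norm (f x))\<^sup>2 + (norm (g x))\<^sup>2)"
    using assms by (auto simp: L2_def)
  have [measurable]: "f \<in> borel_measurable (half_line l)" "g \<in> borel_measurable (half_line l)"
    using assms by (auto simp: L2_def)
  show "(\<lambda>x. f x * cnj (g x)) \<in> borel_measurable (half_line l)" by measurable
  have "norm (a * cnj b) \<le> (norm a)\<^sup>2 + (norm b)\<^sup>2" for a b :: complex
  proof -
    have "2 * (norm a * norm b) \<le> (norm a)\<^sup>2 + (norm b)\<^sup>2"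
      using sum_squares_bound[of "norm a" "norm b"] by simp
    moreover have "0 \<le> norm a * norm b" by simp
    ultimately show ?thesis unfolding norm_mult complex_mod_cnj by linarith
  qed
  then show "AE x in half_line l. norm (f x * cnj (g x)) \<le> norm ((norm (f x))\<^sup>2 + (norm (g x))\<^sup>2)"
    by simp
qed

lemma L2_lincomb:
  assumes "f \<in> L2 l" "g \<in> L2 l"
  shows "(\<lambda>x. a * f x + b * g x) \<in> L2 l"
proof -
  have [measurable]: "f \<in> borel_measurable (half_line l)" "g \<in> borel_measurable (half_line l)"
    using assms by (auto simp: L2_def)
  have "integrable (half_line l) (\<lambda>x. (norm (a * f x + b * g x))\<^sup>2)"
  proof (rule Bochner_Integration.integrable_bound)
    show "integrable (half_line l) (\<lambda>x. 2 * (norm a)\<^sup>2 * (norm (f x))\<^sup>2 + 2 * (norm b)\<^sup>2 * (norm (g x))\<^sup>2)"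
      using assms by (auto simp: L2_def)
    have "(norm (u + v))\<^sup>2 \<le> 2 * (norm u)\<^sup>2 + 2 * (norm v)\<^sup>2" for u v :: complex
    proof -
      have "(norm (u + v))\<^sup>2 \<le> (norm u + norm v)\<^sup>2" by (intro power_mono norm_triangle_ineq) simp
      also have "\<dots> \<le> 2 * (norm u)\<^sup>2 + 2 * (norm v)\<^sup>2"
        using sum_squares_bound[of "norm u" "norm v"] by (simp add: power2_sum)
      finally show ?thesis .
    qed
    from this[of "a * f x" "b * g x" for x]
    show "AE x in half_line l. norm ((norm (a * f x + b * g x))\<^sup>2) \<le>
        norm (2 * (norm a)\<^sup>2 * (norm (f x))\<^sup>2 + 2 * (norm b)\<^sup>2 * (norm (g x))\<^sup>2)"
      by (simp add: norm_mult power_mult_distrib mult.assoc)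
  qed measurable
  then show ?thesis by (simp add: L2_def)
qed

lemma L2_scale: "f \<in> L2 l \<Longrightarrow> (\<lambda>x. a * f x) \<in> L2 l"
  using L2_lincomb[of f l f a 0] by simp

lemma L2_diff: "f \<in> L2 l \<Longrightarrow> g \<in> L2 l \<Longrightarrow> (\<lambda>x. f x - g x) \<in> L2 l"
  using L2_lincomb[of f l g 1 "-1"] by simp

lemma L2_inner_lincomb_left:
  assumes "f \<in> L2 l" "g \<in> L2 l" "k \<in> L2 l"
  shows "L2_inner l (\<lambda>x. a * f x + b * g x) k = a * L2_inner l f k + b * L2_inner l g k"
proof -
  have "(\<integral>x. (a * f x + b * g x) * cnj (k x) \<partial>half_line l) =
      (\<integral>x. a * (f x * cnj (k x)) + b * (g x * cnj (k x)) \<partial>half_line l)"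
    by (intro Bochner_Integration.integral_cong) (auto simp: algebra_simps)
  also have "\<dots> = a * L2_inner l f k + b * L2_inner l g k"
    unfolding L2_inner_def using L2_integrable_mult[OF assms(1,3)] L2_integrable_mult[OF assms(2,3)] by simp
  finally show ?thesis by (simp add: L2_inner_def)
qed

lemma L2_inner_cnj: "L2_inner l g f = cnj (L2_inner l f g)"
  unfolding L2_inner_def using Bochner_Integration.integral_cnj[of "half_line l" "\<lambda>x. f x * cnj (g x)"] by (simp add: mult.commute)

lemma L2_inner_lincomb_right:
  assumes "f \<in> L2 l" "g \<in> L2 l" "k \<in> L2 l"
  shows "L2_inner l k (\<lambda>x. a * f x + b * g x) = cnj a * L2_inner l k f + cnj b * L2_inner l k g"
  using L2_inner_lincomb_left[OF assms, of a b]
  by (subst (1 2 3) L2_inner_cnj) simp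

lemma L2_inner_diff_left:
  assumes "f \<in> L2 l" "g \<in> L2 l" "k \<in> L2 l"
  shows "L2_inner l (\<lambda>x. f x - g x) k = L2_inner l f k - L2_inner l g k"
  using L2_inner_lincomb_left[OF assms, of 1 "-1"] by simp

lemma L2_inner_diff_right:
  assumes "f \<in> L2 l" "g \<in> L2 l" "k \<in> L2 l"
  shows "L2_inner l k (\<lambda>x. f x - g x) = L2_inner l k f - L2_inner l k g"
  using L2_inner_lincomb_right[OF assms, of 1 "-1"] by simp

lemma L2_inner_scale_left: "f \<in> L2 l \<Longrightarrow> k \<in> L2 l \<Longrightarrow> L2_inner l (\<lambda>x. a * f x) k = a * L2_inner l f k"
  using L2_inner_lincomb_left[of f l f k a 0] by simp

lemma L2_inner_scale_right: "f \<in> L2 l \<Longrightarrow> k \<in> L2 l \<Longrightarrow> L2_inner l k (\<lambda>x. a * f x) = cnj a * L2_inner l k f"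
  using L2_inner_lincomb_right[of f l f k a 0] by simp

lemma L2_inner_cong_AE:
  assumes "f \<in> L2 l" "g \<in> L2 l" "AE x in half_line l. f' x = f x" "AE x in half_line l. g' x = g x"
  shows "L2_inner l f' g' = L2_inner l f g"
proof -
  have "f' \<in> L2 l" "g' \<in> L2 l" using assms L2_cong_AE by blast+
  then have [measurable]: "f \<in> borel_measurable (half_line l)" "g \<in> borel_measurable (half_line l)"
    "f' \<in> borel_measurable (half_line l)" "g' \<in> borel_measurable (half_line l)"
    using assms by (auto simp: L2_def)
  show ?thesis unfolding L2_inner_def
  proof (rule integral_cong_AE)
    show "AE x in half_line l. f' x * cnj (g' x) = f x * cnj (g x)"
      using assms(3,4) by eventually_elim simp
  qed measurable
qed

lemma L2_inner_self: "L2_inner l f f = of_real (L2_norm2 l f)"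
proof -
  have "(\<integral>x. f x * cnj (f x) \<partial>half_line l) = (\<integral>x. of_real ((norm (f x))\<^sup>2) \<partial>half_line l)"
    by (intro Bochner_Integration.integral_cong refl) (simp add: complex_norm_square del: of_real_power)
  then show ?thesis by (simp add: L2_inner_def L2_norm2_def del: of_real_power)
qed

lemma L2_norm2_nonneg: "0 \<le> L2_norm2 l f"
  unfolding L2_norm2_def by (intro Bochner_Integration.integral_nonneg) auto

lemma L2_norm2_eq_0:
  assumes "f \<in> L2 l" "L2_norm2 l f = 0"
  shows "AE x in half_line l. f x = 0"
proof -
  have "AE x in half_line l. (norm (f x))\<^sup>2 = 0"
    using assms unfolding L2_norm2_def L2_def
    by (subst (asm) integral_nonneg_eq_0_iff_AE) auto
  then show ?thesis by eventually_elim simp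
qed

lemma L2_norm2_scale: "L2_norm2 l (\<lambda>x. a * f x) = (norm a)\<^sup>2 * L2_norm2 l f"
  unfolding L2_norm2_def by (simp add: norm_mult power_mult_distrib)

lemma L2_norm2_diff:
  assumes "f \<in> L2 l" "g \<in> L2 l"
  shows "L2_norm2 l (\<lambda>x. f x - g x) = L2_norm2 l f - 2 * Re (L2_inner l f g) + L2_norm2 l g"
proof -
  have "complex_of_real (L2_norm2 l (\<lambda>x. f x - g x)) =
      L2_inner l f f - L2_inner l f g - (L2_inner l g f - L2_inner l g g)"
    unfolding L2_inner_self[symmetric] using assms
    by (simp add: L2_inner_diff_left L2_inner_diff_right L2_diff)
  then have "Re (complex_of_real (L2_norm2 l (\<lambda>x. f x - g x))) =
      Re (L2_inner l f f - L2_inner l f g - (cnj (L2_inner l f g) - L2_inner l g g))"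
    using L2_inner_cnj[of l g f] by simp
  then show ?thesis by (simp add: L2_inner_self)
qed

text \<open>The discriminant of \<open>t \<mapsto> \<parallel>f - t \<langle>f, g\<rangle> g\<parallel>\<^sup>2\<close>, which is a non-negative quadratic in the real
number \<open>t\<close>.\<close>

lemma L2_Cauchy_Schwarz:
  assumes f: "f \<in> L2 l" and g: "g \<in> L2 l"
  shows "norm (L2_inner l f g) \<le> sqrt (L2_norm2 l f) * sqrt (L2_norm2 l g)"
proof -
  define p where "p = L2_inner l f g"
  have quad: "0 \<le> L2_norm2 l f - 2 * t * (norm p)\<^sup>2 + t\<^sup>2 * (norm p)\<^sup>2 * L2_norm2 l g" for t :: real
  proof -
    have "0 \<le> L2_norm2 l (\<lambda>x. f x - (of_real t * p) * g x)" by (rule L2_norm2_nonneg)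
    also have "\<dots> = L2_norm2 l f - 2 * Re (L2_inner l f (\<lambda>x. (of_real t * p) * g x)) +
        L2_norm2 l (\<lambda>x. (of_real t * p) * g x)"
      using f g by (intro L2_norm2_diff L2_scale)
    also have "L2_inner l f (\<lambda>x. (of_real t * p) * g x) = of_real t * of_real ((norm p)\<^sup>2)"
      using f g by (subst L2_inner_scale_right)
        (simp_all add: p_def[symmetric] complex_norm_square[symmetric] mult.commute[of "cnj p"] mult.assoc flip: of_real_power)
    also have "L2_norm2 l (\<lambda>x. (of_real t * p) * g x) = t\<^sup>2 * (norm p)\<^sup>2 * L2_norm2 l g"
      by (simp add: L2_norm2_scale norm_mult power_mult_distrib)
    finally show ?thesis by simp
  qed
  have "(norm p)\<^sup>2 \<le> L2_norm2 l f * L2_norm2 l g"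
  proof (cases "L2_norm2 l g = 0")
    case True
    have "(norm p)\<^sup>2 \<le> 0"
    proof (rule ccontr)
      assume "\<not> (norm p)\<^sup>2 \<le> 0"
      then have pos: "(norm p)\<^sup>2 > 0" by simp
      from quad[of "(L2_norm2 l f + 1) / (2 * (norm p)\<^sup>2)"] True pos
      show False by (simp add: field_simps)
    qed
    then show ?thesis using True by simp
  next
    case False
    then have G: "L2_norm2 l g > 0" using L2_norm2_nonneg[of l g] by linarith
    from quad[of "1 / L2_norm2 l g"] have "0 \<le> L2_norm2 l f - (norm p)\<^sup>2 / L2_norm2 l g"
      using G by (simp add: power2_eq_square)
    then show ?thesis using G by (simp add: field_simps)
  qed
  then have "norm p \<le> sqrt (L2_norm2 l f * L2_norm2 l g)" by (rule real_le_rsqrt)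
  then show ?thesis by (simp add: p_def real_sqrt_mult)
qed

section \<open>Functions with two derivatives\<close>

text \<open>A single criterion for sums, products, conjugates and Lipschitz functions.\<close>

lemma abs_continuous_dominated:
  assumes f: "abs_continuous_between l b f" and g: "abs_continuous_between l b g"
    and dom: "\<And>x y. l \<le> x \<Longrightarrow> x \<le> y \<Longrightarrow> y \<le> b \<Longrightarrow> norm (h y - h x) \<le> C * (norm (f y - f x) + norm (g y - g x))"
    and C: "C > 0"
  shows "abs_continuous_between l b h"
  unfolding abs_continuous_between_def
proof (intro allI impI)
  fix \<epsilon> :: real assume "\<epsilon> > 0"
  then have e: "\<epsilon> / (2 * C) > 0" using C by simp
  obtain \<delta>1 where d1: "\<delta>1 > 0" and H1: "\<And>(n::nat) u v.
      (\<forall>i<n. l \<le> u i \<and> u i \<le> v i \<and> v i \<le> b) \<and> disjoint_intervals {..<n} u v \<and>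
      total_length {..<n} u v < \<delta>1 \<longrightarrow> increments f {..<n} u v < \<epsilon> / (2 * C)"
    using f e unfolding abs_continuous_between_def by meson
  obtain \<delta>2 where d2: "\<delta>2 > 0" and H2: "\<And>(n::nat) u v.
      (\<forall>i<n. l \<le> u i \<and> u i \<le> v i \<and> v i \<le> b) \<and> disjoint_intervals {..<n} u v \<and>
      total_length {..<n} u v < \<delta>2 \<longrightarrow> increments g {..<n} u v < \<epsilon> / (2 * C)"
    using g e unfolding abs_continuous_between_def by meson
  show "\<exists>\<delta>>0. \<forall>(n::nat) u v.
      (\<forall>i<n. l \<le> u i \<and> u i \<le> v i \<and> v i \<le> b) \<and> disjoint_intervals {..<n} u v \<and>
      total_length {..<n} u v < \<delta> \<longrightarrow> increments h {..<n} u v < \<epsilon>"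
  proof (intro exI[of _ "min \<delta>1 \<delta>2"] conjI allI impI)
    fix n :: nat and u v :: "nat \<Rightarrow> real"
    assume A: "(\<forall>i<n. l \<le> u i \<and> u i \<le> v i \<and> v i \<le> b) \<and> disjoint_intervals {..<n} u v \<and>
      total_length {..<n} u v < min \<delta>1 \<delta>2"
    have "increments h {..<n} u v \<le> (\<Sum>i<n. C * (norm (f (v i) - f (u i)) + norm (g (v i) - g (u i))))"
      using A by (intro sum_mono dom) auto
    also have "\<dots> = C * (increments f {..<n} u v + increments g {..<n} u v)"
      by (simp only: sum_distrib_left[symmetric] sum.distrib)
    also have "\<dots> < C * (\<epsilon> / (2 * C) + \<epsilon> / (2 * C))"
    proof -
      have "increments f {..<n} u v < \<epsilon> / (2 * C)" using H1[of n u v] A by auto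
      moreover have "increments g {..<n} u v < \<epsilon> / (2 * C)" using H2[of n u v] A by auto
      ultimately show ?thesis using C by (intro mult_strict_left_mono) auto
    qed
    also have "\<dots> = \<epsilon>" using C by (simp add: field_simps)
    finally show "increments h {..<n} u v < \<epsilon>" .
  qed (use d1 d2 in auto)
qed

lemma abs_continuous_lipschitz:
  assumes "\<And>x y. l \<le> x \<Longrightarrow> x \<le> y \<Longrightarrow> y \<le> b \<Longrightarrow> norm (h y - h x) \<le> C * (y - x)" "C > 0"
  shows "abs_continuous_between l b h"
proof -
  have id: "abs_continuous_between l b (\<lambda>x. of_real x :: complex)"
    unfolding abs_continuous_between_def
  proof (intro allI impI)
    fix \<epsilon> :: real assume e: "\<epsilon> > 0"
    show "\<exists>\<delta>>0. \<forall>(n::nat) u v.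
      (\<forall>i<n. l \<le> u i \<and> u i \<le> v i \<and> v i \<le> b) \<and> disjoint_intervals {..<n} u v \<and>
      total_length {..<n} u v < \<delta> \<longrightarrow> (\<Sum>i<n. norm (complex_of_real (v i) - of_real (u i))) < \<epsilon>"
    proof (intro exI[of _ \<epsilon>] conjI allI impI e)
      fix n :: nat and u v :: "nat \<Rightarrow> real"
      assume A: "(\<forall>i<n. l \<le> u i \<and> u i \<le> v i \<and> v i \<le> b) \<and> disjoint_intervals {..<n} u v \<and>
        total_length {..<n} u v < \<epsilon>"
      have "(\<Sum>i<n. norm (complex_of_real (v i) - of_real (u i))) = total_length {..<n} u v"
        using A by (intro sum.cong) (auto simp flip: of_real_diff)
      then show "(\<Sum>i<n. norm (complex_of_real (v i) - of_real (u i))) < \<epsilon>" using A by simp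
    qed
  qed
  show ?thesis
  proof (rule abs_continuous_dominated[OF id id])
    fix x y assume A: "l \<le> x" "x \<le> y" "y \<le> b"
    have "norm (h y - h x) \<le> C * (y - x)" by (rule assms(1)[OF A])
    also have "\<dots> \<le> C * (norm (complex_of_real y - of_real x) + norm (complex_of_real y - of_real x))"
      using A \<open>C > 0\<close> by (intro mult_left_mono) (auto simp flip: of_real_diff)
    finally show "norm (h y - h x) \<le> C * (norm (complex_of_real y - of_real x) + norm (complex_of_real y - of_real x))" .
  qed (fact assms(2))
qed

lemma locally_ac_continuous:
  assumes "locally_abs_continuous l f"
  shows "continuous_on {l..} f"
  unfolding continuous_on_iff
proof (intro ballI allI impI)
  fix x \<epsilon> :: real assume "x \<in> {l..}" "\<epsilon> > 0"
  then have "abs_continuous_between l (x + 1) f" using assms by (simp add: locally_abs_continuous_def)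
  then have "globally_ac (\<lambda>t. f (max l (min (x + 1) t)))"
    using \<open>x \<in> {l..}\<close> by (intro clamped_globally_ac) auto
  from globally_ac_continuous[OF this] \<open>\<epsilon> > 0\<close> obtain d where d: "d > 0"
    "\<And>x'. dist x' x < d \<Longrightarrow> dist (f (max l (min (x + 1) x'))) (f (max l (min (x + 1) x))) < \<epsilon>"
    unfolding continuous_on_iff by (meson UNIV_I)
  have "dist (f x') (f x) < \<epsilon>" if "x' \<in> {l..}" "dist x' x < min d 1" for x'
    using d(2)[of x'] that \<open>x \<in> {l..}\<close> by (simp add: dist_real_def min_def max_def split: if_splits)
  then show "\<exists>d>0. \<forall>x'\<in>{l..}. dist x' x < d \<longrightarrow> dist (f x') (f x) < \<epsilon>"
    using d(1) by (intro exI[of _ "min d 1"]) auto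
qed

lemma locally_ac_bounded:
  assumes "locally_abs_continuous l f"
  obtains B where "B > 0" "\<And>x. x \<in> {l..b} \<Longrightarrow> norm (f x) \<le> B"
proof -
  have "compact (f ` {l..b})"
    by (intro compact_continuous_image continuous_on_subset[OF locally_ac_continuous[OF assms]]) auto
  then obtain B where "\<forall>y\<in>f ` {l..b}. norm y \<le> B" using compact_imp_bounded bounded_iff by metis
  then show thesis by (intro that[of "max B 1"]) force+
qed

lemma locally_ac_mult:
  assumes f: "locally_abs_continuous l f" and g: "locally_abs_continuous l g"
  shows "locally_abs_continuous l (\<lambda>x. f x * g x)"
  unfolding locally_abs_continuous_def
proof (intro allI impI)
  fix b assume "l \<le> b"
  obtain B1 where B1: "B1 > 0" "\<And>x. x \<in> {l..b} \<Longrightarrow> norm (f x) \<le> B1" using locally_ac_bounded[OF f] by metis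
  obtain B2 where B2: "B2 > 0" "\<And>x. x \<in> {l..b} \<Longrightarrow> norm (g x) \<le> B2" using locally_ac_bounded[OF g] by metis
  show "abs_continuous_between l b (\<lambda>x. f x * g x)"
  proof (rule abs_continuous_dominated[where f=f and g=g and C="B1 + B2"])
    fix x y assume A: "l \<le> x" "x \<le> y" "y \<le> b"
    have "f y * g y - f x * g x = f y * (g y - g x) + (f y - f x) * g x" by (simp add: algebra_simps)
    then have "norm (f y * g y - f x * g x) \<le> norm (f y) * norm (g y - g x) + norm (f y - f x) * norm (g x)"
      by (metis norm_mult norm_triangle_ineq)
    also have "\<dots> \<le> (B1 + B2) * norm (g y - g x) + norm (f y - f x) * (B1 + B2)"
      using A B1(2)[of y] B2(2)[of x] B1(1) B2(1) by (intro add_mono mult_mono) auto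
    finally show "norm (f y * g y - f x * g x) \<le> (B1 + B2) * (norm (f y - f x) + norm (g y - g x))"
      by (simp add: algebra_simps)
  qed (use f g \<open>l \<le> b\<close> B1 B2 in \<open>auto simp: locally_abs_continuous_def\<close>)
qed

lemma locally_ac_lincomb:
  assumes f: "locally_abs_continuous l f" and g: "locally_abs_continuous l g"
  shows "locally_abs_continuous l (\<lambda>x. a * f x + b * g x)"
  unfolding locally_abs_continuous_def
proof (intro allI impI)
  fix c assume "l \<le> c"
  show "abs_continuous_between l c (\<lambda>x. a * f x + b * g x)"
  proof (rule abs_continuous_dominated[where f=f and g=g and C="norm a + norm b + 1"])
    fix x y assume A: "l \<le> x" "x \<le> y" "y \<le> c"
    have "(a * f y + b * g y) - (a * f x + b * g x) = a * (f y - f x) + b * (g y - g x)"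
      by (simp add: algebra_simps)
    then have "norm ((a * f y + b * g y) - (a * f x + b * g x)) \<le> norm a * norm (f y - f x) + norm b * norm (g y - g x)"
      by (metis norm_mult norm_triangle_ineq)
    also have "\<dots> \<le> (norm a + norm b + 1) * norm (f y - f x) + (norm a + norm b + 1) * norm (g y - g x)"
      by (intro add_mono mult_right_mono) auto
    finally show "norm ((a * f y + b * g y) - (a * f x + b * g x)) \<le> (norm a + norm b + 1) * (norm (f y - f x) + norm (g y - g x))"
      by (simp add: algebra_simps)
  qed (use f g \<open>l \<le> c\<close> in \<open>auto simp: locally_abs_continuous_def intro: add_nonneg_pos\<close>)
qed

lemma locally_ac_cnj: "locally_abs_continuous l f \<Longrightarrow> locally_abs_continuous l (\<lambda>x. cnj (f x))"
  unfolding locally_abs_continuous_def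
proof (intro allI impI)
  fix b assume "\<forall>b\<ge>l. abs_continuous_between l b f" "l \<le> b"
  then have f: "abs_continuous_between l b f" by blast
  show "abs_continuous_between l b (\<lambda>x. cnj (f x))"
    by (rule abs_continuous_dominated[OF f f, where C=1]) (simp_all flip: complex_cnj_diff)
qed

lemma locally_ac_cong:
  assumes "locally_abs_continuous l f" "\<And>x. x \<ge> l \<Longrightarrow> g x = f x"
  shows "locally_abs_continuous l g"
  unfolding locally_abs_continuous_def
proof (intro allI impI)
  fix b assume "l \<le> b"
  then have f: "abs_continuous_between l b f" using assms(1) by (simp add: locally_abs_continuous_def)
  show "abs_continuous_between l b g"
    by (rule abs_continuous_dominated[OF f f, where C=1]) (simp_all add: assms(2))
qed

lemma at_within_Ici_nontrivial: "l \<le> x \<Longrightarrow> at x within {l..} \<noteq> (bot :: real filter)"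
proof -
  assume "l \<le> x"
  then have "at_right x \<le> at x within {l..}" by (intro at_le) auto
  then show ?thesis using trivial_limit_at_right_real[of x] by (metis bot.extremum_uniqueI)
qed

lemma hderiv_eqI:
  assumes "(f has_vector_derivative f') (at x within {l..})" "l \<le> x"
  shows "hderiv l f x = f'"
  unfolding hderiv_def by (rule vector_derivative_within[OF at_within_Ici_nontrivial[OF assms(2)] assms(1)])

lemma locally_ac_derivative_AE:
  assumes "locally_abs_continuous l f"
  shows "AE x in half_line l. (f has_vector_derivative hderiv l f x) (at x within {l..})"
proof -
  let ?P = "\<lambda>x. (f has_vector_derivative hderiv l f x) (at x within {l..})"
  have neg: "negligible {x\<in>{l..l + real n}. \<not> ?P x}" for n
    using assms by (intro abs_continuous_ftc(3)) (auto simp: locally_abs_continuous_def)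
  have "{x\<in>{l..}. \<not> ?P x} = (\<Union>n. {x\<in>{l..l + real n}. \<not> ?P x})"
  proof safe
    fix x assume "l \<le> x" "\<not> ?P x"
    obtain n :: nat where "x - l \<le> real n" using real_arch_simple by blast
    then show "x \<in> (\<Union>n. {x\<in>{l..l + real n}. \<not> ?P x})" using \<open>l \<le> x\<close> \<open>\<not> ?P x\<close> by (auto intro!: exI[of _ n])
  qed auto
  moreover have "negligible (\<Union>n. {x\<in>{l..l + real n}. \<not> ?P x})"
    by (rule negligible_countable_Union) (use neg in auto)
  ultimately have "{x\<in>{l..}. \<not> ?P x} \<in> null_sets lebesgue" by (simp add: negligible_iff_null_sets)
  then have "AE x in lebesgue. x \<notin> {x\<in>{l..}. \<not> ?P x}" by (rule AE_not_in)
  then show ?thesis by (subst AE_restrict_space_iff) auto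
qed

text \<open>The second derivative is only determined almost everywhere. Carrying a representative \<open>y2\<close>
along, instead of the values of \<^const>\<open>hderiv\<close>, lets the usual differentiation rules produce it.\<close>

definition has_two_derivatives ::
    "real \<Rightarrow> (real \<Rightarrow> complex) \<Rightarrow> (real \<Rightarrow> complex) \<Rightarrow> (real \<Rightarrow> complex) \<Rightarrow> bool" where
  "has_two_derivatives l y y1 y2 \<longleftrightarrow>
     (\<forall>x\<ge>l. (y has_vector_derivative y1 x) (at x within {l..})) \<and>
     locally_abs_continuous l y \<and> locally_abs_continuous l y1 \<and>
     (AE x in half_line l. (y1 has_vector_derivative y2 x) (at x within {l..}))"

lemma smooth_enough_two_derivatives:
  assumes "smooth_enough l y"
  shows "has_two_derivatives l y (hderiv l y) (hderiv l (hderiv l y))"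
proof -
  have "(y has_vector_derivative hderiv l y x) (at x within {l..})" if "x \<ge> l" for x
    using assms that unfolding smooth_enough_def hderiv_def by (simp flip: vector_derivative_works)
  then show ?thesis
    using assms locally_ac_derivative_AE[of l "hderiv l y"]
    by (simp add: has_two_derivatives_def smooth_enough_def)
qed

lemma AE_half_line_le: "AE x in half_line l. l \<le> x"
  by (rule AE_I2) auto

lemma two_derivatives_smooth:
  assumes "has_two_derivatives l y y1 y2"
  shows "smooth_enough l y" "\<And>x. x \<ge> l \<Longrightarrow> hderiv l y x = y1 x"
    "AE x in half_line l. hderiv l (hderiv l y) x = y2 x"
proof -
  show 1: "\<And>x. x \<ge> l \<Longrightarrow> hderiv l y x = y1 x"
    using assms hderiv_eqI unfolding has_two_derivatives_def by blast
  show "smooth_enough l y"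
    unfolding smooth_enough_def
    using assms 1 locally_ac_cong[of l y1 "hderiv l y"] unfolding has_two_derivatives_def
    by (auto intro: differentiableI_vector)
  have "AE x in half_line l. (y1 has_vector_derivative y2 x) (at x within {l..})"
    using assms by (simp add: has_two_derivatives_def)
  then show "AE x in half_line l. hderiv l (hderiv l y) x = y2 x"
    using AE_half_line_le
  proof eventually_elim
    case (elim x)
    have "(hderiv l y has_vector_derivative y2 x) (at x within {l..})"
      by (rule has_vector_derivative_transform[OF _ _ elim(1)]) (use elim 1 in auto)
    then show ?case using elim by (intro hderiv_eqI)
  qed
qed

lemma two_derivatives_lincomb:
  assumes "has_two_derivatives l y y1 y2" "has_two_derivatives l v v1 v2"
  shows "has_two_derivatives l (\<lambda>x. a * y x + b * v x) (\<lambda>x. a * y1 x + b * v1 x) (\<lambda>x. a * y2 x + b * v2 x)"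
  unfolding has_two_derivatives_def
proof (intro conjI allI impI)
  show "AE x in half_line l. ((\<lambda>x. a * y1 x + b * v1 x) has_vector_derivative a * y2 x + b * v2 x) (at x within {l..})"
    using assms(1)[unfolded has_two_derivatives_def, THEN conjunct2, THEN conjunct2, THEN conjunct2]
      assms(2)[unfolded has_two_derivatives_def, THEN conjunct2, THEN conjunct2, THEN conjunct2]
    by eventually_elim (intro has_vector_derivative_add has_vector_derivative_mult_right)
qed (use assms in \<open>auto simp: has_two_derivatives_def intro!: has_vector_derivative_add has_vector_derivative_mult_right locally_ac_lincomb\<close>)

lemma two_derivatives_mult:
  assumes "has_two_derivatives l y y1 y2" "has_two_derivatives l v v1 v2"
  shows "has_two_derivatives l (\<lambda>x. y x * v x) (\<lambda>x. y x * v1 x + y1 x * v x)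
    (\<lambda>x. y x * v2 x + 2 * (y1 x * v1 x) + y2 x * v x)"
proof -
  have Y: "\<And>x. x \<ge> l \<Longrightarrow> (y has_vector_derivative y1 x) (at x within {l..})" "locally_abs_continuous l y"
      "locally_abs_continuous l y1" "AE x in half_line l. (y1 has_vector_derivative y2 x) (at x within {l..})"
    and V: "\<And>x. x \<ge> l \<Longrightarrow> (v has_vector_derivative v1 x) (at x within {l..})" "locally_abs_continuous l v"
      "locally_abs_continuous l v1" "AE x in half_line l. (v1 has_vector_derivative v2 x) (at x within {l..})"
    using assms by (auto simp: has_two_derivatives_def)
  have "AE x in half_line l. ((\<lambda>x. y x * v1 x + y1 x * v x) has_vector_derivative
      (y x * v2 x + 2 * (y1 x * v1 x) + y2 x * v x)) (at x within {l..})"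
    using Y(4) V(4) AE_half_line_le
  proof eventually_elim
    case (elim x)
    have "((\<lambda>x. y x * v1 x + y1 x * v x) has_vector_derivative
      ((y x * v2 x + y1 x * v1 x) + (y1 x * v1 x + y2 x * v x))) (at x within {l..})"
      using elim Y(1) V(1) by (intro has_vector_derivative_add has_vector_derivative_mult) auto
    then show ?case by (simp add: algebra_simps)
  qed
  moreover have "locally_abs_continuous l (\<lambda>x. y x * v1 x + y1 x * v x)"
    using locally_ac_lincomb[OF locally_ac_mult[OF Y(2) V(3)] locally_ac_mult[OF Y(3) V(2)], of 1 1] by simp
  ultimately show ?thesis
    unfolding has_two_derivatives_def using Y V locally_ac_mult[OF Y(2) V(2)]
    by (auto intro!: has_vector_derivative_mult)
qed

text \<open>The fundamental theorem for the Wronskian \<open>y1 cnj v - y cnj v1\<close>, whose derivative loses the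
product of the first derivatives.\<close>

lemma lagrange_identity_interval:
  assumes "has_two_derivatives l y y1 y2" "has_two_derivatives l v v1 v2" "l \<le> b"
  shows "((\<lambda>x. y2 x * cnj (v x) - y x * cnj (v2 x)) has_integral
      ((y1 b * cnj (v b) - y b * cnj (v1 b)) - (y1 l * cnj (v l) - y l * cnj (v1 l)))) {l..b}"
    and "(\<lambda>x. y2 x * cnj (v x) - y x * cnj (v2 x)) absolutely_integrable_on {l..b}"
proof -
  have Y: "\<And>x. x \<ge> l \<Longrightarrow> (y has_vector_derivative y1 x) (at x within {l..})" "locally_abs_continuous l y"
      "locally_abs_continuous l y1" "AE x in half_line l. (y1 has_vector_derivative y2 x) (at x within {l..})"
    and V: "\<And>x. x \<ge> l \<Longrightarrow> (v has_vector_derivative v1 x) (at x within {l..})" "locally_abs_continuous l v"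
      "locally_abs_continuous l v1" "AE x in half_line l. (v1 has_vector_derivative v2 x) (at x within {l..})"
    using assms by (auto simp: has_two_derivatives_def)
  define W where "W x = y1 x * cnj (v x) - y x * cnj (v1 x)" for x
  have W: "locally_abs_continuous l W"
    unfolding W_def
    using locally_ac_lincomb[OF locally_ac_mult[OF Y(3) locally_ac_cnj[OF V(2)]] locally_ac_mult[OF Y(2) locally_ac_cnj[OF V(3)]], of 1 "-1"] by simp
  then have Wb: "abs_continuous_between l b W" using assms(3) by (simp add: locally_abs_continuous_def)
  have "AE x in half_line l. hderiv l W x = y2 x * cnj (v x) - y x * cnj (v2 x)"
    using Y(4) V(4) AE_half_line_le
  proof eventually_elim
    case (elim x)
    have "(W has_vector_derivative ((y1 x * cnj (v1 x) + y2 x * cnj (v x)) - (y x * cnj (v2 x) + y1 x * cnj (v1 x)))) (at x within {l..})"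
      unfolding W_def using elim Y(1) V(1)
      by (intro has_vector_derivative_diff has_vector_derivative_mult has_vector_derivative_cnj) auto
    then have "(W has_vector_derivative (y2 x * cnj (v x) - y x * cnj (v2 x))) (at x within {l..})"
      by simp
    then show ?case using elim by (intro hderiv_eqI)
  qed
  then obtain N where N: "N \<in> null_sets (half_line l)"
      "{x \<in> space (half_line l). hderiv l W x \<noteq> y2 x * cnj (v x) - y x * cnj (v2 x)} \<subseteq> N"
    unfolding eventually_ae_filter by (rule bexE)
  note N = N(2,1)
  then have neg: "negligible N"
    using null_sets_restrict_space[of "{l..}" lebesgue N] by (simp add: negligible_iff_null_sets)
  show "((\<lambda>x. y2 x * cnj (v x) - y x * cnj (v2 x)) has_integral
      ((y1 b * cnj (v b) - y b * cnj (v1 b)) - (y1 l * cnj (v l) - y l * cnj (v1 l)))) {l..b}"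
  proof (rule has_integral_spike[OF neg])
    show "(hderiv l W has_integral
      ((y1 b * cnj (v b) - y b * cnj (v1 b)) - (y1 l * cnj (v l) - y l * cnj (v1 l)))) {l..b}"
      using abs_continuous_ftc(2)[OF Wb assms(3)] by (simp add: W_def)
  qed (use N(1) in auto)
  show "(\<lambda>x. y2 x * cnj (v x) - y x * cnj (v2 x)) absolutely_integrable_on {l..b}"
    by (rule absolutely_integrable_spike[OF abs_continuous_ftc(1)[OF Wb assms(3)] neg]) (use N(1) in auto)
qed

section \<open>Green's formula on the maximal domain\<close>

lemma two_derivatives_expr:
  assumes "has_two_derivatives l y y1 y2"
  shows "AE x in half_line l. schroedinger_expr l q y x = - y2 x + of_real (q x) * y x"
  using two_derivatives_smooth(3)[OF assms] by eventually_elim (simp add: schroedinger_expr_def)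

lemma two_derivatives_cong:
  assumes "has_two_derivatives l y y1 y2" "\<And>x. x \<ge> l \<Longrightarrow> v x = y x"
  shows "has_two_derivatives l v y1 y2"
  using assms locally_ac_cong[of l y v]
  unfolding has_two_derivatives_def
  by (auto intro: has_vector_derivative_transform)

lemma max_domainD:
  assumes "y \<in> max_domain l q"
  shows "y \<in> L2 l" "schroedinger_expr l q y \<in> L2 l"
    "has_two_derivatives l y (hderiv l y) (hderiv l (hderiv l y))"
    "\<And>x. x < l \<Longrightarrow> y x = 0"
  using assms by (simp_all add: max_domain_def smooth_enough_two_derivatives)

lemma max_domain_lincomb:
  assumes y: "y \<in> max_domain l q" and v: "v \<in> max_domain l q"
  shows "(\<lambda>x. a * y x + b * v x) \<in> max_domain l q"
    and "AE x in half_line l. schroedinger_expr l q (\<lambda>x. a * y x + b * v x) x =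
      a * schroedinger_expr l q y x + b * schroedinger_expr l q v x"
    and "hderiv l (\<lambda>x. a * y x + b * v x) l = a * hderiv l y l + b * hderiv l v l"
proof -
  note T = two_derivatives_lincomb[OF max_domainD(3)[OF y] max_domainD(3)[OF v], of a b]
  show E: "AE x in half_line l. schroedinger_expr l q (\<lambda>x. a * y x + b * v x) x =
      a * schroedinger_expr l q y x + b * schroedinger_expr l q v x"
    using two_derivatives_expr[OF T, of q] by eventually_elim (simp add: schroedinger_expr_def algebra_simps)
  show "hderiv l (\<lambda>x. a * y x + b * v x) l = a * hderiv l y l + b * hderiv l v l"
    using two_derivatives_smooth(2)[OF T, of l] by simp
  have "schroedinger_expr l q (\<lambda>x. a * y x + b * v x) \<in> L2 l"
    by (rule L2_cong_AE[OF L2_lincomb[OF max_domainD(2)[OF y] max_domainD(2)[OF v]] E])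
  then show "(\<lambda>x. a * y x + b * v x) \<in> max_domain l q"
    using two_derivatives_smooth(1)[OF T] L2_lincomb[OF max_domainD(1)[OF y] max_domainD(1)[OF v]]
      max_domainD(4)[OF y] max_domainD(4)[OF v] by (simp add: max_domain_def)
qed

definition boundary_form :: "real \<Rightarrow> (real \<Rightarrow> complex) \<Rightarrow> (real \<Rightarrow> complex) \<Rightarrow> complex" where
  "boundary_form l y v = hderiv l y l * cnj (v l) - y l * cnj (hderiv l v l)"

text \<open>The boundary term at infinity in Green's formula. It is shown to vanish, which is the limit
point property at infinity.\<close>

definition green_defect ::
    "real \<Rightarrow> (real \<Rightarrow> real) \<Rightarrow> (real \<Rightarrow> complex) \<Rightarrow> (real \<Rightarrow> complex) \<Rightarrow> complex" where
  "green_defect l q y v = L2_inner l (schroedinger_expr l q y) v - L2_inner l y (schroedinger_expr l q v)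
     - boundary_form l y v"

lemma green_defect_hermitian: "green_defect l q v y = - cnj (green_defect l q y v)"
  unfolding green_defect_def boundary_form_def
  using L2_inner_cnj[of l "schroedinger_expr l q v" y] L2_inner_cnj[of l v "schroedinger_expr l q y"]
  by (simp add: algebra_simps)

lemma green_defect_lincomb:
  assumes y: "y \<in> max_domain l q" and w: "w \<in> max_domain l q" and v: "v \<in> max_domain l q"
  shows "green_defect l q (\<lambda>x. a * y x + b * w x) v = a * green_defect l q y v + b * green_defect l q w v"
proof -
  have "L2_inner l (schroedinger_expr l q (\<lambda>x. a * y x + b * w x)) v =
      L2_inner l (\<lambda>x. a * schroedinger_expr l q y x + b * schroedinger_expr l q w x) v"
    using max_domain_lincomb(2)[OF y w]
    by (intro L2_inner_cong_AE L2_lincomb max_domainD[OF y] max_domainD[OF v] max_domainD[OF w]) auto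
  then show ?thesis
    unfolding green_defect_def boundary_form_def max_domain_lincomb(3)[OF y w]
    using y w v by (simp add: L2_inner_lincomb_left max_domainD algebra_simps)
qed

lemma integral_half_line_truncate:
  fixes f :: "real \<Rightarrow> complex"
  assumes "f absolutely_integrable_on {l..b}" "(f has_integral I) {l..b}"
    and "AE x in half_line l. g x = (if x \<le> b then f x else 0)" "g \<in> borel_measurable (half_line l)"
  shows "(\<integral>x. g x \<partial>half_line l) = I"
proof -
  have S: "set_lebesgue_integral lebesgue {l..b} f = I"
    using set_lebesgue_integral_eq_integral(2)[OF assms(1)] assms(2) by (simp add: integral_unique)
  have int: "integrable lebesgue (\<lambda>x. indicator {l..b} x *\<^sub>R f x)"
    using assms(1) by (simp add: set_integrable_def)
  have eq: "indicator {l..} x *\<^sub>R (if x \<le> b then f x else 0) = indicator {l..b} x *\<^sub>R f x" for x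
    by (auto simp: indicator_def)
  have "integrable (half_line l) (\<lambda>x. if x \<le> b then f x else 0)"
    by (subst integrable_restrict_space) (use int eq in auto)
  then have m: "(\<lambda>x. if x \<le> b then f x else 0) \<in> borel_measurable (half_line l)"
    by (rule borel_measurable_integrable)
  have "(\<integral>x. g x \<partial>half_line l) = (\<integral>x. (if x \<le> b then f x else 0) \<partial>half_line l)"
    by (rule integral_cong_AE[OF assms(4) m assms(3)])
  also have "\<dots> = (\<integral>x. indicator {l..} x *\<^sub>R (if x \<le> b then f x else 0) \<partial>lebesgue)"
    by (rule integral_restrict_space) auto
  also have "\<dots> = I" unfolding eq using S by (simp add: set_lebesgue_integral_def)
  finally show ?thesis .
qed

lemma green_defect_compact_support:
  assumes u: "u \<in> max_domain l q" and v: "v \<in> max_domain l q"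
    and supp: "\<And>x. x \<ge> b \<Longrightarrow> u x = 0" and "l < b"
  shows "green_defect l q u v = 0"
proof -
  let ?u1 = "hderiv l u" and ?u2 = "hderiv l (hderiv l u)"
  let ?v1 = "hderiv l v" and ?v2 = "hderiv l (hderiv l v)"
  \<comment> \<open>At \<open>b\<close> itself only the value of \<open>u\<close> is known to vanish; beyond \<open>b\<close> its derivatives do as well.\<close>
  define c where "c = b + 1"
  have der0: "hderiv l u x = 0" if "x > b" for x
  proof (rule hderiv_eqI)
    have "((\<lambda>_. 0::complex) has_vector_derivative 0) (at x)" by simp
    then have "(u has_vector_derivative 0) (at x)"
      by (rule has_vector_derivative_transform_within_open[of _ _ _ "{b<..}"]) (use that supp in auto)
    then show "(u has_vector_derivative 0) (at x within {l..})" by (rule has_vector_derivative_at_within)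
  qed (use that \<open>l < b\<close> in simp)
  have der20: "hderiv l (hderiv l u) x = 0" if "x > b" for x
  proof (rule hderiv_eqI)
    have "((\<lambda>_. 0::complex) has_vector_derivative 0) (at x)" by simp
    then have "(hderiv l u has_vector_derivative 0) (at x)"
      by (rule has_vector_derivative_transform_within_open[of _ _ _ "{b<..}"]) (use that der0 in auto)
    then show "(hderiv l u has_vector_derivative 0) (at x within {l..})" by (rule has_vector_derivative_at_within)
  qed (use that \<open>l < b\<close> in simp)
  have "l \<le> c" using \<open>l < b\<close> by (simp add: c_def)
  note LI = lagrange_identity_interval[OF max_domainD(3)[OF u] max_domainD(3)[OF v] this]
  define g where "g x = schroedinger_expr l q u x * cnj (v x) - u x * cnj (schroedinger_expr l q v x)" for x
  have g: "g x = - (if x \<le> c then ?u2 x * cnj (v x) - u x * cnj (?v2 x) else 0)" for x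
    using supp[of x] der20[of x] by (auto simp: g_def schroedinger_expr_def c_def algebra_simps)
  have gi: "integrable (half_line l) (\<lambda>x. - g x)"
    unfolding g_def using u v by (intro Bochner_Integration.integrable_minus Bochner_Integration.integrable_diff L2_integrable_mult max_domainD)
  have "(\<integral>x. - g x \<partial>half_line l) = ((?u1 c * cnj (v c) - u c * cnj (?v1 c)) - (?u1 l * cnj (v l) - u l * cnj (?v1 l)))"
    by (rule integral_half_line_truncate[OF LI(2,1)]) (use g gi in \<open>auto intro: borel_measurable_integrable\<close>)
  moreover have "u c = 0" "?u1 c = 0" using supp der0 by (simp_all add: c_def)
  ultimately have "- (\<integral>x. g x \<partial>half_line l) = - boundary_form l u v"
    by (simp add: boundary_form_def)
  then have "(\<integral>x. g x \<partial>half_line l) = boundary_form l u v" by simp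
  moreover have "(\<integral>x. g x \<partial>half_line l) = L2_inner l (schroedinger_expr l q u) v - L2_inner l u (schroedinger_expr l q v)"
    unfolding g_def L2_inner_def using u v
    by (intro Bochner_Integration.integral_diff L2_integrable_mult max_domainD)
  ultimately show ?thesis by (simp add: green_defect_def)
qed

lemma positive_part_power_derivative:
  "((\<lambda>t::real. (max 0 t) ^ Suc (Suc n)) has_real_derivative real (Suc (Suc n)) * (max 0 t) ^ Suc n) (at t)"
proof -
  consider "t < 0" | "t > 0" | "t = 0" by linarith
  then show ?thesis
  proof cases
    case 1
    have "((\<lambda>t::real. 0) has_real_derivative 0) (at t)" by simp
    then have "((\<lambda>t::real. (max 0 t) ^ Suc (Suc n)) has_real_derivative 0) (at t)"
      by (rule has_field_derivative_transform_within_open[of _ _ _ "{..<0}"]) (use 1 in auto)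
    then show ?thesis using 1 by simp
  next
    case 2
    have "((\<lambda>t::real. t ^ Suc (Suc n)) has_real_derivative real (Suc (Suc n)) * t ^ Suc n) (at t)"
      by (rule derivative_eq_intros refl | simp)+
    then have "((\<lambda>t::real. (max 0 t) ^ Suc (Suc n)) has_real_derivative real (Suc (Suc n)) * t ^ Suc n) (at t)"
      by (rule has_field_derivative_transform_within_open[of _ _ _ "{0<..}"]) (use 2 in auto)
    then show ?thesis using 2 by simp
  next
    case 3
    have "((\<lambda>h::real. ((max 0 (0 + h)) ^ Suc (Suc n) - (max 0 0) ^ Suc (Suc n)) / h) \<longlongrightarrow> 0) (at 0)"
    proof (rule Lim_null_comparison)
      show "((\<lambda>h::real. \<bar>h\<bar> ^ Suc n) \<longlongrightarrow> 0) (at 0)"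
        by (rule tendsto_eq_intros refl | simp)+
      show "\<forall>\<^sub>F h in at (0::real). norm (((max 0 (0 + h)) ^ Suc (Suc n) - (max 0 0) ^ Suc (Suc n)) / h) \<le> \<bar>h\<bar> ^ Suc n"
      proof (rule always_eventually, rule allI)
        fix h :: real
        show "norm (((max 0 (0 + h)) ^ Suc (Suc n) - (max 0 0) ^ Suc (Suc n)) / h) \<le> \<bar>h\<bar> ^ Suc n"
        proof (cases "h \<le> 0")
          case True
          then have "max 0 (0 + h) = 0" by simp
          then show ?thesis by (simp del: power_Suc add: power_0_left)
        qed (simp add: max_def)
      qed
    qed
    then show ?thesis using 3 by (simp add: has_field_derivative_iff)
  qed
qed

lemma positive_part_square_cube_derivative:
  "((\<lambda>t::real. (max 0 t)\<^sup>2) has_real_derivative 2 * max 0 t) (at t)"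
  "((\<lambda>t::real. (max 0 t) ^ 3) has_real_derivative 3 * (max 0 t)\<^sup>2) (at t)"
  using positive_part_power_derivative[of 0 t] positive_part_power_derivative[of 1 t]
  by (simp_all add: numeral_3_eq_3 numeral_2_eq_2)

text \<open>The third power makes even the second derivative Lipschitz continuous. The slope \<open>- 3\<close> at
the end point is harmless, since boundary values are adjusted by linear combinations.\<close>

definition cutoff :: "real \<Rightarrow> real \<Rightarrow> complex" where
  "cutoff l x = of_real ((max 0 (l + 1 - x)) ^ 3)"

lemma cutoff_two_derivatives:
  "has_two_derivatives l (cutoff l) (\<lambda>x. of_real (- 3 * (max 0 (l + 1 - x)) ^ 2)) (\<lambda>x. of_real (6 * max 0 (l + 1 - x)))"
proof -
  have 1: "(cutoff l has_vector_derivative of_real (- 3 * (max 0 (l + 1 - x)) ^ 2)) (at x within S)" for x S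
  proof -
    have "((\<lambda>x. (max 0 (l + 1 - x)) ^ 3) has_real_derivative (3 * (max 0 (l + 1 - x))\<^sup>2) * (0 - 1)) (at x within S)"
      by (rule DERIV_chain2[OF positive_part_square_cube_derivative(2)]) (auto intro!: derivative_eq_intros)
    then show ?thesis unfolding cutoff_def
      by (intro has_vector_derivative_of_real) (simp add: has_real_derivative_iff_has_vector_derivative)
  qed
  have 2: "((\<lambda>x. complex_of_real (- 3 * (max 0 (l + 1 - x)) ^ 2)) has_vector_derivative of_real (6 * max 0 (l + 1 - x))) (at x within S)" for x S
  proof -
    have "((\<lambda>x. - 3 * (max 0 (l + 1 - x)) ^ 2) has_real_derivative - 3 * ((2 * (max 0 (l + 1 - x))) * (0 - 1))) (at x within S)"
      by (intro DERIV_cmult DERIV_chain2[OF positive_part_square_cube_derivative(1)]) (auto intro!: derivative_eq_intros)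
    then show ?thesis
      by (intro has_vector_derivative_of_real) (simp add: has_real_derivative_iff_has_vector_derivative)
  qed
  have m: "\<bar>max 0 (l + 1 - t)\<bar> \<le> 1" if "l \<le> t" for t using that by auto
  have "\<bar>(max 0 (l + 1 - y)) ^ n - (max 0 (l + 1 - x)) ^ n\<bar> \<le> real n * (y - x)" if "l \<le> x" "x \<le> y" for x y n
  proof -
    have "norm ((max 0 (l + 1 - y)) ^ n - (max 0 (l + 1 - x)) ^ n) \<le> real n * norm (max 0 (l + 1 - y) - max 0 (l + 1 - x))"
      using m[of x] m[of y] that by (intro norm_power_diff) auto
    also have "\<dots> \<le> real n * (y - x)" using that by (intro mult_left_mono) auto
    finally show ?thesis by simp
  qed
  note L = this
  have ac1: "locally_abs_continuous l (cutoff l)"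
    unfolding locally_abs_continuous_def
  proof (intro allI impI abs_continuous_lipschitz)
    fix x y assume "l \<le> x" "x \<le> y"
    from L[OF this, of 3] show "norm (cutoff l y - cutoff l x) \<le> 3 * (y - x)"
      unfolding cutoff_def of_real_diff[symmetric] norm_of_real by simp
  qed simp
  have ac2: "locally_abs_continuous l (\<lambda>x. complex_of_real (- 3 * (max 0 (l + 1 - x)) ^ 2))"
    unfolding locally_abs_continuous_def
  proof (intro allI impI abs_continuous_lipschitz)
    fix x y assume "l \<le> x" "x \<le> y"
    from L[OF this, of 2] show "norm (complex_of_real (- 3 * (max 0 (l + 1 - y)) ^ 2) - complex_of_real (- 3 * (max 0 (l + 1 - x)) ^ 2)) \<le> 6 * (y - x)"
      unfolding of_real_diff[symmetric] norm_of_real abs_le_iff by simp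
  qed simp
  show ?thesis unfolding has_two_derivatives_def using 1 2 ac1 ac2 by simp
qed

lemma continuous_compact_support_L2:
  assumes cont: "continuous_on {l..} f" and supp: "\<And>x. x \<ge> b \<Longrightarrow> f x = 0"
  shows "f \<in> L2 l"
proof -
  have m: "f \<in> borel_measurable (half_line l)"
    by (rule continuous_imp_measurable_on_sets_lebesgue[OF cont]) simp
  have "continuous_on {l..b} (\<lambda>x. (norm (f x))\<^sup>2)"
    by (intro continuous_intros continuous_on_subset[OF cont]) auto
  then have "(\<lambda>x. (norm (f x))\<^sup>2) absolutely_integrable_on {l..b}"
    by (rule absolutely_integrable_continuous_real)
  then have "integrable lebesgue (\<lambda>x. indicator {l..b} x *\<^sub>R (norm (f x))\<^sup>2)"
    by (simp add: set_integrable_def)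
  moreover have "(\<lambda>x. indicator {l..b} x *\<^sub>R (norm (f x))\<^sup>2) = (\<lambda>x. indicator {l..} x *\<^sub>R (norm (f x))\<^sup>2)"
    using supp by (auto simp: indicator_def fun_eq_iff)
  ultimately have "integrable lebesgue (\<lambda>x. indicator {l..} x *\<^sub>R (norm (f x))\<^sup>2)" by (simp only:)
  then have "integrable (half_line l) (\<lambda>x. (norm (f x))\<^sup>2)"
    by (subst integrable_restrict_space) auto
  with m show ?thesis by (simp add: L2_def)
qed

text \<open>A smooth function with compact support need not lie in the maximal domain, because its product
with \<open>q\<close> need not be square-integrable. For a cut-off solution \<open>\<chi>\<phi>\<close> the terms with \<open>q\<close> combine to
\<open>z \<chi>\<phi>\<close>, and what remains is continuous with compact support.\<close>

lemma cutoff_solution: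
  assumes sol: "is_solution l q z \<phi>"
  obtains u where "u \<in> max_domain l q" "\<And>x. x \<ge> l + 1 \<Longrightarrow> u x = 0"
    "u l = \<phi> l" "hderiv l u l = hderiv l \<phi> l - 3 * \<phi> l"
proof -
  define u where "u x = (if x < l then 0 else cutoff l x * \<phi> x)" for x
  let ?\<chi> = "cutoff l" and ?\<chi>1 = "\<lambda>x. complex_of_real (- 3 * (max 0 (l + 1 - x)) ^ 2)"
    and ?\<chi>2 = "\<lambda>x. complex_of_real (6 * max 0 (l + 1 - x))"
  let ?\<phi>1 = "hderiv l \<phi>" and ?\<phi>2 = "hderiv l (hderiv l \<phi>)"
  have P: "has_two_derivatives l \<phi> ?\<phi>1 ?\<phi>2"
    using sol by (simp add: is_solution_def smooth_enough_two_derivatives)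
  have T: "has_two_derivatives l u (\<lambda>x. ?\<chi> x * ?\<phi>1 x + ?\<chi>1 x * \<phi> x)
      (\<lambda>x. ?\<chi> x * ?\<phi>2 x + 2 * (?\<chi>1 x * ?\<phi>1 x) + ?\<chi>2 x * \<phi> x)"
    by (rule two_derivatives_cong[OF two_derivatives_mult[OF cutoff_two_derivatives P]]) (simp add: u_def)
  have zero: "?\<chi> x = 0" "?\<chi>1 x = 0" "?\<chi>2 x = 0" if "x \<ge> l + 1" for x
    using that by (simp_all add: cutoff_def max_def)
  have c\<phi>: "continuous_on {l..} \<phi>" "continuous_on {l..} ?\<phi>1"
    using P by (auto simp: has_two_derivatives_def intro: locally_ac_continuous)
  have c\<chi>: "continuous_on {l..} ?\<chi>" by (auto simp: cutoff_def intro!: continuous_intros)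
  have "continuous_on {l..} (\<lambda>x. z * (?\<chi> x * \<phi> x) - 2 * (?\<chi>1 x * ?\<phi>1 x) - ?\<chi>2 x * \<phi> x)"
    by (intro continuous_intros c\<phi> c\<chi>)
  then have L: "(\<lambda>x. z * (?\<chi> x * \<phi> x) - 2 * (?\<chi>1 x * ?\<phi>1 x) - ?\<chi>2 x * \<phi> x) \<in> L2 l"
    by (rule continuous_compact_support_L2[where b="l + 1"]) (simp add: zero)
  have "AE x in half_line l. schroedinger_expr l q \<phi> x = z * \<phi> x" using sol by (simp add: is_solution_def)
  then have E: "AE x in half_line l. schroedinger_expr l q u x =
      z * (?\<chi> x * \<phi> x) - 2 * (?\<chi>1 x * ?\<phi>1 x) - ?\<chi>2 x * \<phi> x"
    using two_derivatives_expr[OF T, of q] AE_half_line_le[of l]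
  proof eventually_elim
    case (elim x)
    have ux: "u x = ?\<chi> x * \<phi> x" using elim by (simp add: u_def)
    have "?\<chi> x * schroedinger_expr l q \<phi> x = ?\<chi> x * (z * \<phi> x)" using elim by simp
    then show ?case unfolding elim(2) ux by (simp add: schroedinger_expr_def algebra_simps)
  qed
  have "schroedinger_expr l q u \<in> L2 l" by (rule L2_cong_AE[OF L E])
  moreover have "u \<in> L2 l"
  proof (rule continuous_compact_support_L2)
    show "continuous_on {l..} u"
      using T by (auto simp: has_two_derivatives_def intro: locally_ac_continuous)
    show "u x = 0" if "x \<ge> l + 1" for x using zero(1)[OF that] by (simp add: u_def)
  qed
  ultimately have "u \<in> max_domain l q"
    using two_derivatives_smooth(1)[OF T] by (simp add: max_domain_def u_def)
  moreover have "hderiv l u l = hderiv l \<phi> l - 3 * \<phi> l"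
    using two_derivatives_smooth(2)[OF T, of l] by (simp add: cutoff_def)
  ultimately show thesis
    by (intro that[of u]) (auto simp: u_def zero cutoff_def)
qed

text \<open>Cut-off versions of the two fundamental solutions at the spectral parameter \<open>\<i>\<close> span all
boundary values.\<close>

lemma compactly_supported_boundary_values:
  assumes w: "weyl_function l q m"
  obtains p where "p \<in> max_domain l q" "\<forall>x\<ge>l+1. p x = 0" "p l = \<alpha>" "hderiv l p l = \<beta>"
proof -
  obtain \<phi>1 \<phi>2 where \<phi>: "is_solution l q \<i> \<phi>1" "\<phi>1 l = 0" "hderiv l \<phi>1 l = 1"
      "is_solution l q \<i> \<phi>2" "\<phi>2 l = -1" "hderiv l \<phi>2 l = 0"
    using w[unfolded weyl_function_def, rule_format, of \<i>] by auto
  obtain u1 where u1: "u1 \<in> max_domain l q" "\<forall>x\<ge>l+1. u1 x = 0" "u1 l = 0" "hderiv l u1 l = 1"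
    using cutoff_solution[OF \<phi>(1)] \<phi>(2,3) by (metis diff_zero mult_zero_right)
  obtain u2 where u2: "u2 \<in> max_domain l q" "\<forall>x\<ge>l+1. u2 x = 0" "u2 l = -1" "hderiv l u2 l = 3"
    using cutoff_solution[OF \<phi>(4)] \<phi>(5,6)
    by (metis diff_0 minus_mult_minus mult.right_neutral minus_minus mult_minus_right)
  show thesis
  proof (rule that)
    show "(\<lambda>x. (\<beta> + 3 * \<alpha>) * u1 x + (- \<alpha>) * u2 x) \<in> max_domain l q"
      by (rule max_domain_lincomb(1)[OF u1(1) u2(1)])
    show "hderiv l (\<lambda>x. (\<beta> + 3 * \<alpha>) * u1 x + (- \<alpha>) * u2 x) l = \<beta>"
      unfolding max_domain_lincomb(3)[OF u1(1) u2(1)] using u1 u2 by simp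
  qed (simp_all add: u1 u2)
qed

text \<open>Every function of the maximal domain is the sum of a function in the minimal domain and one of
compact support. The boundary term at infinity vanishes for two functions of the first kind by
symmetry of the minimal operator, and as soon as one of the functions has compact support.\<close>

theorem green_formula:
  assumes sym: "symmetric_operator l (min_domain l q) (schroedinger_expr l q)"
    and w: "weyl_function l q m"
    and y: "y \<in> max_domain l q" and v: "v \<in> max_domain l q"
  shows "L2_inner l (schroedinger_expr l q y) v - L2_inner l y (schroedinger_expr l q v) = boundary_form l y v"
proof -
  have split: "\<exists>p y0. p \<in> max_domain l q \<and> (\<forall>x\<ge>l+1. p x = 0) \<and> y0 \<in> min_domain l q \<and> y0 \<in> max_domain l q \<and>
      y = (\<lambda>x. 1 * y0 x + 1 * p x)" if y: "y \<in> max_domain l q" for y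
  proof -
    obtain p where p: "p \<in> max_domain l q" "\<forall>x\<ge>l+1. p x = 0" "p l = y l" "hderiv l p l = hderiv l y l"
      by (rule compactly_supported_boundary_values[OF w])
    define y0 where "y0 x = 1 * y x + (-1) * p x" for x
    have y0: "y0 \<in> max_domain l q" unfolding y0_def by (rule max_domain_lincomb(1)[OF y p(1)])
    have "hderiv l y0 l = 0"
      unfolding y0_def using max_domain_lincomb(3)[OF y p(1), of 1 "-1"] p by simp
    then have "y0 \<in> min_domain l q" using y0 p by (simp add: min_domain_def y0_def)
    moreover have "y = (\<lambda>x. 1 * y0 x + 1 * p x)" by (simp add: y0_def)
    ultimately show ?thesis using p y0 by blast
  qed
  obtain p y0 where p: "p \<in> max_domain l q" "\<forall>x\<ge>l+1. p x = 0" "y0 \<in> min_domain l q" "y0 \<in> max_domain l q"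
    and y_eq: "y = (\<lambda>x. 1 * y0 x + 1 * p x)" using split[OF y] by blast
  obtain r v0 where r: "r \<in> max_domain l q" "\<forall>x\<ge>l+1. r x = 0" "v0 \<in> min_domain l q" "v0 \<in> max_domain l q"
    and v_eq: "v = (\<lambda>x. 1 * v0 x + 1 * r x)" using split[OF v] by blast
  have comp: "green_defect l q k f = 0" if "k \<in> max_domain l q" "\<forall>x\<ge>l+1. k x = 0" "f \<in> max_domain l q" for k f
    using green_defect_compact_support[OF that(1,3), of "l + 1"] that(2) by simp
  have "green_defect l q v0 y0 = 0"
    using sym p(3) r(3) unfolding symmetric_operator_def green_defect_def boundary_form_def
    by (auto simp: min_domain_def)
  moreover have "green_defect l q r y0 = 0" using comp r p by blast
  ultimately have "green_defect l q v y0 = 0"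
    unfolding v_eq using green_defect_lincomb[OF r(4) r(1) p(4), of 1 1] by simp
  then have "green_defect l q y0 v = 0" using green_defect_hermitian[of l q y0 v] by simp
  moreover have "green_defect l q p v = 0" using comp p v by blast
  ultimately have "green_defect l q y v = 0"
    using green_defect_lincomb[OF p(4) p(1) v, of 1 1] by (simp add: y_eq)
  then show ?thesis by (simp add: green_defect_def)
qed

section \<open>The Herglotz representation\<close>

definition circle_point :: "real \<Rightarrow> complex" where
  "circle_point t = exp (2 * of_real pi * \<i> * of_real t)"

lemma norm_circle_point [simp]: "norm (circle_point t) = 1"
  by (simp add: circle_point_def norm_exp_eq_Re)

lemma circle_point_cnj: "circle_point t * cnj (circle_point t) = 1"
  using complex_norm_square[of "circle_point t"] by simp

lemma circle_point_nz: "circle_point t \<noteq> 0"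
  by (simp add: circle_point_def)

lemma continuous_circle_point: "continuous_on S circle_point"
  unfolding circle_point_def by (intro continuous_intros)

lemma Cauchy_circle_point:
  assumes "G holomorphic_on cball 0 1" "norm \<zeta> < 1"
  shows "((\<lambda>t. G (circle_point t) * circle_point t / (circle_point t - \<zeta>)) has_integral G \<zeta>) {0..1}"
proof -
  have "((\<lambda>u. G u / (u - \<zeta>)) has_contour_integral (2 * of_real pi * \<i> * G \<zeta>)) (circlepath 0 1)"
    using assms by (intro Cauchy_integral_circlepath_simple) auto
  then have "((\<lambda>t. G (circle_point t) / (circle_point t - \<zeta>) * (2 * pi * \<i> * circle_point t))
      has_integral (2 * of_real pi * \<i> * G \<zeta>)) {0..1}"
    unfolding has_contour_integral vector_derivative_circlepath
    by (simp add: circlepath circle_point_def)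
  from has_integral_mult_right[OF this, of "1 / (2 * pi * \<i>)"] show ?thesis
    by (simp add: field_simps)
qed

text \<open>Cauchy's formula gives the integral of \<open>G\<close> against the kernel. The integral of \<open>cnj G\<close> is the
conjugate of Cauchy's formula at the origin, because on the circle the conjugate of the kernel
extends holomorphically to the disc.\<close>

lemma Schwarz_integral_formula:
  assumes G: "G holomorphic_on cball 0 1" and \<zeta>: "norm \<zeta> < 1"
  shows "((\<lambda>t. of_real (Re (G (circle_point t))) * ((circle_point t + \<zeta>) / (circle_point t - \<zeta>)))
    has_integral (G \<zeta> - \<i> * of_real (Im (G 0)))) {0..1}"
proof -
  have ne: "circle_point t \<noteq> \<zeta>" for t using \<zeta> norm_circle_point[of t] by force
  have 1: "((\<lambda>t. G (circle_point t) * circle_point t / (circle_point t - \<zeta>)) has_integral G \<zeta>) {0..1}"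
    by (rule Cauchy_circle_point[OF G \<zeta>])
  have 2: "((\<lambda>t. G (circle_point t)) has_integral G 0) {0..1}"
    using Cauchy_circle_point[OF G, of 0] by (simp add: circle_point_nz)
  have nz: "1 - cnj \<zeta> * w \<noteq> 0" if "norm w \<le> 1" for w
  proof
    assume "1 - cnj \<zeta> * w = 0"
    then have "norm (cnj \<zeta> * w) = 1" by simp
    moreover have "norm (cnj \<zeta> * w) < 1"
      unfolding norm_mult complex_mod_cnj using \<zeta> that mult_left_mono[of "norm w" 1 "norm \<zeta>"] by simp
    ultimately show False by simp
  qed
  have "(\<lambda>w. G w * ((1 + cnj \<zeta> * w) / (1 - cnj \<zeta> * w))) holomorphic_on cball 0 1"
    using nz by (intro holomorphic_intros G) auto
  from Cauchy_circle_point[OF this, of 0]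
  have "((\<lambda>t. G (circle_point t) * ((1 + cnj \<zeta> * circle_point t) / (1 - cnj \<zeta> * circle_point t))) has_integral G 0) {0..1}"
    by (simp add: circle_point_nz)
  then have "((\<lambda>t. cnj (G (circle_point t) * ((1 + cnj \<zeta> * circle_point t) / (1 - cnj \<zeta> * circle_point t)))) has_integral cnj (G 0)) {0..1}"
    unfolding has_integral_cnj[symmetric, of _ "G 0"] by (simp only: o_def)
  moreover have "cnj (G (circle_point t) * ((1 + cnj \<zeta> * circle_point t) / (1 - cnj \<zeta> * circle_point t))) =
      cnj (G (circle_point t)) * ((circle_point t + \<zeta>) / (circle_point t - \<zeta>))" for t
  proof -
    let ?e = "circle_point t"
    have "(1 + \<zeta> * cnj ?e) / (1 - \<zeta> * cnj ?e) = (?e * (1 + \<zeta> * cnj ?e)) / (?e * (1 - \<zeta> * cnj ?e))"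
      using circle_point_nz by simp
    also have "\<dots> = (?e + \<zeta> * (?e * cnj ?e)) / (?e - \<zeta> * (?e * cnj ?e))"
      by (simp add: algebra_simps)
    finally have "(1 + \<zeta> * cnj ?e) / (1 - \<zeta> * cnj ?e) = (?e + \<zeta>) / (?e - \<zeta>)"
      by (simp only: circle_point_cnj mult_1_right)
    then show ?thesis
      by (simp only: complex_cnj_mult complex_cnj_divide complex_cnj_add complex_cnj_diff complex_cnj_one complex_cnj_cnj)
  qed
  ultimately have 3: "((\<lambda>t. cnj (G (circle_point t)) * ((circle_point t + \<zeta>) / (circle_point t - \<zeta>))) has_integral cnj (G 0)) {0..1}"
    by simp
  have "((\<lambda>t. (2 * (G (circle_point t) * circle_point t / (circle_point t - \<zeta>)) - G (circle_point t)
       + cnj (G (circle_point t)) * ((circle_point t + \<zeta>) / (circle_point t - \<zeta>))) / 2)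
      has_integral ((2 * G \<zeta> - G 0 + cnj (G 0)) / 2)) {0..1}"
    by (intro has_integral_divide has_integral_add has_integral_diff has_integral_mult_right 1 2 3)
  moreover have "(2 * (G (circle_point t) * circle_point t / (circle_point t - \<zeta>)) - G (circle_point t)
       + cnj (G (circle_point t)) * ((circle_point t + \<zeta>) / (circle_point t - \<zeta>))) / 2
     = of_real (Re (G (circle_point t))) * ((circle_point t + \<zeta>) / (circle_point t - \<zeta>))" for t
  proof -
    have "2 * (G (circle_point t) * circle_point t / (circle_point t - \<zeta>)) - G (circle_point t) =
        G (circle_point t) * ((circle_point t + \<zeta>) / (circle_point t - \<zeta>))"
      using ne[of t] by (simp add: field_simps)
    moreover have "complex_of_real (Re (G (circle_point t))) = (G (circle_point t) + cnj (G (circle_point t))) / 2"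
      by (simp add: complex_add_cnj)
    ultimately show ?thesis by (simp add: algebra_simps add_divide_distrib)
  qed
  moreover have "(2 * G \<zeta> - G 0 + cnj (G 0)) / 2 = G \<zeta> - \<i> * of_real (Im (G 0))"
    by (simp add: complex_eq_iff)
  ultimately show ?thesis by (simp only:)
qed

definition schwarz_kernel :: "complex \<Rightarrow> real \<Rightarrow> complex" where
  "schwarz_kernel \<zeta> t = (circle_point t + \<zeta>) / (circle_point t - \<zeta>)"

lemma schwarz_kernel_continuous:
  assumes "norm \<zeta> < 1"
  shows "isCont (schwarz_kernel \<zeta>) t"
proof -
  have "circle_point t \<noteq> \<zeta>" for t using assms norm_circle_point[of t] by force
  then have "continuous_on UNIV (schwarz_kernel \<zeta>)"
    unfolding schwarz_kernel_def by (intro continuous_intros continuous_circle_point) auto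
  then show ?thesis by (simp add: continuous_on_eq_continuous_at)
qed

lemma schwarz_kernel_bound:
  assumes "norm \<zeta> < 1"
  shows "norm (schwarz_kernel \<zeta> t) \<le> 2 / (1 - norm \<zeta>)"
proof -
  have "norm (circle_point t + \<zeta>) \<le> 2" using norm_triangle_ineq[of "circle_point t" \<zeta>] assms by simp
  moreover have "1 - norm \<zeta> \<le> norm (circle_point t - \<zeta>)" using norm_triangle_ineq2[of "circle_point t" \<zeta>] by simp
  ultimately show ?thesis unfolding schwarz_kernel_def norm_divide using assms by (intro frac_le) auto
qed

text \<open>For radii \<open>r\<^sub>n\<close> tending to one, the densities \<open>Re F(r\<^sub>n e) / c\<close> define probability measures
on the parameter interval \<open>{0..1}\<close>. By Helly's theorem a subsequence converges weakly, and the
Schwarz kernel of a fixed interior point is a bounded continuous test function.\<close>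

lemma Herglotz_disc:
  assumes F: "F holomorphic_on ball 0 1" and pos: "\<And>\<zeta>. norm \<zeta> < 1 \<Longrightarrow> 0 \<le> Re (F \<zeta>)"
    and F0: "F 0 = of_real c" and "c > 0"
  shows "\<exists>M. real_distribution M \<and> (\<forall>\<zeta>. norm \<zeta> < 1 \<longrightarrow> F \<zeta> = of_real c * (\<integral>t. schwarz_kernel \<zeta> t \<partial>M))"
proof -
  define r where "r n = 1 - 1 / (real n + 2)" for n
  have r: "0 < r n" "r n < 1" for n by (auto simp: r_def field_simps)
  define d where "d n t = indicator {0..1} t * (Re (F (of_real (r n) * circle_point t)) / c)" for n t
  have rc: "norm (of_real (r n) * w) < 1" if "norm w \<le> 1" for n and w :: complex
  proof -
    have "r n * norm w \<le> r n * 1" using r(1)[of n] that by (intro mult_left_mono) auto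
    then have "r n * norm w < 1" using r(2)[of n] by linarith
    then show ?thesis using r(1)[of n] by (simp add: norm_mult)
  qed
  have d0: "0 \<le> d n t" for n t
    unfolding d_def using pos rc[of "circle_point t" n] \<open>c > 0\<close> by (auto simp: indicator_def)
  have hol: "(\<lambda>w. F (of_real (r n) * w)) holomorphic_on cball 0 1" for n
  proof -
    have "F \<circ> (\<lambda>w. of_real (r n) * w) holomorphic_on cball 0 1"
      using rc by (intro holomorphic_on_compose_gen[OF _ F] holomorphic_intros) auto
    then show ?thesis by (simp add: o_def)
  qed
  have cont: "continuous_on {0..1} (\<lambda>t. Re (F (of_real (r n) * circle_point t)) / c)" for n
  proof -
    have "continuous_on (cball 0 1) (\<lambda>w. F (of_real (r n) * w))"
      by (rule holomorphic_on_imp_continuous_on[OF hol])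
    then have "continuous_on {0..1} (\<lambda>t. F (of_real (r n) * circle_point t))"
      by (rule continuous_on_compose2[OF _ continuous_circle_point]) auto
    then show ?thesis using \<open>c > 0\<close> by (intro continuous_intros) auto
  qed
  have d_meas[measurable]: "d n \<in> borel_measurable borel" for n
    using borel_measurable_continuous_on_indicator[OF _ cont[of n]] by (simp add: d_def[abs_def])
  define \<mu> where "\<mu> n = density lborel (\<lambda>t. ennreal (d n t))" for n
  have key: "(\<integral>t. schwarz_kernel \<zeta> t \<partial>\<mu> n) = F (of_real (r n) * \<zeta>) / of_real c" 
    "integrable lborel (\<lambda>t. d n t *\<^sub>R schwarz_kernel \<zeta> t)" if "norm \<zeta> < 1" for n \<zeta>
  proof -
    have kc: "continuous_on UNIV (schwarz_kernel \<zeta>)"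
      using schwarz_kernel_continuous[OF that] by (simp add: continuous_on_eq_continuous_at)
    have [measurable]: "schwarz_kernel \<zeta> \<in> borel_measurable borel"
      by (rule borel_measurable_continuous_onI[OF kc])
    have eq: "d n t *\<^sub>R schwarz_kernel \<zeta> t =
        indicator {0..1} t *\<^sub>R ((Re (F (of_real (r n) * circle_point t)) / c) *\<^sub>R schwarz_kernel \<zeta> t)" for t
      by (auto simp: d_def indicator_def)
    have "continuous_on {0..1} (\<lambda>t. (Re (F (of_real (r n) * circle_point t)) / c) *\<^sub>R schwarz_kernel \<zeta> t)"
      by (intro continuous_on_scaleR cont continuous_on_subset[OF kc]) auto
    then have si: "set_integrable lborel {0..1} (\<lambda>t. (Re (F (of_real (r n) * circle_point t)) / c) *\<^sub>R schwarz_kernel \<zeta> t)"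
      by (rule borel_integrable_atLeastAtMost')
    then show "integrable lborel (\<lambda>t. d n t *\<^sub>R schwarz_kernel \<zeta> t)"
      unfolding eq by (simp add: set_integrable_def)
    have "(\<integral>t. schwarz_kernel \<zeta> t \<partial>\<mu> n) = (\<integral>t. d n t *\<^sub>R schwarz_kernel \<zeta> t \<partial>lborel)"
      unfolding \<mu>_def using d0 by (intro integral_density) auto
    also have "\<dots> = integral {0..1} (\<lambda>t. (Re (F (of_real (r n) * circle_point t)) / c) *\<^sub>R schwarz_kernel \<zeta> t)"
      unfolding eq using set_borel_integral_eq_integral(2)[OF si] by (simp add: set_lebesgue_integral_def)
    also have "\<dots> = F (of_real (r n) * \<zeta>) / of_real c"
    proof (rule integral_unique)
      from has_integral_divide[OF Schwarz_integral_formula[OF hol that, of n], of "of_real c"] F0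
      show "((\<lambda>t. (Re (F (of_real (r n) * circle_point t)) / c) *\<^sub>R schwarz_kernel \<zeta> t) has_integral
          F (of_real (r n) * \<zeta>) / of_real c) {0..1}"
        by (simp add: schwarz_kernel_def scaleR_conv_of_real mult.commute)
    qed
    finally show "(\<integral>t. schwarz_kernel \<zeta> t \<partial>\<mu> n) = F (of_real (r n) * \<zeta>) / of_real c" .
  qed
  have k0: "schwarz_kernel 0 = (\<lambda>_. 1)" by (rule ext) (simp add: schwarz_kernel_def circle_point_nz)
  have dist: "real_distribution (\<mu> n)" for n
  proof -
    have int: "integrable lborel (d n)"
      using integrable_Re[OF key(2)[of 0 n]] by (simp add: k0)
    have "complex_of_real (\<integral>t. d n t \<partial>lborel) = (\<integral>t. d n t *\<^sub>R schwarz_kernel 0 t \<partial>lborel)"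
      by (simp add: k0 scaleR_conv_of_real)
    also have "\<dots> = (\<integral>t. schwarz_kernel 0 t \<partial>\<mu> n)"
      unfolding \<mu>_def using d0 by (subst integral_density) (auto simp: k0)
    also have "\<dots> = 1" using key(1)[of 0 n] F0 \<open>c > 0\<close> by simp
    finally have "(\<integral>t. d n t \<partial>lborel) = 1" using of_real_eq_1_iff by blast
    then have "emeasure (\<mu> n) UNIV = 1"
      unfolding \<mu>_def using int d0 by (subst emeasure_density) (auto simp: nn_integral_eq_integral)
    then have "prob_space (\<mu> n)" by (intro prob_spaceI) (simp add: \<mu>_def)
    moreover have "sets (\<mu> n) = sets borel" by (simp add: \<mu>_def)
    ultimately show ?thesis by (simp add: real_distribution_def real_distribution_axioms_def)
  qed
  have "tight \<mu>"
    unfolding tight_def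
  proof (intro conjI allI impI dist)
    fix \<epsilon> :: real assume "\<epsilon> > 0"
    have "measure (\<mu> n) {-1<..1} = 1" for n
    proof -
      interpret real_distribution "\<mu> n" by (rule dist)
      have m: "(\<lambda>t. ennreal (d n t)) \<in> borel_measurable lborel" by measurable
      have "AE x in \<mu> n. x \<in> {-1<..1}"
        unfolding \<mu>_def AE_density[OF m] by (rule AE_I2) (auto simp: d_def indicator_def split: if_splits)
      then show ?thesis by (subst prob_eq_1) auto
    qed
    then show "\<exists>a b. a < b \<and> (\<forall>n. 1 - \<epsilon> < measure (\<mu> n) {a<..b})"
      using \<open>\<epsilon> > 0\<close> by (intro exI[of _ "-1"] exI[of _ 1]) auto
  qed
  from tight_imp_convergent_subsubsequence[OF this strict_mono_id]
  obtain s M where s: "strict_mono s" and M: "real_distribution M" and wc: "weak_conv_m (\<mu> \<circ> id \<circ> s) M"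
    by blast
  have "F \<zeta> = of_real c * (\<integral>t. schwarz_kernel \<zeta> t \<partial>M)" if \<zeta>: "norm \<zeta> < 1" for \<zeta>
  proof -
    have "(\<lambda>n. \<integral>t. schwarz_kernel \<zeta> t \<partial>((\<mu> \<circ> id \<circ> s) n)) \<longlonglongrightarrow> (\<integral>t. schwarz_kernel \<zeta> t \<partial>M)"
      by (rule weak_conv_imp_integral_bdd_continuous_conv[OF _ M wc
            schwarz_kernel_continuous[OF \<zeta>] schwarz_kernel_bound[OF \<zeta>]]) (simp add: dist)
    then have 1: "(\<lambda>n. F (of_real (r (s n)) * \<zeta>) / of_real c) \<longlonglongrightarrow> (\<integral>t. schwarz_kernel \<zeta> t \<partial>M)"
      using key(1)[OF \<zeta>] by (simp add: o_def)
    have "(\<lambda>n. 1 - 1 / real (n + 2)) \<longlonglongrightarrow> 1 - 0"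
      by (intro tendsto_intros LIMSEQ_ignore_initial_segment lim_1_over_n)
    then have "r \<longlonglongrightarrow> 1" by (simp add: r_def[abs_def] add.commute)
    then have "(\<lambda>n. r (s n)) \<longlonglongrightarrow> 1"
      using LIMSEQ_subseq_LIMSEQ[OF _ s] by (simp add: o_def)
    then have "(\<lambda>n. of_real (r (s n)) * \<zeta>) \<longlonglongrightarrow> of_real 1 * \<zeta>"
      by (intro tendsto_intros)
    moreover have "isCont F \<zeta>"
      using holomorphic_on_imp_continuous_on[OF F] \<zeta> by (simp add: continuous_on_eq_continuous_at)
    ultimately have "(\<lambda>n. F (of_real (r (s n)) * \<zeta>)) \<longlonglongrightarrow> F \<zeta>"
      using isCont_tendsto_compose[of \<zeta> F] by simp
    then have "(\<lambda>n. F (of_real (r (s n)) * \<zeta>) / of_real c) \<longlonglongrightarrow> F \<zeta> / of_real c"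
      using \<open>c > 0\<close> by (intro tendsto_intros) auto
    from LIMSEQ_unique[OF 1 this] show ?thesis using \<open>c > 0\<close> by (simp add: field_simps)
  qed
  with M show ?thesis by blast
qed

lemma Cayley_upper_half_plane:
  assumes "norm \<zeta> < 1"
  shows "Im (\<i> * (1 + \<zeta>) / (1 - \<zeta>)) > 0"
proof -
  have "\<zeta> \<noteq> 1" using assms by auto
  then have "norm (1 - \<zeta>) > 0" by simp
  have "\<i> * (1 + \<zeta>) / (1 - \<zeta>) = \<i> * (1 + \<zeta>) * cnj (1 - \<zeta>) / of_real ((norm (1 - \<zeta>))\<^sup>2)"
    using complex_div_cnj[of "\<i> * (1 + \<zeta>)" "1 - \<zeta>"] by (simp only: of_real_power)
  then have "Im (\<i> * (1 + \<zeta>) / (1 - \<zeta>)) = Im (\<i> * (1 + \<zeta>) * cnj (1 - \<zeta>)) / (norm (1 - \<zeta>))\<^sup>2"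
    by (simp only: Im_divide_of_real)
  also have "Im (\<i> * (1 + \<zeta>) * cnj (1 - \<zeta>)) = 1 - (norm \<zeta>)\<^sup>2"
    unfolding cmod_power2 by (simp add: algebra_simps power2_eq_square)
  finally show ?thesis using assms \<open>norm (1 - \<zeta>) > 0\<close> by (simp add: power_less_one_iff)
qed

lemma Cayley_inverse:
  assumes "Im z > 0"
  shows "norm ((z - \<i>) / (z + \<i>)) < 1" "\<i> * (1 + (z - \<i>) / (z + \<i>)) / (1 - (z - \<i>) / (z + \<i>)) = z"
proof -
  have nz: "z + \<i> \<noteq> 0" using assms by (auto simp: complex_eq_iff)
  have "(norm (z - \<i>))\<^sup>2 < (norm (z + \<i>))\<^sup>2"
    unfolding cmod_power2 using assms by (simp add: power2_eq_square algebra_simps)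
  then have "norm (z - \<i>) < norm (z + \<i>)" by (rule power_less_imp_less_base) simp
  then show "norm ((z - \<i>) / (z + \<i>)) < 1" using nz by (simp add: norm_divide)
  have "1 + (z - \<i>) / (z + \<i>) = 2 * z / (z + \<i>)" "1 - (z - \<i>) / (z + \<i>) = 2 * \<i> / (z + \<i>)"
    using nz by (simp_all add: field_simps)
  then show "\<i> * (1 + (z - \<i>) / (z + \<i>)) / (1 - (z - \<i>) / (z + \<i>)) = z"
    using nz by simp
qed

text \<open>The Cayley transform of the circle onto the real line; the point \<open>1\<close>, which corresponds to
infinity, is sent to \<open>0\<close> by division by zero.\<close>

definition line_point :: "real \<Rightarrow> real" where
  "line_point t = Re (\<i> * (1 + circle_point t) / (1 - circle_point t))"

lemma circle_point_line_point:
  assumes "circle_point t \<noteq> 1"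
  shows "circle_point t = (of_real (line_point t) - \<i>) / (of_real (line_point t) + \<i>)"
proof -
  let ?e = "circle_point t"
  define s where "s = \<i> * (1 + ?e) / (1 - ?e)"
  have "cnj ?e = 1 / ?e" using circle_point_cnj[of t] circle_point_nz[of t] by (simp add: field_simps)
  then have "cnj s = - \<i> * (1 + 1 / ?e) / (1 - 1 / ?e)" by (simp add: s_def)
  also have "\<dots> = s"
    unfolding s_def using assms circle_point_nz[of t] by (simp add: divide_simps) (simp add: algebra_simps)
  finally have "Im s = 0" by (simp add: complex_eq_iff)
  then have s: "of_real (line_point t) = s" by (simp add: line_point_def s_def[symmetric] complex_eq_iff)
  have "s * (1 - ?e) = \<i> * (1 + ?e)" using assms by (simp add: s_def)
  then have "?e * (s + \<i>) = s - \<i>" by (simp add: algebra_simps)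
  moreover have "s + \<i> \<noteq> 0" using \<open>Im s = 0\<close> by (auto simp: complex_eq_iff)
  ultimately show ?thesis unfolding s by (simp add: field_simps)
qed

text \<open>Under the Cayley transform, mass at the circle point \<open>1\<close> contributes the linear term \<open>z\<close>.\<close>

lemma schwarz_kernel_half_plane:
  assumes "Im z > 0"
  shows "circle_point t \<noteq> 1 \<Longrightarrow> \<i> * schwarz_kernel ((z - \<i>) / (z + \<i>)) t =
      (1 + of_real (line_point t) * z) / (of_real (line_point t) - z)"
    and "circle_point t = 1 \<Longrightarrow> \<i> * schwarz_kernel ((z - \<i>) / (z + \<i>)) t = z"
proof -
  show "\<i> * schwarz_kernel ((z - \<i>) / (z + \<i>)) t = z" if "circle_point t = 1"
    using Cayley_inverse(2)[OF assms] that by (simp add: schwarz_kernel_def)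
  assume ne: "circle_point t \<noteq> 1"
  define s where "s = complex_of_real (line_point t)"
  have nz: "z + \<i> \<noteq> 0" "s + \<i> \<noteq> 0" "s - z \<noteq> 0" using assms by (auto simp: complex_eq_iff s_def)
  have 1: "(s - \<i>) / (s + \<i>) + (z - \<i>) / (z + \<i>) = 2 * (1 + s * z) / ((s + \<i>) * (z + \<i>))"
    using nz by (simp add: add_frac_eq) (simp add: algebra_simps)
  have 2: "(s - \<i>) / (s + \<i>) - (z - \<i>) / (z + \<i>) = 2 * \<i> * (s - z) / ((s + \<i>) * (z + \<i>))"
    using nz by (simp add: diff_frac_eq) (simp add: algebra_simps)
  have "schwarz_kernel ((z - \<i>) / (z + \<i>)) t = (2 * (1 + s * z)) / (2 * \<i> * (s - z))"
    unfolding schwarz_kernel_def circle_point_line_point[OF ne] s_def[symmetric] 1 2 using nz by simp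
  moreover have "\<i> * ((2 * a) / (2 * \<i> * b)) = a / b" for a b :: complex by simp
  ultimately show "\<i> * schwarz_kernel ((z - \<i>) / (z + \<i>)) t =
      (1 + of_real (line_point t) * z) / (of_real (line_point t) - z)"
    by (simp only: s_def)
qed

lemma Im_half_plane_kernel:
  assumes "Im z > 0"
  shows "Im ((1 + of_real s * z) / (of_real s - z)) = Im z * (1 + s\<^sup>2) / (norm (of_real s - z))\<^sup>2"
proof -
  have "(1 + of_real s * z) / (of_real s - z) = (1 + of_real s * z) * cnj (of_real s - z) / of_real ((norm (of_real s - z))\<^sup>2)"
    using complex_div_cnj[of "1 + of_real s * z" "of_real s - z"] by (simp only: of_real_power)
  then have "Im ((1 + of_real s * z) / (of_real s - z)) = Im ((1 + of_real s * z) * cnj (of_real s - z)) / (norm (of_real s - z))\<^sup>2"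
    by (simp only: Im_divide_of_real)
  also have "Im ((1 + of_real s * z) * cnj (of_real s - z)) = Im z * (1 + s\<^sup>2)"
    by (simp add: algebra_simps power2_eq_square)
  finally show ?thesis .
qed

text \<open>The representation of the disc is transported by the Cayley transform. Mass \<open>p\<close> at the circle
point \<open>1\<close> would give \<open>Im (f (\<i>y)) \<ge> c p y\<close>, which the sublinear growth excludes, so the measure can
be pushed forward to the real line.\<close>

lemma Herglotz_half_plane:
  assumes f: "f holomorphic_on {z. Im z > 0}" and pos: "\<And>z. Im z > 0 \<Longrightarrow> 0 \<le> Im (f z)"
    and fi: "f \<i> = of_real c * \<i>" and c: "c > 0"
    and sub: "\<And>\<epsilon>. \<epsilon> > 0 \<Longrightarrow> \<exists>y>0. Im (f (of_real y * \<i>)) \<le> \<epsilon> * y"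
  shows "\<exists>M. real_distribution M \<and> (\<forall>z. Im z > 0 \<longrightarrow>
      integrable M (\<lambda>s. (1 + of_real s * z) / (of_real s - z)) \<and>
      f z = of_real c * (\<integral>s. (1 + of_real s * z) / (of_real s - z) \<partial>M))"
proof -
  define F where "F \<zeta> = - \<i> * f (\<i> * (1 + \<zeta>) / (1 - \<zeta>))" for \<zeta>
  have "f \<circ> (\<lambda>\<zeta>. \<i> * (1 + \<zeta>) / (1 - \<zeta>)) holomorphic_on ball 0 1"
    using Cayley_upper_half_plane by (intro holomorphic_on_compose_gen[OF _ f] holomorphic_intros) auto
  then have "F holomorphic_on ball 0 1"
    unfolding F_def o_def by (intro holomorphic_intros)
  moreover have "0 \<le> Re (F \<zeta>)" if "norm \<zeta> < 1" for \<zeta>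
    using pos[OF Cayley_upper_half_plane[OF that]] by (simp add: F_def)
  moreover have "F 0 = of_real c" using fi by (simp add: F_def complex_eq_iff)
  ultimately have "\<exists>M. real_distribution M \<and> (\<forall>\<zeta>. norm \<zeta> < 1 \<longrightarrow> F \<zeta> = of_real c * (\<integral>t. schwarz_kernel \<zeta> t \<partial>M))"
    using c by (intro Herglotz_disc)
  then obtain M where M: "real_distribution M"
    and FM': "\<forall>\<zeta>. norm \<zeta> < 1 \<longrightarrow> F \<zeta> = of_real c * (\<integral>t. schwarz_kernel \<zeta> t \<partial>M)"
    by (elim exE conjE)
  note FM = FM'[rule_format]
  interpret real_distribution M by (rule M)
  define k where "k z t = \<i> * schwarz_kernel ((z - \<i>) / (z + \<i>)) t" for z t
  have k_int: "integrable M (k z)" if "Im z > 0" for z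
  proof -
    note \<zeta> = Cayley_inverse(1)[OF that]
    have "continuous_on UNIV (schwarz_kernel ((z - \<i>) / (z + \<i>)))"
      using schwarz_kernel_continuous[OF \<zeta>] by (simp add: continuous_on_eq_continuous_at)
    then have [measurable]: "schwarz_kernel ((z - \<i>) / (z + \<i>)) \<in> borel_measurable borel"
      by (rule borel_measurable_continuous_onI)
    show ?thesis unfolding k_def
      using schwarz_kernel_bound[OF \<zeta>]
      by (intro integrable_const_bound[where B="2 / (1 - norm ((z - \<i>) / (z + \<i>)))"] AE_I2)
        (auto simp: norm_mult)
  qed
  have fM: "f z = of_real c * (\<integral>t. k z t \<partial>M)" if "Im z > 0" for z
  proof -
    have "f z = \<i> * F ((z - \<i>) / (z + \<i>))"
      unfolding F_def Cayley_inverse(2)[OF that] by simp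
    also have "\<dots> = of_real c * (\<i> * (\<integral>t. schwarz_kernel ((z - \<i>) / (z + \<i>)) t \<partial>M))"
      using FM[OF Cayley_inverse(1)[OF that]] by simp
    also have "\<i> * (\<integral>t. schwarz_kernel ((z - \<i>) / (z + \<i>)) t \<partial>M) = (\<integral>t. k z t \<partial>M)"
      by (simp add: k_def)
    finally show ?thesis .
  qed
  define A where "A = {t. circle_point t = 1}"
  have circle_meas[measurable]: "circle_point \<in> borel_measurable borel"
    by (rule borel_measurable_continuous_onI[OF continuous_circle_point])
  have A[measurable]: "A \<in> sets borel" unfolding A_def by measurable
  have "prob A \<le> 0"
  proof (rule ccontr)
    assume "\<not> prob A \<le> 0"
    then have pA: "c * prob A / 2 > 0" using c by simp
    obtain y where y: "y > 0" "Im (f (of_real y * \<i>)) \<le> c * prob A / 2 * y" using sub[OF pA] by blast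
    let ?z = "of_real y * \<i>"
    have Iz: "Im ?z > 0" using y by simp
    have "(\<integral>t. y * indicator A t \<partial>M) \<le> (\<integral>t. Im (k ?z t) \<partial>M)"
    proof (rule integral_mono)
      show "integrable M (\<lambda>t. Im (k ?z t))" using k_int[OF Iz] by simp
      show "y * indicator A t \<le> Im (k ?z t)" for t
      proof (cases "circle_point t = 1")
        case True
        then have "k ?z t = ?z" using schwarz_kernel_half_plane(2)[OF Iz] by (simp add: k_def)
        then show ?thesis using y(1) by (simp add: indicator_def)
      next
        case False
        then have "Im (k ?z t) = Im ((1 + of_real (line_point t) * ?z) / (of_real (line_point t) - ?z))"
          using schwarz_kernel_half_plane(1)[OF Iz] by (simp add: k_def)
        also have "\<dots> \<ge> 0" unfolding Im_half_plane_kernel[OF Iz] using y by simp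
        finally show ?thesis using False by (simp add: A_def)
      qed
      show "integrable M (\<lambda>t. y * indicator A t)"
        by (intro integrable_mult_right integrable_real_indicator) (auto simp: A emeasure_finite less_top[symmetric])
    qed
    then have "y * prob A \<le> Im (\<integral>t. k ?z t \<partial>M)" using k_int[OF Iz] by simp
    then have "c * (y * prob A) \<le> Im (f ?z)"
      unfolding fM[OF Iz] using c by simp
    with y(2) have "c * (y * prob A) \<le> c * prob A / 2 * y" by linarith
    then show False using mult_pos_pos[OF pA y(1)] by (simp add: algebra_simps)
  qed
  then have "prob A = 0" using measure_nonneg[of M A] by linarith
  then have AE: "AE t in M. circle_point t \<noteq> 1"
    using prob_eq_0[of A] by (simp add: A_def)
  have [measurable]: "line_point \<in> borel_measurable borel" unfolding line_point_def by measurable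
  let ?N = "distr M borel line_point"
  have N: "real_distribution ?N" by (rule real_distribution_distr) simp
  have "integrable ?N (\<lambda>s. (1 + of_real s * z) / (of_real s - z)) \<and>
      f z = of_real c * (\<integral>s. (1 + of_real s * z) / (of_real s - z) \<partial>?N)" if "Im z > 0" for z
  proof -
    have eq: "AE t in M. k z t = (1 + of_real (line_point t) * z) / (of_real (line_point t) - z)"
      using AE by eventually_elim (simp add: k_def schwarz_kernel_half_plane(1)[OF that])
    have "integrable M (\<lambda>t. (1 + of_real (line_point t) * z) / (of_real (line_point t) - z))"
      by (rule integrable_cong_AE_imp[OF k_int[OF that]]) (use eq in \<open>auto\<close>)
    moreover have "(\<integral>t. k z t \<partial>M) = (\<integral>t. (1 + of_real (line_point t) * z) / (of_real (line_point t) - z) \<partial>M)"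
      by (rule integral_cong_AE) (use k_int[OF that] eq in \<open>auto\<close>)
    ultimately show ?thesis
      unfolding fM[OF that] by (simp add: integrable_distr_eq integral_distr)
  qed
  with N show ?thesis by blast
qed

text \<open>The measure of the class is \<open>c (1 + s\<^sup>2)\<close> times the probability measure representing \<open>f\<close>.
It is infinite because \<open>y Im (f (\<i>y))\<close> is the integral of \<open>y\<^sup>2 / (s\<^sup>2 + y\<^sup>2)\<close> with respect to it
and would be bounded by its total mass.\<close>

theorem Donoghue_class_criterion:
  assumes f: "f holomorphic_on {z. Im z \<noteq> 0}" and sym: "\<And>z. Im z \<noteq> 0 \<Longrightarrow> f (cnj z) = cnj (f z)"
    and pos: "\<And>z. Im z > 0 \<Longrightarrow> 0 \<le> Im (f z)"
    and fi: "f \<i> = of_real c * \<i>" and c: "c > 1"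
    and sub: "\<And>\<epsilon>. \<epsilon> > 0 \<Longrightarrow> \<exists>y>0. Im (f (of_real y * \<i>)) \<le> \<epsilon> * y"
    and unb: "\<And>B. \<exists>y>0. B < y * Im (f (of_real y * \<i>))"
  shows "\<exists>\<kappa>. 0 < \<kappa> \<and> \<kappa> < 1 \<and> f \<in> donoghue_class_inv \<kappa>"
proof -
  have "f holomorphic_on {z. Im z > 0}" by (rule holomorphic_on_subset[OF f]) auto
  then have "\<exists>M. real_distribution M \<and> (\<forall>z. Im z > 0 \<longrightarrow>
      integrable M (\<lambda>s. (1 + of_real s * z) / (of_real s - z)) \<and>
      f z = of_real c * (\<integral>s. (1 + of_real s * z) / (of_real s - z) \<partial>M))"
    using c by (intro Herglotz_half_plane pos fi sub) auto
  then obtain M where M: "real_distribution M"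
    and MM: "\<forall>z. Im z > 0 \<longrightarrow>
      integrable M (\<lambda>s. (1 + of_real s * z) / (of_real s - z)) \<and>
      f z = of_real c * (\<integral>s. (1 + of_real s * z) / (of_real s - z) \<partial>M)"
    by (elim exE conjE)
  have kint: "integrable M (\<lambda>s. (1 + of_real s * z) / (of_real s - z))"
    and fM: "f z = of_real c * (\<integral>s. (1 + of_real s * z) / (of_real s - z) \<partial>M)" if "Im z > 0" for z
    using MM that by simp_all
  interpret real_distribution M by (rule M)
  define \<sigma> where "\<sigma> = density M (\<lambda>s. ennreal (c * (1 + s\<^sup>2)))"
  have w: "0 \<le> c * (1 + s\<^sup>2)" "1 + s\<^sup>2 \<noteq> 0" for s :: real using c by (auto simp: add_nonneg_eq_0_iff)
  have rep: "f z = (\<integral>s. (1 / (of_real s - z) - of_real (s / (1 + s\<^sup>2))) \<partial>\<sigma>)" if z: "Im z > 0" for z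
  proof -
    have "(\<integral>s. (1 / (of_real s - z) - of_real (s / (1 + s\<^sup>2))) \<partial>\<sigma>) =
        (\<integral>s. (c * (1 + s\<^sup>2)) *\<^sub>R (1 / (of_real s - z) - of_real (s / (1 + s\<^sup>2))) \<partial>M)"
      unfolding \<sigma>_def using w by (intro integral_density) auto
    also have "\<dots> = (\<integral>s. of_real c * ((1 + of_real s * z) / (of_real s - z)) \<partial>M)"
    proof (rule Bochner_Integration.integral_cong[OF refl])
      fix s :: real
      have nz: "complex_of_real s - z \<noteq> 0" using z by (auto simp: complex_eq_iff)
      have nz2: "1 + (complex_of_real s)\<^sup>2 \<noteq> 0"
        using w(2)[of s] by (metis of_real_1 of_real_add of_real_eq_0_iff of_real_power)
      show "(c * (1 + s\<^sup>2)) *\<^sub>R (1 / (of_real s - z) - of_real (s / (1 + s\<^sup>2))) =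
          of_real c * ((1 + of_real s * z) / (of_real s - z))"
        using nz nz2 by (simp add: scaleR_conv_of_real divide_simps) (simp add: algebra_simps power2_eq_square)
    qed
    also have "\<dots> = f z" unfolding fM[OF z] by (rule integral_mult_right_zero)
    finally show ?thesis by simp
  qed
  have rep': "f z = (\<integral>s. (1 / (of_real s - z) - of_real (s / (1 + s\<^sup>2))) \<partial>\<sigma>)" if z: "Im z \<noteq> 0" for z
  proof (cases "Im z > 0")
    case False
    then have "Im (cnj z) > 0" using z by simp
    then have "f (cnj z) = (\<integral>s. (1 / (of_real s - cnj z) - of_real (s / (1 + s\<^sup>2))) \<partial>\<sigma>)" by (rule rep)
    then have "cnj (f z) = (\<integral>s. (1 / (of_real s - cnj z) - of_real (s / (1 + s\<^sup>2))) \<partial>\<sigma>)" using sym[OF z] by simp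
    then have "f z = cnj (\<integral>s. (1 / (of_real s - cnj z) - of_real (s / (1 + s\<^sup>2))) \<partial>\<sigma>)" by (metis complex_cnj_cnj)
    also have "\<dots> = (\<integral>s. cnj (1 / (of_real s - cnj z) - of_real (s / (1 + s\<^sup>2))) \<partial>\<sigma>)"
      by (rule Bochner_Integration.integral_cnj[symmetric])
    finally show ?thesis by simp
  qed (rule rep)
  have inf: "emeasure \<sigma> UNIV = \<infinity>"
  proof (rule ccontr)
    assume "emeasure \<sigma> UNIV \<noteq> \<infinity>"
    moreover have "emeasure \<sigma> UNIV = (\<integral>\<^sup>+s. ennreal (c * (1 + s\<^sup>2)) \<partial>M)"
      unfolding \<sigma>_def by (subst emeasure_density) (auto simp: events_eq_borel)
    ultimately have int: "integrable M (\<lambda>s. c * (1 + s\<^sup>2))"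
      using w by (intro integrableI_nonneg) (auto simp: less_top)
    obtain y where y: "y > 0" "(\<integral>s. c * (1 + s\<^sup>2) \<partial>M) < y * Im (f (of_real y * \<i>))" using unb by blast
    let ?z = "of_real y * \<i>"
    have Iz: "Im ?z > 0" using y by simp
    have "y * Im (f ?z) = (\<integral>s. y * (c * Im ((1 + of_real s * ?z) / (of_real s - ?z))) \<partial>M)"
      unfolding fM[OF Iz] using kint[OF Iz] by simp
    also have "\<dots> \<le> (\<integral>s. c * (1 + s\<^sup>2) \<partial>M)"
    proof (rule integral_mono)
      show "integrable M (\<lambda>s. y * (c * Im ((1 + of_real s * ?z) / (of_real s - ?z))))" using kint[OF Iz] by simp
      fix s :: real
      have "(norm (of_real s - ?z))\<^sup>2 = s\<^sup>2 + y\<^sup>2" unfolding cmod_power2 by simp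
      then have "y * (c * Im ((1 + of_real s * ?z) / (of_real s - ?z))) = (c * (1 + s\<^sup>2)) * (y\<^sup>2 / (s\<^sup>2 + y\<^sup>2))"
        unfolding Im_half_plane_kernel[OF Iz] by (simp add: power2_eq_square)
      also have "\<dots> \<le> (c * (1 + s\<^sup>2)) * 1"
        using y w(1)[of s] by (intro mult_left_mono) (auto simp: divide_simps sum_power2_gt_zero_iff)
      finally show "y * (c * Im ((1 + of_real s * ?z) / (of_real s - ?z))) \<le> c * (1 + s\<^sup>2)" by simp
    qed (rule int)
    finally show False using y(2) by linarith
  qed
  have bi: "has_bochner_integral \<sigma> (\<lambda>t. 1 / (1 + t\<^sup>2)) c"
    unfolding \<sigma>_def
  proof (rule has_bochner_integral_density)
    have "has_bochner_integral M (\<lambda>_. c) c" using prob_space by (simp add: has_bochner_integral_iff)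
    moreover have "(c * (1 + s\<^sup>2)) *\<^sub>R (1 / (1 + s\<^sup>2)) = c" for s :: real using w(2)[of s] by simp
    ultimately show "has_bochner_integral M (\<lambda>s. (c * (1 + s\<^sup>2)) *\<^sub>R (1 / (1 + s\<^sup>2))) c"
      by (simp only:)
  qed (use w in auto)
  \<comment> \<open>the solution of \<open>(1 + \<kappa>) / (1 - \<kappa>) = c\<close>\<close>
  define \<kappa> where "\<kappa> = (c - 1) / (c + 1)"
  have k: "0 < \<kappa>" "\<kappa> < 1" "(1 + \<kappa>) / (1 - \<kappa>) = c" using c by (auto simp: \<kappa>_def field_simps)
  have "f \<in> donoghue_class_inv \<kappa>"
    unfolding donoghue_class_inv_def mem_Collect_eq
  proof (intro conjI exI[of _ \<sigma>] allI impI)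
    show "herglotz_nevanlinna f" using f sym pos by (simp add: herglotz_nevanlinna_def)
    show "sets \<sigma> = sets borel" by (simp add: \<sigma>_def)
  qed (use k inf bi rep' in auto)
  with k show ?thesis by blast
qed

section \<open>Defect fields along the imaginary axis\<close>

text \<open>A family of eigenfunctions together with a function \<open>N\<close> describing its boundary form, and a
function \<open>t\<close> whose boundary form with every member is one. There are two instances below: the Weyl
solutions, normalised by their boundary value, and their multiples by \<open>1 / (m z - a)\<close>. They provide
the impedance functions of the two cases of the theorem.\<close>

locale defect_field =
  fixes l :: real and q :: "real \<Rightarrow> real" and u :: "complex \<Rightarrow> real \<Rightarrow> complex" and N :: "complex \<Rightarrow> complex"
    and t :: "real \<Rightarrow> complex"
  assumes dense: "L2_dense l (min_domain l q)"
    and green: "\<And>y v. y \<in> max_domain l q \<Longrightarrow> v \<in> max_domain l q \<Longrightarrow>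
      L2_inner l (schroedinger_expr l q y) v - L2_inner l y (schroedinger_expr l q v) = boundary_form l y v"
    and u_dom: "\<And>z. Im z \<noteq> 0 \<Longrightarrow> u z \<in> max_domain l q"
    and u_eq: "\<And>z. Im z \<noteq> 0 \<Longrightarrow> AE x in half_line l. schroedinger_expr l q (u z) x = z * u z x"
    and u_form: "\<And>z w. Im z \<noteq> 0 \<Longrightarrow> Im w \<noteq> 0 \<Longrightarrow> boundary_form l (u z) (u w) = N z - cnj (N w)"
    and t_dom: "t \<in> max_domain l q"
    and t_form: "\<And>z. Im z \<noteq> 0 \<Longrightarrow> boundary_form l (u z) t = 1"
begin

lemma u_L2: "Im z \<noteq> 0 \<Longrightarrow> u z \<in> L2 l"
  using u_dom max_domainD(1) by blast

lemma green_u: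
  assumes z: "Im z \<noteq> 0" and v: "v \<in> max_domain l q"
  shows "z * L2_inner l (u z) v - L2_inner l (u z) (schroedinger_expr l q v) = boundary_form l (u z) v"
proof -
  have "L2_inner l (schroedinger_expr l q (u z)) v = L2_inner l (\<lambda>x. z * u z x) v"
    using u_eq[OF z] by (intro L2_inner_cong_AE L2_scale u_L2[OF z] max_domainD(1)[OF v]) auto
  then have "L2_inner l (schroedinger_expr l q (u z)) v = z * L2_inner l (u z) v"
    using L2_inner_scale_left[OF u_L2[OF z] max_domainD(1)[OF v]] by simp
  then show ?thesis using green[OF u_dom[OF z] v] by simp
qed

lemma kernel_identity:
  assumes z: "Im z \<noteq> 0" and w: "Im w \<noteq> 0"
  shows "(z - cnj w) * L2_inner l (u z) (u w) = N z - cnj (N w)"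
proof -
  have "L2_inner l (u z) (schroedinger_expr l q (u w)) = L2_inner l (u z) (\<lambda>x. w * u w x)"
    using u_eq[OF w] by (intro L2_inner_cong_AE L2_scale u_L2 z w) auto
  also have "\<dots> = cnj w * L2_inner l (u z) (u w)"
    by (rule L2_inner_scale_right[OF u_L2[OF w] u_L2[OF z]])
  finally show ?thesis
    using green_u[OF z u_dom[OF w]] u_form[OF z w] by (simp add: algebra_simps)
qed

lemma N_cnj:
  assumes "Im z \<noteq> 0"
  shows "N (cnj z) = cnj (N z)"
  using kernel_identity[of "cnj z" z] assms by simp

lemma Im_N:
  assumes "Im z \<noteq> 0"
  shows "Im z * L2_norm2 l (u z) = Im (N z)"
proof -
  have "(z - cnj z) * of_real (L2_norm2 l (u z)) = N z - cnj (N z)"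
    using kernel_identity[OF assms assms] by (simp add: L2_inner_self)
  then show ?thesis by (simp add: complex_eq_iff complex_diff_cnj)
qed

text \<open>Otherwise Green's formula would make the boundary form with \<open>t\<close> vanish.\<close>

lemma u_norm_pos:
  assumes z: "Im z \<noteq> 0"
  shows "0 < L2_norm2 l (u z)"
proof (rule ccontr)
  assume "\<not> 0 < L2_norm2 l (u z)"
  then have 0: "L2_norm2 l (u z) = 0" using L2_norm2_nonneg[of l "u z"] by linarith
  have "norm (L2_inner l (u z) f) \<le> 0" if "f \<in> L2 l" for f
    using L2_Cauchy_Schwarz[OF u_L2[OF z] that] 0 by simp
  then have "L2_inner l (u z) t = 0" "L2_inner l (u z) (schroedinger_expr l q t) = 0"
    using max_domainD(1,2)[OF t_dom] by auto
  then show False using green_u[OF z t_dom] t_form[OF z] by simp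
qed

lemma Im_N_pos: "Im z > 0 \<Longrightarrow> Im (N z) > 0"
  using Im_N[of z] u_norm_pos[of z] by (metis less_irrefl mult_pos_pos)

text \<open>In operator terms \<open>u z - u w\<close> is \<open>z - w\<close> times a resolvent applied to \<open>u w\<close>, whence the factor
\<open>1 / \<bar>Im z\<bar>\<close>. The kernel identity alone yields the estimate: it makes
\<open>\<langle>z u\<^sub>z - w u\<^sub>w, u\<^sub>z - u\<^sub>w\<rangle>\<close> real.\<close>

lemma u_diff_bound:
  assumes z: "Im z \<noteq> 0" and w: "Im w \<noteq> 0"
  shows "\<bar>Im z\<bar> * sqrt (L2_norm2 l (\<lambda>x. u z x - u w x)) \<le> norm (z - w) * sqrt (L2_norm2 l (u w))"
proof -
  let ?d = "\<lambda>x. u z x - u w x"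
  define Q where "Q = L2_inner l (u z) (u w)"
  define n where "n = L2_norm2 l ?d"
  have d: "?d \<in> L2 l" by (intro L2_diff u_L2 z w)
  have QQ: "L2_inner l (u w) (u z) = cnj Q" unfolding Q_def by (rule L2_inner_cnj)
  have 2: "L2_inner l (u w) ?d = cnj Q - of_real (L2_norm2 l (u w))"
    using L2_inner_diff_right[OF u_L2[OF z] u_L2[OF w] u_L2[OF w]] by (simp only: QQ L2_inner_self)
  have 3: "L2_inner l (u z) ?d = of_real (L2_norm2 l (u z)) - Q"
    using L2_inner_diff_right[OF u_L2[OF z] u_L2[OF w] u_L2[OF z]] by (simp only: Q_def L2_inner_self)
  have 1: "complex_of_real n = of_real (L2_norm2 l (u z)) - Q - (cnj Q - of_real (L2_norm2 l (u w)))"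
    using L2_inner_diff_left[OF u_L2[OF z] u_L2[OF w] d] by (simp only: 2 3 n_def L2_inner_self)
  have k1: "(z - cnj z) * of_real (L2_norm2 l (u z)) = N z - cnj (N z)"
    using kernel_identity[OF z z] by (simp only: L2_inner_self)
  have k2: "(w - cnj w) * of_real (L2_norm2 l (u w)) = N w - cnj (N w)"
    using kernel_identity[OF w w] by (simp only: L2_inner_self)
  have k3: "(z - cnj w) * Q = N z - cnj (N w)" using kernel_identity[OF z w] by (simp only: Q_def)
  have k4: "(w - cnj z) * cnj Q = N w - cnj (N z)" using kernel_identity[OF w z] by (simp only: QQ)
  define P where "P = (z - w) * L2_inner l (u w) ?d"
  have "(z - cnj z) * of_real n + (P - cnj P) =
      (z - cnj z) * of_real (L2_norm2 l (u z)) - (z - cnj w) * Q - (w - cnj z) * cnj Q + (w - cnj w) * of_real (L2_norm2 l (u w))"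
    unfolding P_def 1 2 by (simp add: algebra_simps)
  also have "\<dots> = 0" unfolding k1 k2 k3 k4 by simp
  finally have "Im ((z - cnj z) * of_real n + (P - cnj P)) = 0" by simp
  then have "Im z * n + Im P = 0" by simp
  then have "\<bar>Im z * n\<bar> = \<bar>Im P\<bar>" by linarith
  then have "\<bar>Im z\<bar> * n = \<bar>Im P\<bar>"
    using L2_norm2_nonneg[of l ?d] by (simp only: abs_mult n_def abs_of_nonneg)
  also have "\<dots> \<le> norm P" by (rule abs_Im_le_cmod)
  also have "\<dots> \<le> norm (z - w) * (sqrt (L2_norm2 l (u w)) * sqrt n)"
    unfolding P_def norm_mult n_def by (intro mult_left_mono L2_Cauchy_Schwarz u_L2 w d) auto
  finally have le: "\<bar>Im z\<bar> * n \<le> norm (z - w) * sqrt (L2_norm2 l (u w)) * sqrt n" by (simp add: mult.assoc)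
  show ?thesis
  proof (cases "n = 0")
    case False
    then have "n > 0" using L2_norm2_nonneg[of l ?d] by (simp add: n_def)
    then have "(\<bar>Im z\<bar> * sqrt n) * sqrt n \<le> (norm (z - w) * sqrt (L2_norm2 l (u w))) * sqrt n"
      using le by (simp add: mult.assoc)
    then show ?thesis using \<open>n > 0\<close> by (simp add: n_def[symmetric])
  next
    case True
    then show ?thesis using L2_norm2_nonneg[of l "u w"] by (simp add: n_def[symmetric])
  qed
qed

text \<open>By the kernel identity the difference quotient at \<open>w\<close> is \<open>\<langle>u\<^sub>z, u\<^sub>v\<rangle>\<close> with \<open>v = cnj w\<close>,
and \<open>u z\<close> depends continuously on \<open>z\<close>.\<close>

lemma N_holomorphic: "N holomorphic_on {z. Im z \<noteq> 0}"
  unfolding holomorphic_on_def field_differentiable_def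
proof (intro ballI exI)
  fix w assume "w \<in> {z. Im z \<noteq> 0}"
  then have w: "Im w \<noteq> 0" and w': "Im (cnj w) \<noteq> 0" by auto
  define C where "C = sqrt (L2_norm2 l (u w)) * sqrt (L2_norm2 l (u (cnj w)))"
  let ?F = "at w within {z. Im z \<noteq> 0}"
  show "(N has_field_derivative L2_inner l (u w) (u (cnj w))) ?F"
    unfolding has_field_derivative_iff
  proof (rule Lim_transform_eventually[where f="\<lambda>z. L2_inner l (u z) (u (cnj w))"])
    have ev: "\<forall>\<^sub>F z in ?F. z \<noteq> w \<and> Im z \<noteq> 0" by (simp add: eventually_at_filter)
    show "\<forall>\<^sub>F z in ?F. L2_inner l (u z) (u (cnj w)) = (N z - N w) / (z - w)"
      using ev
    proof eventually_elim
      case (elim z)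
      then have "(z - w) * L2_inner l (u z) (u (cnj w)) = N z - N w"
        using kernel_identity[of z "cnj w"] w N_cnj[OF w] by simp
      then show ?case using elim by (simp add: field_simps)
    qed
    have lim: "((\<lambda>z. norm (z - w) * C / \<bar>Im z\<bar>) \<longlongrightarrow> norm (w - w) * C / \<bar>Im w\<bar>) ?F"
      by (intro tendsto_intros) (use w in auto)
    have "((\<lambda>z. L2_inner l (u z) (u (cnj w)) - L2_inner l (u w) (u (cnj w))) \<longlongrightarrow> 0) ?F"
    proof (rule Lim_null_comparison)
      show "((\<lambda>z. norm (z - w) * C / \<bar>Im z\<bar>) \<longlongrightarrow> 0) ?F" using lim by simp
      show "\<forall>\<^sub>F z in ?F. norm (L2_inner l (u z) (u (cnj w)) - L2_inner l (u w) (u (cnj w))) \<le> norm (z - w) * C / \<bar>Im z\<bar>"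
        using ev
      proof eventually_elim
        case (elim z)
        then have z: "Im z \<noteq> 0" by simp
        have "norm (L2_inner l (u z) (u (cnj w)) - L2_inner l (u w) (u (cnj w))) =
            norm (L2_inner l (\<lambda>x. u z x - u w x) (u (cnj w)))"
          by (subst L2_inner_diff_left[OF u_L2[OF z] u_L2[OF w] u_L2[OF w']]) simp
        also have "\<dots> \<le> sqrt (L2_norm2 l (\<lambda>x. u z x - u w x)) * sqrt (L2_norm2 l (u (cnj w)))"
          by (intro L2_Cauchy_Schwarz L2_diff u_L2 z w w')
        also have "\<dots> \<le> (norm (z - w) * sqrt (L2_norm2 l (u w)) / \<bar>Im z\<bar>) * sqrt (L2_norm2 l (u (cnj w)))"
          using u_diff_bound[OF z w] z L2_norm2_nonneg by (intro mult_right_mono) (auto simp: field_simps)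
        finally show ?case by (simp add: C_def)
      qed
    qed
    then show "((\<lambda>z. L2_inner l (u z) (u (cnj w))) \<longlongrightarrow> L2_inner l (u w) (u (cnj w))) ?F"
      by (simp add: LIM_zero_iff)
  qed
qed

text \<open>Against a function \<open>g\<close> of the minimal domain, Green's formula moves the operator onto \<open>g\<close> and
gains a factor \<open>1 / y\<close>. Density of the minimal domain and boundedness extend this to all \<open>f\<close>.\<close>

lemma bounded_multiples_weakly_null:
  assumes bound: "\<And>y. y \<ge> 1 \<Longrightarrow> L2_norm2 l (\<lambda>x. s y * u (of_real y * \<i>) x) \<le> K\<^sup>2" and K: "K \<ge> 0"
    and f: "f \<in> L2 l" and e: "\<epsilon> > 0"
  shows "\<exists>Y\<ge>1. \<forall>y\<ge>Y. norm (L2_inner l (\<lambda>x. s y * u (of_real y * \<i>) x) f) < \<epsilon>"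
proof -
  let ?v = "\<lambda>y x. s y * u (of_real y * \<i>) x"
  define \<eta> where "\<eta> = \<epsilon> / (2 * (K + 1))"
  have eta: "\<eta> > 0" using e K by (simp add: \<eta>_def)
  obtain g where g: "g \<in> min_domain l q" and fg: "L2_norm2 l (\<lambda>x. f x - g x) < \<eta>\<^sup>2"
    using dense f eta unfolding L2_dense_def L2_norm2_def by (meson zero_less_power)
  have gd: "g \<in> max_domain l q" using g by (simp add: min_domain_def)
  have gL: "g \<in> L2 l" and lgL: "schroedinger_expr l q g \<in> L2 l" using gd max_domainD by blast+
  define G where "G = sqrt (L2_norm2 l (schroedinger_expr l q g))"
  have G: "G \<ge> 0" by (simp add: G_def L2_norm2_nonneg)
  have bf0: "boundary_form l y g = 0" for y using g by (simp add: boundary_form_def min_domain_def)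
  have main: "norm (L2_inner l (?v y) f) \<le> K * \<eta> + K * G / y" if y: "y \<ge> 1" for y
  proof -
    let ?z = "of_real y * \<i>"
    have z: "Im ?z \<noteq> 0" using y by simp
    have vL: "?v y \<in> L2 l" by (intro L2_scale u_L2 z)
    have sv: "sqrt (L2_norm2 l (?v y)) \<le> K" using bound[OF y] K by (simp add: real_le_lsqrt L2_norm2_nonneg)
    have "?z * L2_inner l (u ?z) g = L2_inner l (u ?z) (schroedinger_expr l q g)"
      using green_u[OF z gd] bf0 by simp
    then have "s y * (?z * L2_inner l (u ?z) g) = s y * L2_inner l (u ?z) (schroedinger_expr l q g)" by simp
    then have "?z * L2_inner l (?v y) g = L2_inner l (?v y) (schroedinger_expr l q g)"
      by (simp add: L2_inner_scale_left u_L2[OF z] gL lgL mult.left_commute)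
    then have "norm (?z * L2_inner l (?v y) g) \<le> sqrt (L2_norm2 l (?v y)) * G"
      using L2_Cauchy_Schwarz[OF vL lgL] by (simp add: G_def)
    also have "\<dots> \<le> K * G" using sv G by (rule mult_right_mono)
    finally have "norm (L2_inner l (?v y) g) \<le> K * G / y" using y by (simp add: norm_mult field_simps)
    moreover have "norm (L2_inner l (?v y) (\<lambda>x. f x - g x)) \<le> K * \<eta>"
    proof -
      have "norm (L2_inner l (?v y) (\<lambda>x. f x - g x)) \<le> sqrt (L2_norm2 l (?v y)) * sqrt (L2_norm2 l (\<lambda>x. f x - g x))"
        by (intro L2_Cauchy_Schwarz vL L2_diff f gL)
      also have "\<dots> \<le> K * \<eta>"
        using sv fg eta K by (intro mult_mono) (auto simp: real_le_lsqrt L2_norm2_nonneg)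
      finally show ?thesis .
    qed
    moreover have "norm (L2_inner l (?v y) f) \<le>
        norm (L2_inner l (?v y) (\<lambda>x. f x - g x)) + norm (L2_inner l (?v y) g)"
      using norm_triangle_ineq[of "L2_inner l (?v y) (\<lambda>x. f x - g x)" "L2_inner l (?v y) g"]
      by (simp add: L2_inner_diff_right[OF f gL vL])
    ultimately show ?thesis by linarith
  qed
  have Ke: "K * \<eta> \<le> \<epsilon> / 2" using e K by (simp add: \<eta>_def field_simps)
  define Y where "Y = max 1 (2 * (K * G + 1) / \<epsilon>)"
  show ?thesis
  proof (intro exI[of _ Y] conjI allI impI)
    fix y assume "Y \<le> y"
    then have y: "y \<ge> 1" "2 * (K * G + 1) / \<epsilon> \<le> y" by (auto simp: Y_def)
    then have "2 * (K * G + 1) \<le> y * \<epsilon>" using e by (simp add: field_simps)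
    then have "K * G / y < \<epsilon> / 2" using y(1) e by (simp add: field_simps)
    then show "norm (L2_inner l (?v y) f) < \<epsilon>" using main[OF y(1)] Ke by linarith
  qed (simp add: Y_def)
qed

lemma u_bounded_imaginary_axis:
  assumes "y \<ge> 1"
  shows "L2_norm2 l (u (of_real y * \<i>)) \<le> 4 * L2_norm2 l (u \<i>)"
proof -
  let ?z = "of_real y * \<i>"
  have z: "Im ?z \<noteq> 0" and i: "Im \<i> \<noteq> 0" using assms by auto
  define n where "n = L2_norm2 l (\<lambda>x. u ?z x - u \<i> x)"
  define R where "R = L2_norm2 l (u \<i>)"
  have "?z - \<i> = of_real (y - 1) * \<i>" by (simp add: algebra_simps)
  then have nz: "norm (?z - \<i>) = y - 1" using assms by (simp add: norm_mult del: of_real_diff)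
  have "y * sqrt n \<le> (y - 1) * sqrt R"
    using u_diff_bound[OF z i] assms unfolding nz n_def R_def by simp
  also have "\<dots> \<le> y * sqrt R" by (intro mult_right_mono) (auto simp: R_def L2_norm2_nonneg)
  finally have "n \<le> R" using assms by simp
  \<comment> \<open>Expanding this square gives \<open>\<parallel>f\<parallel>\<^sup>2 \<le> 2 \<parallel>f - g\<parallel>\<^sup>2 + 2 \<parallel>g\<parallel>\<^sup>2\<close>.\<close>
  have "0 \<le> L2_norm2 l (\<lambda>x. u ?z x - 2 * u \<i> x)" by (rule L2_norm2_nonneg)
  also have "\<dots> = L2_norm2 l (u ?z) - 4 * Re (L2_inner l (u ?z) (u \<i>)) + 4 * R"
    by (subst L2_norm2_diff[OF u_L2[OF z] L2_scale[OF u_L2[OF i]]])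
      (simp add: L2_inner_scale_right[OF u_L2[OF i] u_L2[OF z]] L2_norm2_scale R_def)
  finally have "0 \<le> 2 * n + 2 * R - L2_norm2 l (u ?z)"
    unfolding n_def L2_norm2_diff[OF u_L2[OF z] u_L2[OF i]] R_def by simp
  with \<open>n \<le> R\<close> show ?thesis by (simp add: R_def)
qed

text \<open>\<open>N (\<i>y)\<close> differs by a constant from \<open>\<i> (y + 1) \<langle>u\<^sub>\<i>\<^sub>y, u\<^sub>\<i>\<rangle>\<close>, and the inner product tends to zero.\<close>

lemma N_sublinear:
  assumes e: "\<epsilon> > 0"
  shows "\<exists>y>0. Im (N (of_real y * \<i>)) \<le> \<epsilon> * y"
proof -
  have bnd: "L2_norm2 l (\<lambda>x. 1 * u (of_real y * \<i>) x) \<le> (2 * sqrt (L2_norm2 l (u \<i>)))\<^sup>2" if "y \<ge> 1" for y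
    using u_bounded_imaginary_axis[OF that] by (simp add: power_mult_distrib L2_norm2_nonneg)
  have "u \<i> \<in> L2 l" by (rule u_L2) simp
  from bounded_multiples_weakly_null[where s="\<lambda>_. 1", OF bnd _ this, of "\<epsilon> / 4"] e
  obtain Y where Y: "Y \<ge> 1" "\<And>y. y \<ge> Y \<Longrightarrow> norm (L2_inner l (u (of_real y * \<i>)) (u \<i>)) < \<epsilon> / 4"
    by (auto simp: L2_norm2_nonneg)
  define y where "y = max Y (2 * norm (N \<i>) / \<epsilon>)"
  have y: "y \<ge> 1" "y \<ge> Y" "2 * norm (N \<i>) / \<epsilon> \<le> y" using Y(1) by (auto simp: y_def)
  let ?z = "of_real y * \<i>"
  have "(?z - cnj \<i>) * L2_inner l (u ?z) (u \<i>) = N ?z - cnj (N \<i>)"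
    using y(1) by (intro kernel_identity) auto
  moreover have "?z - cnj \<i> = of_real (y + 1) * \<i>" by (simp add: algebra_simps)
  ultimately have "N ?z = of_real (y + 1) * \<i> * L2_inner l (u ?z) (u \<i>) + cnj (N \<i>)" by simp
  then have "norm (N ?z) \<le> norm (of_real (y + 1) * \<i> * L2_inner l (u ?z) (u \<i>)) + norm (cnj (N \<i>))"
    by (metis norm_triangle_ineq)
  also have "norm (of_real (y + 1) * \<i> * L2_inner l (u ?z) (u \<i>)) = (y + 1) * norm (L2_inner l (u ?z) (u \<i>))"
    using y(1) by (simp add: norm_mult del: of_real_add)
  also have "\<dots> \<le> (2 * y) * (\<epsilon> / 4)"
    using Y(2)[OF y(2)] y(1) by (intro mult_mono) auto
  also have "norm (cnj (N \<i>)) \<le> \<epsilon> * y / 2" using y(3) e by (simp add: field_simps)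
  finally have "norm (N ?z) \<le> \<epsilon> * y" by (simp add: field_simps)
  then have "Im (N ?z) \<le> \<epsilon> * y" using abs_Im_le_cmod[of "N ?z"] by linarith
  then show ?thesis using y(1) by (intro exI[of _ y]) auto
qed

text \<open>The quantity \<open>y Im (N (\<i>y))\<close> is the squared norm of \<open>\<i>y u\<^sub>\<i>\<^sub>y\<close>. If it were bounded, both terms
of Green's formula for \<open>u\<^sub>\<i>\<^sub>y\<close> and \<open>t\<close> would tend to zero.\<close>

lemma N_unbounded: "\<exists>y>0. B < y * Im (N (of_real y * \<i>))"
proof (rule ccontr)
  assume "\<not> ?thesis"
  then have H: "y * Im (N (of_real y * \<i>)) \<le> B" if "y > 0" for y using that by (meson not_le)
  have bnd: "L2_norm2 l (\<lambda>x. (of_real y * \<i>) * u (of_real y * \<i>) x) \<le> (sqrt \<bar>B\<bar>)\<^sup>2" if "y \<ge> 1" for y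
  proof -
    have "L2_norm2 l (\<lambda>x. (of_real y * \<i>) * u (of_real y * \<i>) x) = y * (Im (of_real y * \<i>) * L2_norm2 l (u (of_real y * \<i>)))"
      by (simp add: L2_norm2_scale norm_mult power2_eq_square)
    also have "\<dots> = y * Im (N (of_real y * \<i>))" using that by (subst Im_N) auto
    also have "\<dots> \<le> B" using that by (intro H) simp
    finally show ?thesis by simp
  qed
  have bnd': "L2_norm2 l (\<lambda>x. 1 * u (of_real y * \<i>) x) \<le> (2 * sqrt (L2_norm2 l (u \<i>)))\<^sup>2" if "y \<ge> 1" for y
    using u_bounded_imaginary_axis[OF that] by (simp add: power_mult_distrib L2_norm2_nonneg)
  obtain Y where Y: "Y \<ge> 1" "\<And>y. y \<ge> Y \<Longrightarrow> norm (L2_inner l (\<lambda>x. (of_real y * \<i>) * u (of_real y * \<i>) x) t) < 1 / 2"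
    using bounded_multiples_weakly_null[where s="\<lambda>y. of_real y * \<i>", OF bnd _ max_domainD(1)[OF t_dom], of "1 / 2"] by auto
  obtain Y' where Y': "Y' \<ge> 1" "\<And>y. y \<ge> Y' \<Longrightarrow> norm (L2_inner l (u (of_real y * \<i>)) (schroedinger_expr l q t)) < 1 / 2"
    using bounded_multiples_weakly_null[where s="\<lambda>_. 1", OF bnd' _ max_domainD(2)[OF t_dom], of "1 / 2"]
    by (auto simp: L2_norm2_nonneg)
  define y where "y = max Y Y'"
  let ?z = "of_real y * \<i>"
  have z: "Im ?z \<noteq> 0" using Y(1) by (simp add: y_def)
  have "1 = ?z * L2_inner l (u ?z) t - L2_inner l (u ?z) (schroedinger_expr l q t)"
    using green_u[OF z t_dom] t_form[OF z] by simp
  also have "?z * L2_inner l (u ?z) t = L2_inner l (\<lambda>x. ?z * u ?z x) t"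
    by (rule L2_inner_scale_left[OF u_L2[OF z] max_domainD(1)[OF t_dom], symmetric])
  finally have "norm (1::complex) \<le> norm (L2_inner l (\<lambda>x. ?z * u ?z x) t) + norm (L2_inner l (u ?z) (schroedinger_expr l q t))"
    by (metis norm_triangle_ineq4)
  moreover have "norm (L2_inner l (\<lambda>x. ?z * u ?z x) t) < 1 / 2" by (rule Y(2)) (simp add: y_def)
  moreover have "norm (L2_inner l (u ?z) (schroedinger_expr l q t)) < 1 / 2" by (rule Y'(2)) (simp add: y_def)
  ultimately show False by simp
qed

theorem affine_image_in_Donoghue_class:
  assumes f: "\<And>z. Im z \<noteq> 0 \<Longrightarrow> f z = of_real k * (N z - of_real (Re (N \<i>)))"
    and k: "k > 0" and large: "k * Im (N \<i>) > 1"
  shows "\<exists>\<kappa>. 0 < \<kappa> \<and> \<kappa> < 1 \<and> f \<in> donoghue_class_inv \<kappa>"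
proof (rule Donoghue_class_criterion)
  have "(\<lambda>z. of_real k * (N z - of_real (Re (N \<i>)))) holomorphic_on {z. Im z \<noteq> 0}"
    by (intro holomorphic_intros N_holomorphic)
  then show "f holomorphic_on {z. Im z \<noteq> 0}"
    by (rule holomorphic_transform) (simp add: f)
  show "f (cnj z) = cnj (f z)" if "Im z \<noteq> 0" for z
    using that by (simp add: f N_cnj)
  have Imf: "Im (f z) = k * Im (N z)" if "Im z \<noteq> 0" for z using f[OF that] by simp
  show "0 \<le> Im (f z)" if "Im z > 0" for z
    using that k Im_N_pos[OF that] by (simp add: Imf)
  show "f \<i> = of_real (k * Im (N \<i>)) * \<i>"
    using f[of \<i>] by (simp add: complex_eq_iff)
  show "k * Im (N \<i>) > 1" by (rule large)
  show "\<exists>y>0. Im (f (of_real y * \<i>)) \<le> \<epsilon> * y" if "\<epsilon> > 0" for \<epsilon>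
  proof -
    have "\<epsilon> / k > 0" using that k by simp
    then obtain y where "y > 0" "Im (N (of_real y * \<i>)) \<le> \<epsilon> / k * y" using N_sublinear by blast
    then show ?thesis using k by (intro exI[of _ y]) (simp add: Imf field_simps)
  qed
  show "\<exists>y>0. B < y * Im (f (of_real y * \<i>))" for B
  proof -
    obtain y where "y > 0" "B / k < y * Im (N (of_real y * \<i>))" using N_unbounded by blast
    then show ?thesis using k by (intro exI[of _ y]) (simp add: Imf field_simps)
  qed
qed

end

section \<open>The Weyl function\<close>

lemma max_domain_eq_zero:
  assumes y: "y \<in> max_domain l q" and n: "L2_norm2 l y = 0"
  shows "y = (\<lambda>_. 0)"
proof
  fix x0 show "y x0 = 0"
  proof (cases "x0 < l")
    case False
    show ?thesis
    proof (rule ccontr)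
      assume "y x0 \<noteq> 0"
      have "locally_abs_continuous l y" using max_domainD(3)[OF y] by (simp add: has_two_derivatives_def)
      then have "continuous_on {l..} y" by (rule locally_ac_continuous)
      then obtain d where d: "d > 0" "\<And>x. x \<in> {l..} \<Longrightarrow> dist x x0 < d \<Longrightarrow> dist (y x) (y x0) < norm (y x0)"
        using False \<open>y x0 \<noteq> 0\<close> unfolding continuous_on_iff by (metis atLeast_iff not_less zero_less_norm_iff)
      have "AE x in half_line l. y x = 0" by (rule L2_norm2_eq_0[OF max_domainD(1)[OF y] n])
      then obtain S where S: "S \<in> null_sets (half_line l)" "{x \<in> space (half_line l). y x \<noteq> 0} \<subseteq> S"
        unfolding eventually_ae_filter by (rule bexE)
      have "S \<in> null_sets lebesgue" using S(1) null_sets_restrict_space[of "{l..}" lebesgue S] by simp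
      then have "negligible S" by (simp add: negligible_iff_null_sets)
      moreover have "cbox x0 (x0 + d / 2) \<subseteq> S"
      proof
        fix x assume "x \<in> cbox x0 (x0 + d / 2)"
        then have x: "x \<in> {l..}" "dist x x0 < d" using False d(1) by (auto simp: dist_real_def)
        from d(2)[OF this] have "y x \<noteq> 0" by (auto simp: dist_norm)
        then show "x \<in> S" using S(2) x by auto
      qed
      ultimately have "negligible (cbox x0 (x0 + d / 2))" by (rule negligible_subset)
      then have "box x0 (x0 + d / 2) = {}" by (simp only: negligible_interval)
      then show False using d(1) by simp
    qed
  qed (rule max_domainD(4)[OF y])
qed

lemma weyl_solution_exists:
  assumes w: "weyl_function l q m" and z: "Im z \<noteq> 0"
  shows "\<exists>y. y \<in> max_domain l q \<and> (AE x in half_line l. schroedinger_expr l q y x = z * y x) \<and>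
    y l = -1 \<and> hderiv l y l = m z"
proof -
  obtain \<phi>1 \<phi>2 where \<phi>: "is_solution l q z \<phi>1" "\<phi>1 l = 0" "hderiv l \<phi>1 l = 1"
      "is_solution l q z \<phi>2" "\<phi>2 l = -1" "hderiv l \<phi>2 l = 0" "(\<lambda>x. \<phi>2 x + m z * \<phi>1 x) \<in> L2 l"
    using w[unfolded weyl_function_def, rule_format, OF z] by (elim exE conjE)
  have s: "smooth_enough l \<phi>1" "smooth_enough l \<phi>2"
    and e: "AE x in half_line l. schroedinger_expr l q \<phi>1 x = z * \<phi>1 x" "AE x in half_line l. schroedinger_expr l q \<phi>2 x = z * \<phi>2 x"
    using \<phi>(1,4) by (simp_all add: is_solution_def)
  define y where "y x = (if x < l then 0 else 1 * \<phi>2 x + m z * \<phi>1 x)" for x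
  note T0 = two_derivatives_lincomb[OF smooth_enough_two_derivatives[OF s(2)] smooth_enough_two_derivatives[OF s(1)], of 1 "m z"]
  have T: "has_two_derivatives l y (\<lambda>x. 1 * hderiv l \<phi>2 x + m z * hderiv l \<phi>1 x)
      (\<lambda>x. 1 * hderiv l (hderiv l \<phi>2) x + m z * hderiv l (hderiv l \<phi>1) x)"
    by (rule two_derivatives_cong[OF T0]) (simp add: y_def)
  have E: "AE x in half_line l. schroedinger_expr l q y x = z * y x"
    using two_derivatives_expr[OF T, of q] e AE_half_line_le[of l]
  proof eventually_elim
    case (elim x)
    have yx: "y x = \<phi>2 x + m z * \<phi>1 x" using elim by (simp add: y_def)
    have "schroedinger_expr l q y x = schroedinger_expr l q \<phi>2 x + m z * schroedinger_expr l q \<phi>1 x"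
      unfolding elim(1) yx by (simp add: schroedinger_expr_def algebra_simps)
    then show ?case using elim(2,3) yx by (simp add: algebra_simps)
  qed
  have L: "y \<in> L2 l"
    by (rule L2_cong_AE[OF \<phi>(7)]) (rule AE_I2, simp add: y_def)
  have "schroedinger_expr l q y \<in> L2 l" by (rule L2_cong_AE[OF L2_scale[OF L] E])
  then have "y \<in> max_domain l q"
    using L two_derivatives_smooth(1)[OF T] by (simp add: max_domain_def y_def)
  moreover have "hderiv l y l = m z" using two_derivatives_smooth(2)[OF T, of l] \<phi> by simp
  moreover have "y l = -1" using \<phi> by (simp add: y_def)
  ultimately show ?thesis using E by blast
qed

text \<open>Symmetry of the minimal operator on all functions with vanishing boundary values at \<open>l\<close>
forces the limit point case at infinity.\<close>

locale weyl_limit_point =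
  fixes l :: real and q :: "real \<Rightarrow> real" and m :: "complex \<Rightarrow> complex"
  assumes sym: "symmetric_operator l (min_domain l q) (schroedinger_expr l q)"
    and weyl: "weyl_function l q m"
begin

lemmas green = green_formula[OF sym weyl]

definition weyl_solution :: "complex \<Rightarrow> real \<Rightarrow> complex" where
  "weyl_solution z = (SOME y. y \<in> max_domain l q \<and>
     (AE x in half_line l. schroedinger_expr l q y x = z * y x) \<and> y l = -1 \<and> hderiv l y l = m z)"

lemma weyl_solution:
  assumes "Im z \<noteq> 0"
  shows "weyl_solution z \<in> max_domain l q"
    "AE x in half_line l. schroedinger_expr l q (weyl_solution z) x = z * weyl_solution z x"
    "weyl_solution z l = -1" "hderiv l (weyl_solution z) l = m z"
  using someI_ex[OF weyl_solution_exists[OF weyl assms]] unfolding weyl_solution_def by auto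

lemma boundary_values_attained: "\<exists>t. t \<in> max_domain l q \<and> t l = \<alpha> \<and> hderiv l t l = \<beta>"
  using compactly_supported_boundary_values[OF weyl, of \<alpha> \<beta>] by metis

lemma dirichlet_field:
  obtains t where "defect_field l q weyl_solution (\<lambda>z. - m z) t"
proof -
  obtain t where t: "t \<in> max_domain l q" "t l = 0" "hderiv l t l = 1"
    using boundary_values_attained by blast
  have "defect_field l q weyl_solution (\<lambda>z. - m z) t"
  proof
    show "L2_dense l (min_domain l q)" using sym by (simp add: symmetric_operator_def)
  qed (use green weyl_solution t in \<open>auto simp: boundary_form_def\<close>)
  then show thesis by (rule that)
qed

lemma m_cnj: "Im z \<noteq> 0 \<Longrightarrow> m (cnj z) = cnj (m z)"
  by (rule dirichlet_field) (metis (mono_tags, lifting) complex_cnj_minus defect_field.N_cnj minus_equation_iff)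

lemma Im_m_neg: "Im z > 0 \<Longrightarrow> Im (m z) < 0"
  by (rule dirichlet_field) (drule defect_field.Im_N_pos, auto)

lemma Im_m_nz: "Im z \<noteq> 0 \<Longrightarrow> Im (m z) \<noteq> 0"
  using Im_m_neg[of z] Im_m_neg[of "cnj z"] m_cnj[of z] by (cases "Im z > 0") auto

lemma shifted_field:
  fixes a :: real
  obtains t where "defect_field l q (\<lambda>z x. (1 / (m z - of_real a)) * weyl_solution z x) (\<lambda>z. 1 / (m z - of_real a)) t"
proof -
  obtain t where t: "t \<in> max_domain l q" "t l = 1" "hderiv l t l = - of_real a"
    using boundary_values_attained by blast
  define u where "u = (\<lambda>z x. (1 / (m z - of_real a)) * weyl_solution z x)"
  have nz: "m z - of_real a \<noteq> 0" "m z \<noteq> of_real a" if "Im z \<noteq> 0" for z using Im_m_nz[OF that] by (auto simp: complex_eq_iff)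
  have dom: "u z \<in> max_domain l q" and u': "hderiv l (u z) l = m z / (m z - of_real a)"
    and eq: "AE x in half_line l. schroedinger_expr l q (u z) x = z * u z x" if "Im z \<noteq> 0" for z
  proof -
    note W = weyl_solution[OF that]
    note L = max_domain_lincomb[OF W(1) W(1), of "1 / (m z - of_real a)" 0]
    show "u z \<in> max_domain l q" using L(1) by (simp add: u_def)
    show "hderiv l (u z) l = m z / (m z - of_real a)" using L(3) W by (simp add: u_def)
    from L(2) W(2) show "AE x in half_line l. schroedinger_expr l q (u z) x = z * u z x"
      by eventually_elim (simp add: u_def)
  qed
  have ul: "u z l = - 1 / (m z - of_real a)" if "Im z \<noteq> 0" for z using weyl_solution(3)[OF that] by (simp add: u_def)
  have "defect_field l q u (\<lambda>z. 1 / (m z - of_real a)) t"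
  proof
    show "L2_dense l (min_domain l q)" using sym by (simp add: symmetric_operator_def)
    show "boundary_form l (u z) (u w) = 1 / (m z - of_real a) - cnj (1 / (m w - of_real a))"
      if "Im z \<noteq> 0" "Im w \<noteq> 0" for z w
    proof -
      define x where "x = m z - of_real a"
      define y where "y = cnj (m w) - of_real a"
      have "cnj (m w - of_real a) \<noteq> 0" using nz(1)[OF that(2)] by (simp only: complex_cnj_zero_iff not_False_eq_True)
      then have "x \<noteq> 0" "y \<noteq> 0" using nz(1)[OF that(1)] by (simp_all add: x_def y_def)
      moreover have "boundary_form l (u z) (u w) = (x + of_real a) / x * (- 1 / y) - (- 1 / x) * ((y + of_real a) / y)"
        using that by (simp add: boundary_form_def u' ul x_def y_def)
      ultimately show ?thesis unfolding x_def[symmetric]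
        by (simp add: y_def[symmetric] divide_simps)
    qed
    show "boundary_form l (u z) t = 1" if "Im z \<noteq> 0" for z
      using nz[OF that] that t by (simp add: boundary_form_def u' ul divide_simps)
  qed (use green dom eq t in auto)
  then show thesis using that by (simp add: u_def)
qed

end

section \<open>Impedance and transfer functions\<close>

text \<open>The boundary condition of parameter \<open>\<mu>\<close> is written with homogeneous coordinates
\<open>(param_value \<mu>, param_slope \<mu>)\<close>, which are \<open>(\<mu>, 1)\<close> for finite \<open>\<mu>\<close> and \<open>(1, 0)\<close> for \<open>\<mu> = \<infinity>\<close>. Both
cases of the state operator and of the channel vector then have the same form.\<close>

definition param_value :: "boundary_param \<Rightarrow> real" where
  "param_value \<mu> = (case \<mu> of Fin x \<Rightarrow> x | Infty \<Rightarrow> 1)"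

definition param_slope :: "boundary_param \<Rightarrow> real" where
  "param_slope \<mu> = (case \<mu> of Fin x \<Rightarrow> 1 | Infty \<Rightarrow> 0)"

definition param_denom :: "boundary_param \<Rightarrow> complex \<Rightarrow> complex" where
  "param_denom \<mu> h = of_real (param_value \<mu>) - of_real (param_slope \<mu>) * h"

definition boundary_value :: "real \<Rightarrow> boundary_param \<Rightarrow> (real \<Rightarrow> complex) \<Rightarrow> complex" where
  "boundary_value l \<mu> v = of_real (param_value \<mu>) * v l - of_real (param_slope \<mu>) * hderiv l v l"

lemma param_denom_nz: "Im h > 0 \<Longrightarrow> param_denom \<mu> h \<noteq> 0"
  by (cases \<mu>) (auto simp: param_denom_def param_value_def param_slope_def complex_eq_iff)

lemma param_denom_cnj: "cnj (param_denom \<mu> h) = param_denom \<mu> (cnj h)"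
  by (simp add: param_denom_def)

lemma state_op_eq:
  "schroedinger_state_op l q \<mu> h y v = L2_inner l (schroedinger_expr l q y) v
     - (hderiv l y l - h * y l) / param_denom \<mu> h * cnj (boundary_value l \<mu> v)"
  by (cases \<mu>) (simp_all add: delta_def delta'_def param_denom_def param_value_def param_slope_def boundary_value_def)

lemma channel_vector_eq:
  "channel_vector l \<mu> h v = of_real (sqrt (Im h) / norm (param_denom \<mu> h)) * cnj (boundary_value l \<mu> v)"
  by (cases \<mu>) (simp_all add: delta_def delta'_def param_denom_def param_value_def param_slope_def boundary_value_def)

lemma channel_adjoint_eq:
  "channel_adjoint (schroedinger_lsystem l q \<mu> h) y =
     of_real (sqrt (Im h) / norm (param_denom \<mu> h)) * boundary_value l \<mu> y"
  by (simp add: channel_adjoint_def schroedinger_lsystem_def channel_vector_eq)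

context weyl_limit_point
begin

text \<open>Green's formula turns the adjoint into the same expression with \<open>h\<close> replaced by its conjugate.\<close>

lemma real_part_state_op:
  assumes y: "y \<in> max_domain l q" and v: "v \<in> max_domain l q" and h: "Im h > 0"
  shows "real_part_op (schroedinger_state_op l q \<mu> h) y v = L2_inner l (schroedinger_expr l q y) v
    - ((hderiv l y l - h * y l) / param_denom \<mu> h + (hderiv l y l - cnj h * y l) / param_denom \<mu> (cnj h)) / 2
      * cnj (boundary_value l \<mu> v)"
proof -
  define I where "I = L2_inner l (schroedinger_expr l q y) v"
  define d where "d = param_denom \<mu> (cnj h)"
  have d: "d \<noteq> 0" using param_denom_nz[OF h, of \<mu>] unfolding d_def param_denom_cnj[symmetric] by simp
  have "cnj (L2_inner l (schroedinger_expr l q v) y) = L2_inner l y (schroedinger_expr l q v)"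
    by (rule L2_inner_cnj[symmetric])
  then have adj: "cnj (schroedinger_state_op l q \<mu> h v y) = L2_inner l y (schroedinger_expr l q v)
      - (cnj (hderiv l v l) - cnj h * cnj (v l)) / d * boundary_value l \<mu> y"
    by (simp add: state_op_eq param_denom_cnj d_def)
  have "d * boundary_form l y v + (cnj (hderiv l v l) - cnj h * cnj (v l)) * boundary_value l \<mu> y =
      (hderiv l y l - cnj h * y l) * cnj (boundary_value l \<mu> v)"
    by (simp add: d_def param_denom_def boundary_form_def boundary_value_def algebra_simps)
  then have e1: "boundary_form l y v + (cnj (hderiv l v l) - cnj h * cnj (v l)) / d * boundary_value l \<mu> y =
      (hderiv l y l - cnj h * y l) / d * cnj (boundary_value l \<mu> v)"
    using d by (simp add: field_simps)
  have e2: "L2_inner l y (schroedinger_expr l q v) = I - boundary_form l y v"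
    using green[OF y v] by (simp add: I_def algebra_simps)
  have "cnj (schroedinger_state_op l q \<mu> h v y) = I - (hderiv l y l - cnj h * y l) / d * cnj (boundary_value l \<mu> v)"
    unfolding adj e2 e1[symmetric] by (rule diff_diff_eq)
  note adj' = this
  have "(I - X * F + (I - Y * F)) / 2 = I - (X + Y) / 2 * F" for X Y F by (simp add: field_simps)
  then show ?thesis
    unfolding real_part_op_def adjoint_op_def adj' state_op_eq[of l q \<mu> h y v] I_def[symmetric] d_def[symmetric] .
qed

text \<open>Uniqueness only has to be checked for the homogeneous equation tested against its own
solution.\<close>

lemma resolvent_opI:
  assumes y: "y \<in> max_domain l q"
    and sol: "\<And>v. v \<in> max_domain l q \<Longrightarrow> B y v - z * L2_inner l y v = F v"
    and lin: "\<And>y1 y2 v. y1 \<in> max_domain l q \<Longrightarrow> y2 \<in> max_domain l q \<Longrightarrow> v \<in> max_domain l q \<Longrightarrow>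
      B (\<lambda>x. 1 * y1 x + (-1) * y2 x) v = B y1 v - B y2 v"
    and inj: "\<And>d. d \<in> max_domain l q \<Longrightarrow> B d d - z * L2_inner l d d = 0 \<Longrightarrow> L2_norm2 l d = 0"
  shows "resolvent_op (schroedinger_lsystem l q \<mu> h) B z F = y"
  unfolding resolvent_op_def schroedinger_lsystem_def lsystem.simps
proof (rule the_equality)
  show "y \<in> max_domain l q \<and> (\<forall>v\<in>max_domain l q. B y v - z * L2_inner l y v = F v)"
    using y sol by blast
  fix w assume w: "w \<in> max_domain l q \<and> (\<forall>v\<in>max_domain l q. B w v - z * L2_inner l w v = F v)"
  then have wd: "w \<in> max_domain l q" by blast
  define d where "d = (\<lambda>x. 1 * w x + (-1) * y x)"
  have d: "d \<in> max_domain l q" unfolding d_def by (rule max_domain_lincomb(1)[OF wd y])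
  have e1: "L2_inner l d d = L2_inner l w d - L2_inner l y d"
    using L2_inner_lincomb_left[OF max_domainD(1)[OF wd] max_domainD(1)[OF y] max_domainD(1)[OF d], of 1 "-1"]
    by (simp add: d_def)
  have e2: "B d d = B w d - B y d" using lin[of w y d] w y d by (simp add: d_def)
  have "B d d - z * L2_inner l d d = (B w d - z * L2_inner l w d) - (B y d - z * L2_inner l y d)"
    unfolding e1 e2 by (simp add: algebra_simps)
  also have "\<dots> = F d - F d" using w sol[OF d] d by simp
  finally have "B d d - z * L2_inner l d d = 0" by simp
  then have "d = (\<lambda>_. 0)" by (intro max_domain_eq_zero[OF d] inj d)
  then show "w = y" by (auto simp: d_def fun_eq_iff)
qed

lemma L2_inner_expr_lincomb:
  assumes "y1 \<in> max_domain l q" "y2 \<in> max_domain l q" "v \<in> max_domain l q"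
  shows "L2_inner l (schroedinger_expr l q (\<lambda>x. a * y1 x + b * y2 x)) v =
    a * L2_inner l (schroedinger_expr l q y1) v + b * L2_inner l (schroedinger_expr l q y2) v"
proof -
  have "L2_inner l (schroedinger_expr l q (\<lambda>x. a * y1 x + b * y2 x)) v =
      L2_inner l (\<lambda>x. a * schroedinger_expr l q y1 x + b * schroedinger_expr l q y2 x) v"
    using max_domain_lincomb(2)[OF assms(1,2)]
    by (intro L2_inner_cong_AE L2_lincomb max_domainD[OF assms(1)] max_domainD[OF assms(2)] max_domainD[OF assms(3)]) auto
  then show ?thesis using assms by (simp add: L2_inner_lincomb_left max_domainD)
qed

lemma weyl_multiple:
  assumes z: "Im z \<noteq> 0"
  shows "(\<lambda>x. c * weyl_solution z x) \<in> max_domain l q"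
    "v \<in> max_domain l q \<Longrightarrow> L2_inner l (schroedinger_expr l q (\<lambda>x. c * weyl_solution z x)) v =
      z * L2_inner l (\<lambda>x. c * weyl_solution z x) v"
    "hderiv l (\<lambda>x. c * weyl_solution z x) l = c * m z" "c * weyl_solution z l = - c"
    "boundary_value l \<mu> (\<lambda>x. c * weyl_solution z x) = - c * (of_real (param_value \<mu>) + of_real (param_slope \<mu>) * m z)"
proof -
  note W = weyl_solution[OF z]
  note L = max_domain_lincomb[OF W(1) W(1), of c 0]
  show D: "(\<lambda>x. c * weyl_solution z x) \<in> max_domain l q" using L(1) by simp
  show hd: "hderiv l (\<lambda>x. c * weyl_solution z x) l = c * m z" using L(3) W by simp
  show "c * weyl_solution z l = - c" using W by simp
  show "boundary_value l \<mu> (\<lambda>x. c * weyl_solution z x) = - c * (of_real (param_value \<mu>) + of_real (param_slope \<mu>) * m z)"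
    unfolding boundary_value_def hd using W by (simp add: algebra_simps)
  assume v: "v \<in> max_domain l q"
  have "AE x in half_line l. schroedinger_expr l q (\<lambda>x. c * weyl_solution z x) x = z * (c * weyl_solution z x)"
    using L(2) W(2) by eventually_elim (simp add: mult.left_commute)
  then have "L2_inner l (schroedinger_expr l q (\<lambda>x. c * weyl_solution z x)) v = L2_inner l (\<lambda>x. z * (c * weyl_solution z x)) v"
    by (intro L2_inner_cong_AE L2_scale max_domainD[OF W(1)] max_domainD[OF v]) auto
  then show "L2_inner l (schroedinger_expr l q (\<lambda>x. c * weyl_solution z x)) v =
      z * L2_inner l (\<lambda>x. c * weyl_solution z x) v"
    using L2_inner_scale_left[OF max_domainD(1)[OF D] max_domainD(1)[OF v]] by simp
qed

definition impedance_denom :: "boundary_param \<Rightarrow> complex \<Rightarrow> complex \<Rightarrow> complex" where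
  "impedance_denom \<mu> h z = of_real (param_value \<mu> - param_slope \<mu> * Re h) * m z
     + of_real (param_value \<mu> * Re h - param_slope \<mu> * (norm h)\<^sup>2)"

lemma impedance_denom_nz:
  assumes h: "Im h > 0" and z: "Im z \<noteq> 0"
  shows "impedance_denom \<mu> h z \<noteq> 0"
proof (cases "param_value \<mu> = param_slope \<mu> * Re h")
  case True
  then obtain x where \<mu>: "\<mu> = Fin x" by (cases \<mu>) (auto simp: param_value_def param_slope_def)
  have "Re (impedance_denom \<mu> h z) = - (Im h)\<^sup>2"
    using True unfolding impedance_denom_def cmod_power2
    by (simp add: \<mu> param_value_def param_slope_def power2_eq_square)
  then show ?thesis using h by auto
next
  case False
  have "Im (impedance_denom \<mu> h z) = (param_value \<mu> - param_slope \<mu> * Re h) * Im (m z)"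
    by (simp add: impedance_denom_def)
  then show ?thesis using False Im_m_nz[OF z] by auto
qed

text \<open>A multiple of the Weyl solution solves the resolvent equation. It is the only solution because
the quadratic form of the real part is real while \<open>z\<close> is not.\<close>

lemma impedance_value:
  assumes h: "Im h > 0" and z: "Im z \<noteq> 0"
  shows "impedance_function (schroedinger_lsystem l q \<mu> h) z =
    of_real (Im h) * (of_real (param_value \<mu>) + of_real (param_slope \<mu>) * m z) / impedance_denom \<mu> h z"
proof -
  let ?\<Theta> = "schroedinger_lsystem l q \<mu> h"
  let ?B = "real_part_op (schroedinger_state_op l q \<mu> h)"
  define dn where "dn = param_denom \<mu> h"
  define s where "s = sqrt (Im h) / norm dn"
  have dn: "dn \<noteq> 0" "cnj dn \<noteq> 0" using param_denom_nz[OF h] by (simp_all add: dn_def)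
  \<comment> \<open>This factor matches the boundary term of the state operator with the channel vector, whose
    coefficient is \<open>s\<close>.\<close>
  define c where "c = - of_real (s * (norm dn)\<^sup>2) / impedance_denom \<mu> h z"
  let ?y = "\<lambda>x. c * weyl_solution z x"
  note Y = weyl_multiple[OF z, where c=c]
  have E: "((hderiv l ?y l - h * ?y l) / dn + (hderiv l ?y l - cnj h * ?y l) / cnj dn) / 2 = - of_real s"
  proof -
    have "(m z + h) * cnj dn + (m z + cnj h) * dn = 2 * impedance_denom \<mu> h z"
      unfolding impedance_denom_def cmod_power2 dn_def param_denom_def
      by (simp add: complex_eq_iff algebra_simps power2_eq_square)
    then have "((m z + h) / dn + (m z + cnj h) / cnj dn) / 2 = impedance_denom \<mu> h z / (dn * cnj dn)"
      using dn by (simp add: add_frac_eq mult.commute)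
    then have "((m z + h) / dn + (m z + cnj h) / cnj dn) / 2 = impedance_denom \<mu> h z / of_real ((norm dn)\<^sup>2)"
      unfolding complex_norm_square .
    moreover have "((hderiv l ?y l - h * ?y l) / dn + (hderiv l ?y l - cnj h * ?y l) / cnj dn) / 2 =
        c * (((m z + h) / dn + (m z + cnj h) / cnj dn) / 2)"
      unfolding Y(3,4) by (simp add: algebra_simps add_divide_distrib)
    ultimately show ?thesis
      using impedance_denom_nz[OF h z, of \<mu>] dn by (simp add: c_def)
  qed
  have B_eq: "?B y v = L2_inner l (schroedinger_expr l q y) v
      - ((hderiv l y l - h * y l) / dn + (hderiv l y l - cnj h * y l) / cnj dn) / 2 * cnj (boundary_value l \<mu> v)"
    if "y \<in> max_domain l q" "v \<in> max_domain l q" for y v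
    using real_part_state_op[OF that h] by (simp only: dn_def param_denom_cnj)
  have "resolvent_op ?\<Theta> ?B z (channel_op ?\<Theta> 1) = ?y"
  proof (rule resolvent_opI)
    show "?y \<in> max_domain l q" by (rule Y(1))
    show "?B ?y v - z * L2_inner l ?y v = channel_op ?\<Theta> 1 v" if v: "v \<in> max_domain l q" for v
      unfolding B_eq[OF Y(1) v] Y(2)[OF v] E
      by (simp add: schroedinger_lsystem_def channel_vector_eq s_def dn_def)
    show "?B (\<lambda>x. 1 * y1 x + (-1) * y2 x) v = ?B y1 v - ?B y2 v"
      if y: "y1 \<in> max_domain l q" "y2 \<in> max_domain l q" and v: "v \<in> max_domain l q" for y1 y2 v
      unfolding B_eq[OF max_domain_lincomb(1)[OF y] v] B_eq[OF y(1) v] B_eq[OF y(2) v]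
        L2_inner_expr_lincomb[OF y v] max_domain_lincomb(3)[OF y]
      using dn by (simp add: field_simps)
    show "L2_norm2 l d = 0" if d: "d \<in> max_domain l q" and eq: "?B d d - z * L2_inner l d d = 0" for d
    proof -
      have "Im (?B d d) = 0" by (simp add: real_part_op_def adjoint_op_def)
      then have "Im (z * of_real (L2_norm2 l d)) = 0" using eq by (simp add: L2_inner_self)
      then show ?thesis using z by simp
    qed
  qed
  then have "impedance_function ?\<Theta> z = of_real s * boundary_value l \<mu> ?y"
    unfolding impedance_function_def by (simp add: schroedinger_lsystem_def[of l q \<mu> h, symmetric] channel_adjoint_eq s_def dn_def)
      (simp add: schroedinger_lsystem_def channel_adjoint_def channel_vector_eq)
  also have "\<dots> = of_real (s * s * (norm dn)\<^sup>2) * (of_real (param_value \<mu>) + of_real (param_slope \<mu>) * m z) / impedance_denom \<mu> h z"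
    unfolding Y(5) by (simp add: c_def)
  also have "s * s * (norm dn)\<^sup>2 = Im h"
    using h dn by (simp add: s_def power2_eq_square)
  finally show ?thesis .
qed

text \<open>At \<open>z = - \<i>\<close> uniqueness follows from dissipativity: the imaginary part of the quadratic form of
the state operator is \<open>Im h \<bar>G\<bar>\<^sup>2 / \<bar>dn\<bar>\<^sup>2 \<ge> 0\<close>, with \<open>G\<close> the boundary value of the solution. The
parameter \<open>\<mu>\<close> enters only through the unimodular factor \<open>dn / cnj dn\<close>.\<close>

lemma transfer_value:
  assumes h: "Im h > 0"
  shows "norm (transfer_function (schroedinger_lsystem l q \<mu> h) (- \<i>)) = norm (m \<i> + h) / norm (m \<i> + cnj h)"
proof -
  let ?\<Theta> = "schroedinger_lsystem l q \<mu> h"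
  let ?B = "schroedinger_state_op l q \<mu> h"
  define z where "z = - \<i>"
  have z: "Im z \<noteq> 0" by (simp add: z_def)
  have mz: "m z = cnj (m \<i>)" using m_cnj[of \<i>] by (simp add: z_def)
  define dn where "dn = param_denom \<mu> h"
  define s where "s = sqrt (Im h) / norm dn"
  have dn: "dn \<noteq> 0" using param_denom_nz[OF h] by (simp_all add: dn_def)
  then have cdn: "cnj dn \<noteq> 0" by simp
  have mh: "m z + h \<noteq> 0"
  proof
    assume "m z + h = 0"
    then have "Im (m z + h) = 0" by simp
    then show False using h Im_m_neg[of \<i>] by (simp add: mz)
  qed
  define c where "c = - (of_real s * dn) / (m z + h)"
  let ?y = "\<lambda>x. c * weyl_solution z x"
  note Y = weyl_multiple[OF z, where c=c]
  have B_eq: "?B y v = L2_inner l (schroedinger_expr l q y) v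
      - (hderiv l y l - h * y l) / dn * cnj (boundary_value l \<mu> v)" for y v
    by (simp only: state_op_eq dn_def)
  have "(hderiv l ?y l - h * ?y l) / dn = c * (m z + h) / dn"
    unfolding Y(3,4) by (simp add: algebra_simps)
  also have "\<dots> = - of_real s" using dn mh by (simp add: c_def)
  finally have E: "(hderiv l ?y l - h * ?y l) / dn = - of_real s" .
  have "resolvent_op ?\<Theta> ?B z (channel_op ?\<Theta> 1) = ?y"
  proof (rule resolvent_opI)
    show "?y \<in> max_domain l q" by (rule Y(1))
    show "?B ?y v - z * L2_inner l ?y v = channel_op ?\<Theta> 1 v" if v: "v \<in> max_domain l q" for v
      unfolding B_eq Y(2)[OF v] E
      by (simp add: schroedinger_lsystem_def channel_vector_eq s_def dn_def)
    show "?B (\<lambda>x. 1 * y1 x + (-1) * y2 x) v = ?B y1 v - ?B y2 v"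
      if y: "y1 \<in> max_domain l q" "y2 \<in> max_domain l q" and v: "v \<in> max_domain l q" for y1 y2 v
      unfolding B_eq L2_inner_expr_lincomb[OF y v] max_domain_lincomb(3)[OF y]
      using dn by (simp add: field_simps)
    show "L2_norm2 l d = 0" if d: "d \<in> max_domain l q" and eq: "?B d d - z * L2_inner l d d = 0" for d
    proof -
      define J where "J = L2_inner l (schroedinger_expr l q d) d"
      have "L2_inner l d (schroedinger_expr l q d) = cnj J" unfolding J_def by (rule L2_inner_cnj)
      then have "J - cnj J = boundary_form l d d" using green[OF d d] by (simp add: J_def)
      then have "Im (J - cnj J) = Im (boundary_form l d d)" by simp
      then have ImJ: "Im J = Im (hderiv l d l * cnj (d l))" by (simp add: boundary_form_def algebra_simps)
      define G where "G = boundary_value l \<mu> d"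
      have "Im (?B d d) = Im h * (norm G)\<^sup>2 / (norm dn)\<^sup>2"
      proof (cases \<mu>)
        case Infty
        then have "dn = 1" "G = d l" by (simp_all add: dn_def G_def param_denom_def boundary_value_def param_value_def param_slope_def)
        then show ?thesis
          unfolding B_eq J_def[symmetric] G_def[symmetric] using ImJ
          by (simp add: cmod_power2) (simp add: algebra_simps power2_eq_square)
      next
        case (Fin x)
        then have 1: "dn = of_real x - h" "G = of_real x * d l - hderiv l d l"
          by (simp_all add: dn_def G_def param_denom_def boundary_value_def param_value_def param_slope_def)
        have "(hderiv l d l - h * d l) / dn * cnj G = (dn * d l - G) / dn * cnj G"
          by (simp add: 1 algebra_simps)
        \<comment> \<open>The first term cancels against the boundary contribution of the differential expression.\<close>
        also have "\<dots> = d l * cnj G - G * cnj G * (1 / dn)" using dn by (simp add: field_simps)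
        also have "\<dots> = d l * cnj G - of_real ((norm G)\<^sup>2) * (1 / dn)" unfolding complex_norm_square ..
        finally have T: "(hderiv l d l - h * d l) / dn * cnj G = d l * cnj G - of_real ((norm G)\<^sup>2) * (1 / dn)" .
        have "Im (a - (b - of_real r * w)) = Im a - Im b + r * Im w" for a b w r by simp
        then have "Im (?B d d) = Im J - Im (d l * cnj G) + (norm G)\<^sup>2 * Im (1 / dn)"
          unfolding B_eq J_def[symmetric] G_def[symmetric] T .
        moreover have "Im (1 / dn) = Im h / (norm dn)\<^sup>2"
          unfolding cmod_power2 by (simp add: Im_divide 1 power2_eq_square)
        moreover have "Im (d l * cnj G) = Im J" unfolding ImJ 1 by (simp add: algebra_simps)
        ultimately show ?thesis by simp
      qed
      moreover have "Im (?B d d) + L2_norm2 l d = 0"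
        using arg_cong[OF eq, of Im] by (simp add: L2_inner_self z_def)
      moreover have "Im h * (norm G)\<^sup>2 / (norm dn)\<^sup>2 \<ge> 0" using h by simp
      ultimately show ?thesis using L2_norm2_nonneg[of l d] by linarith
    qed
  qed
  then have "transfer_function ?\<Theta> z = 1 - 2 * \<i> * (of_real s * boundary_value l \<mu> ?y)"
    unfolding transfer_function_def
    by (simp add: schroedinger_lsystem_def channel_adjoint_def channel_vector_eq s_def dn_def)
  also have "\<dots> = 1 - 2 * \<i> * (of_real (s * s) * dn * (of_real (param_value \<mu>) + of_real (param_slope \<mu>) * m z) / (m z + h))"
    unfolding Y(5) by (simp add: c_def)
  also have "of_real (s * s) * dn = of_real (Im h) / cnj dn"
  proof -
    have "s * s = Im h / (norm dn)\<^sup>2" using h by (simp add: s_def power2_eq_square)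
    then have "of_real (s * s) * dn = of_real (Im h) / (dn * cnj dn) * dn"
      unfolding complex_norm_square[symmetric] by simp
    then show ?thesis using dn by simp
  qed
  also have "1 - 2 * \<i> * (of_real (Im h) / cnj dn * (of_real (param_value \<mu>) + of_real (param_slope \<mu>) * m z) / (m z + h)) =
      (cnj dn * (m z + h) - 2 * \<i> * of_real (Im h) * (of_real (param_value \<mu>) + of_real (param_slope \<mu>) * m z)) / (cnj dn * (m z + h))"
    using cdn mh by (simp add: diff_divide_distrib)
  also have "2 * \<i> * of_real (Im h) = h - cnj h" by (simp add: complex_eq_iff)
  also have "cnj dn * (m z + h) - (h - cnj h) * (of_real (param_value \<mu>) + of_real (param_slope \<mu>) * m z) = dn * (m z + cnj h)"
    by (simp add: dn_def param_denom_def algebra_simps)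
  finally have "norm (transfer_function ?\<Theta> z) = norm (m z + cnj h) / norm (m z + h)"
    using dn by (simp add: norm_divide norm_mult)
  also have "m z + cnj h = cnj (m \<i> + h)" by (simp add: mz)
  also have "m z + h = cnj (m \<i> + cnj h)" by (simp add: mz)
  finally show ?thesis by (simp only: z_def complex_mod_cnj)
qed

end

section \<open>The maximal c-entropy\<close>

lemma Donoghue_class_value_at_i:
  assumes "M \<in> donoghue_class_inv \<kappa>"
  shows "M \<i> = \<i> * of_real ((1 + \<kappa>) / (1 - \<kappa>))"
proof -
  obtain \<sigma> :: "real measure" where \<sigma>: "has_bochner_integral \<sigma> (\<lambda>t. 1 / (1 + t\<^sup>2)) ((1 + \<kappa>) / (1 - \<kappa>))"
    and M: "\<forall>z. Im z \<noteq> 0 \<longrightarrow> M z = (\<integral>t. (1 / (of_real t - z) - of_real (t / (1 + t\<^sup>2))) \<partial>\<sigma>)"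
    using assms unfolding donoghue_class_inv_def by blast
  have "1 / (of_real t - \<i>) - of_real (t / (1 + t\<^sup>2)) = \<i> * complex_of_real (1 / (1 + t\<^sup>2))" for t :: real
  proof -
    have "1 / (complex_of_real t - \<i>) = (of_real t + \<i>) / (1 + (of_real t)\<^sup>2)"
    proof -
      have nz: "complex_of_real t + \<i> \<noteq> 0" by (auto simp: complex_eq_iff)
      have "1 / (complex_of_real t - \<i>) = (of_real t + \<i>) / ((of_real t - \<i>) * (of_real t + \<i>))"
        using nz by simp
      also have "(complex_of_real t - \<i>) * (of_real t + \<i>) = 1 + (of_real t)\<^sup>2"
        by (simp add: algebra_simps power2_eq_square)
      finally show ?thesis .
    qed
    then show ?thesis by (simp add: add_divide_distrib)
  qed
  then have "M \<i> = (\<integral>t. \<i> * complex_of_real (1 / (1 + t\<^sup>2)) \<partial>\<sigma>)" using M by simp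
  also have "\<dots> = \<i> * (\<integral>t. complex_of_real (1 / (1 + t\<^sup>2)) \<partial>\<sigma>)" by (rule integral_mult_right_zero)
  also have "(\<integral>t. complex_of_real (1 / (1 + t\<^sup>2)) \<partial>\<sigma>) = of_real (\<integral>t. 1 / (1 + t\<^sup>2) \<partial>\<sigma>)" by (rule integral_complex_of_real)
  also have "(\<integral>t. 1 / (1 + t\<^sup>2) \<partial>\<sigma>) = (1 + \<kappa>) / (1 - \<kappa>)" using \<sigma> by (simp add: has_bochner_integral_iff)
  finally show ?thesis .
qed

text \<open>The quotient \<open>(x\<^sup>2 + P) / (x\<^sup>2 + R)\<close> decreases in \<open>x\<^sup>2\<close> because \<open>P > R\<close>.\<close>

lemma log_ratio_max:
  fixes P R x :: real
  assumes "0 < R" "R < P"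
  shows "ln (x\<^sup>2 + P) - ln (x\<^sup>2 + R) \<le> ln P - ln R"
    and "x \<noteq> 0 \<Longrightarrow> ln (x\<^sup>2 + P) - ln (x\<^sup>2 + R) < ln P - ln R"
proof -
  have pos: "0 < x\<^sup>2 + P" "0 < x\<^sup>2 + R" using assms by (auto simp: add_nonneg_pos)
  show "ln (x\<^sup>2 + P) - ln (x\<^sup>2 + R) < ln P - ln R" if "x \<noteq> 0"
  proof -
    have "x\<^sup>2 * R < x\<^sup>2 * P" using that assms by simp
    then have "(x\<^sup>2 + P) * R < P * (x\<^sup>2 + R)" by (simp add: algebra_simps)
    then have "ln ((x\<^sup>2 + P) * R) < ln (P * (x\<^sup>2 + R))" using pos assms by simp
    then show ?thesis using pos assms by (simp add: ln_mult)
  qed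
  then show "ln (x\<^sup>2 + P) - ln (x\<^sup>2 + R) \<le> ln P - ln R" by (cases "x = 0") auto
qed

context weyl_limit_point
begin

lemma c_entropy_value:
  assumes h: "Im h > 0" and ne: "Im h \<noteq> - Im (m \<i>)"
  shows "c_entropy (schroedinger_lsystem l q \<mu> h) =
    ereal ((ln ((Re (m \<i>) + Re h)\<^sup>2 + (Im h - Im (m \<i>))\<^sup>2) - ln ((Re (m \<i>) + Re h)\<^sup>2 + (Im h + Im (m \<i>))\<^sup>2)) / 2)"
proof -
  have b: "Im (m \<i>) < 0" using Im_m_neg[of \<i>] by simp
  have "Im (m \<i> + h) \<noteq> 0" "Im (m \<i> + cnj h) \<noteq> 0" using h ne b by auto
  then have nz: "m \<i> + h \<noteq> 0" "m \<i> + cnj h \<noteq> 0" by force+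
  then have n: "0 < norm (m \<i> + h)" "0 < norm (m \<i> + cnj h)" by simp_all
  have L: "ln (norm w) = ln ((Re w)\<^sup>2 + (Im w)\<^sup>2) / 2" if "0 < norm w" for w :: complex
    unfolding cmod_power2[symmetric] using that by (simp add: ln_realpow)
  have T: "norm (transfer_function (schroedinger_lsystem l q \<mu> h) (- \<i>)) = norm (m \<i> + h) / norm (m \<i> + cnj h)"
    by (rule transfer_value[OF h])
  then have "transfer_function (schroedinger_lsystem l q \<mu> h) (- \<i>) \<noteq> 0" using n by auto
  moreover have "- ln (norm (transfer_function (schroedinger_lsystem l q \<mu> h) (- \<i>))) = ln (norm (m \<i> + cnj h)) - ln (norm (m \<i> + h))"
    unfolding T using n by (simp add: ln_div)
  moreover have "(Im (m \<i> + cnj h))\<^sup>2 = (Im h - Im (m \<i>))\<^sup>2" by (simp add: power2_commute)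
  ultimately show ?thesis
    unfolding c_entropy_def L[OF n(1)] L[OF n(2)] by (simp add: diff_divide_distrib add.commute)
qed

text \<open>Up to the positive factor \<open>D\<close> or \<open>1 / D\<close>, the impedance is the function \<open>N\<close> of one of the two
defect fields, shifted to have real part zero at \<open>\<i>\<close>. The case distinction on \<open>D\<close> is what makes
its value at \<open>\<i>\<close> equal to \<open>\<i> s\<close> with \<open>s > 1\<close>.\<close>

lemma critical_lsystem_admissible:
  assumes D: "D > 0" and ne: "D \<noteq> - Im (m \<i>)"
    and h: "h = Complex (- Re (m \<i>)) D"
    and \<mu>: "\<mu> = (if D > - Im (m \<i>) then Infty else Fin (- Re (m \<i>)))"
  shows "(\<mu>, h) \<in> admissible_params l q D"
proof -
  have hI: "Im h > 0" using D h by simp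
  let ?V = "impedance_function (schroedinger_lsystem l q \<mu> h)"
  have "\<exists>\<kappa>. 0 < \<kappa> \<and> \<kappa> < 1 \<and> ?V \<in> donoghue_class_inv \<kappa>"
  proof (cases "D > - Im (m \<i>)")
    case True
    obtain t where F: "defect_field l q (\<lambda>z x. (1 / (m z - of_real (Re (m \<i>)))) * weyl_solution z x) (\<lambda>z. 1 / (m z - of_real (Re (m \<i>)))) t"
      by (rule shifted_field)
    have mi: "m \<i> - of_real (Re (m \<i>)) = \<i> * of_real (Im (m \<i>))" by (simp add: complex_eq_iff)
    have b: "Im (m \<i>) < 0" using Im_m_neg[of \<i>] by simp
    have inv: "1 / (m \<i> - of_real (Re (m \<i>))) = \<i> * of_real (- 1 / Im (m \<i>))"
      unfolding mi using b by (simp add: complex_eq_iff Re_divide Im_divide power2_eq_square)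
    show ?thesis
    proof (rule defect_field.affine_image_in_Donoghue_class[OF F _ D])
      show "D * Im (1 / (m \<i> - of_real (Re (m \<i>)))) > 1"
        unfolding inv using b True by (simp add: field_simps)
      fix z assume z: "Im z \<noteq> 0"
      have "?V z = of_real D / (m z - of_real (Re (m \<i>)))"
        unfolding impedance_value[OF hI z] impedance_denom_def using True h \<mu> by (simp add: param_value_def param_slope_def)
      then show "?V z = of_real D * (1 / (m z - of_real (Re (m \<i>))) - of_real (Re (1 / (m \<i> - of_real (Re (m \<i>))))))"
        unfolding inv by simp
    qed
  next
    case False
    then have less: "D < - Im (m \<i>)" using ne by simp
    obtain t where F: "defect_field l q weyl_solution (\<lambda>z. - m z) t" by (rule dirichlet_field)
    show ?thesis
    proof (rule defect_field.affine_image_in_Donoghue_class[OF F])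
      show "1 / D > 0" using D by simp
      show "1 / D * Im (- m \<i>) > 1" using D less by (simp add: field_simps)
      fix z assume z: "Im z \<noteq> 0"
      have "impedance_denom \<mu> h z = - (of_real D)\<^sup>2"
        using False h \<mu> unfolding impedance_denom_def cmod_power2
        by (simp add: param_value_def param_slope_def power2_eq_square)
      then show "?V z = of_real (1 / D) * (- m z - of_real (Re (- m \<i>)))"
        unfolding impedance_value[OF hI z] using False h \<mu> D
        by (simp add: param_value_def param_slope_def power2_eq_square field_simps)
    qed
  qed
  then show ?thesis using h by (simp add: admissible_params_def)
qed

text \<open>Let \<open>b = - Im (m \<i>)\<close> and \<open>V \<i> = \<i> s\<close> with \<open>s > 1\<close>. For \<open>\<mu> = \<infinity>\<close> the equation reads \<open>D = s b\<close>. For a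
finite \<open>\<mu>\<close> its imaginary part gives \<open>b = s D\<close>, and then its real part forces \<open>\<mu> = - Re (m \<i>)\<close>.\<close>

lemma admissible_at_critical_h:
  assumes adm: "(\<mu>, h) \<in> admissible_params l q D" and D: "D > 0" and Re_h: "Re h = - Re (m \<i>)"
  shows "\<mu> = (if D > - Im (m \<i>) then Infty else Fin (- Re (m \<i>)))"
proof -
  have hD: "Im h = D" using adm by (simp add: admissible_params_def)
  then have hI: "Im h > 0" using D by simp
  have iI: "Im \<i> \<noteq> 0" by simp
  define b where "b = - Im (m \<i>)"
  have b: "b > 0" using Im_m_neg[of \<i>] by (simp add: b_def)
  obtain \<kappa> where k: "0 < \<kappa>" "\<kappa> < 1" "impedance_function (schroedinger_lsystem l q \<mu> h) \<in> donoghue_class_inv \<kappa>"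
    using adm by (auto simp: admissible_params_def)
  define s where "s = (1 + \<kappa>) / (1 - \<kappa>)"
  have s: "s > 1" using k by (simp add: s_def field_simps)
  have "of_real D * (of_real (param_value \<mu>) + of_real (param_slope \<mu>) * m \<i>) / impedance_denom \<mu> h \<i> = \<i> * of_real s"
    using Donoghue_class_value_at_i[OF k(3)] unfolding impedance_value[OF hI iI] hD s_def .
  then have eq: "of_real D * (of_real (param_value \<mu>) + of_real (param_slope \<mu>) * m \<i>) = \<i> * of_real s * impedance_denom \<mu> h \<i>"
    using impedance_denom_nz[OF hI iI, of \<mu>] by (simp add: field_simps)
  show ?thesis
  proof (cases \<mu>)
    case Infty
    have "Re (of_real D * (of_real (param_value \<mu>) + of_real (param_slope \<mu>) * m \<i>)) = D"
      by (simp add: Infty param_value_def param_slope_def)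
    moreover have "Re (\<i> * of_real s * impedance_denom \<mu> h \<i>) = s * b"
      by (simp add: Infty param_value_def param_slope_def impedance_denom_def b_def)
    ultimately have "D = s * b" using eq by simp
    then have "D > b" using s b by simp
    then show ?thesis using Infty by (simp add: b_def)
  next
    case (Fin x)
    have re: "D * (x + Re (m \<i>)) = s * b * (x + Re (m \<i>))"
      using arg_cong[OF eq, of Re]
      by (simp add: Fin param_value_def param_slope_def impedance_denom_def b_def Re_h algebra_simps)
    have im: "D * b = s * D * D"
      using arg_cong[OF eq, of Im] unfolding impedance_denom_def cmod_power2
      by (simp add: Fin param_value_def param_slope_def b_def Re_h hD algebra_simps power2_eq_square)
    then have bs: "b = s * D" using D by simp
    then have "b > D" using s D by simp
    have "s * b > D" using s b \<open>b > D\<close> by (smt (verit) mult_less_cancel_right1)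
    then have "x = - Re (m \<i>)" using re by simp
    then show ?thesis using Fin \<open>b > D\<close> by (simp add: b_def)
  qed
qed

end

theorem theorem22:
  fixes l D :: real and q :: "real \<Rightarrow> real" and m :: "complex \<Rightarrow> complex"
  assumes "locally_summable l q"
    and "has_deficiency_indices l (min_domain l q) (schroedinger_expr l q) 1 1"
    and "weyl_function l q m"
    and "D > 0" and "D \<noteq> - Im (m \<i>)"
  shows "(\<forall>\<mu> h. has_max_finite_c_entropy l q D \<mu> h \<longleftrightarrow>
            h = Complex (- Re (m \<i>)) D \<and>
            \<mu> = (if D > - Im (m \<i>) then Infty else Fin (- Re (m \<i>)))) \<and>
         (\<forall>\<mu> h. has_max_finite_c_entropy l q D \<mu> h \<longrightarrow>
            c_entropy (schroedinger_lsystem l q \<mu> h) =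
              ereal (ln \<bar>D - Im (m \<i>)\<bar> - ln \<bar>D + Im (m \<i>)\<bar>))"
proof -
  interpret weyl_limit_point l q m
    using assms(2,3) by unfold_locales (simp_all add: has_deficiency_indices_def)
  define a where "a = Re (m \<i>)"
  define b where "b = Im (m \<i>)"
  have b: "b < 0" using Im_m_neg[of \<i>] by (simp add: b_def)
  define P where "P = (D - b)\<^sup>2"
  define R where "R = (D + b)\<^sup>2"
  have "D + b \<noteq> 0" using assms(5) by (simp add: b_def)
  then have R: "0 < R" by (simp add: R_def)
  have "P - R = - 4 * (D * b)" by (simp add: P_def R_def power2_eq_square algebra_simps)
  moreover have "D * b < 0" using assms(4) b by (rule mult_pos_neg)
  ultimately have PR: "R < P" by linarith
  define S where "S x = (ln (x\<^sup>2 + P) - ln (x\<^sup>2 + R)) / 2" for x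
  have S_le: "S x \<le> S 0" for x using log_ratio_max(1)[OF R PR, of x] by (simp add: S_def)
  have S_less: "S x < S 0" if "x \<noteq> 0" for x using log_ratio_max(2)[OF R PR that] by (simp add: S_def)
  have ent: "c_entropy (schroedinger_lsystem l q \<mu> h) = ereal (S (a + Re h))" if "Im h = D" for \<mu> h
    using c_entropy_value[of h \<mu>] that assms(4,5) by (simp add: S_def P_def R_def a_def b_def)
  define h0 where "h0 = Complex (- Re (m \<i>)) D"
  define \<mu>0 where "\<mu>0 = (if D > - Im (m \<i>) then Infty else Fin (- Re (m \<i>)))"
  have adm0: "(\<mu>0, h0) \<in> admissible_params l q D"
    by (rule critical_lsystem_admissible[OF assms(4,5) h0_def \<mu>0_def])
  have admD: "Im h = D" if "(\<mu>, h) \<in> admissible_params l q D" for \<mu> h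
    using that by (simp add: admissible_params_def)
  have ent0: "c_entropy (schroedinger_lsystem l q \<mu>0 h0) = ereal (S 0)"
    using ent[OF admD[OF adm0]] by (simp add: h0_def a_def)
  have iff: "has_max_finite_c_entropy l q D \<mu> h \<longleftrightarrow> h = h0 \<and> \<mu> = \<mu>0" for \<mu> h
  proof
    assume H: "has_max_finite_c_entropy l q D \<mu> h"
    then have adm: "(\<mu>, h) \<in> admissible_params l q D" by (simp add: has_max_finite_c_entropy_def)
    have "c_entropy (schroedinger_lsystem l q \<mu>0 h0) \<le> c_entropy (schroedinger_lsystem l q \<mu> h)"
      using H adm0 unfolding has_max_finite_c_entropy_def by blast
    then have "S 0 \<le> S (a + Re h)" by (simp add: ent0 ent[OF admD[OF adm]])
    then have "a + Re h = 0" using S_less[of "a + Re h"] by fastforce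
    then have Re_h: "Re h = - Re (m \<i>)" by (simp add: a_def)
    then have "h = h0" using admD[OF adm] by (simp add: h0_def complex_eq_iff)
    moreover have "\<mu> = \<mu>0" unfolding \<mu>0_def by (rule admissible_at_critical_h[OF adm assms(4) Re_h])
    ultimately show "h = h0 \<and> \<mu> = \<mu>0" by blast
  next
    assume "h = h0 \<and> \<mu> = \<mu>0"
    moreover have "c_entropy (schroedinger_lsystem l q \<mu>' h') \<le> c_entropy (schroedinger_lsystem l q \<mu>0 h0)"
      if "(\<mu>', h') \<in> admissible_params l q D" for \<mu>' h'
      using S_le by (simp add: ent0 ent[OF admD[OF that]])
    ultimately show "has_max_finite_c_entropy l q D \<mu> h"
      unfolding has_max_finite_c_entropy_def using adm0 ent0 by auto
  qed
  have "S 0 = ln \<bar>D - b\<bar> - ln \<bar>D + b\<bar>"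
  proof -
    have "ln (x\<^sup>2) / 2 = ln \<bar>x\<bar>" if "x \<noteq> 0" for x :: real
      using ln_realpow[of "\<bar>x\<bar>" 2] that by simp
    from this[of "D - b"] this[of "D + b"] show ?thesis
      using \<open>D + b \<noteq> 0\<close> assms(4) b by (simp add: S_def P_def R_def diff_divide_distrib)
  qed
  then have val: "c_entropy (schroedinger_lsystem l q \<mu> h) = ereal (ln \<bar>D - Im (m \<i>)\<bar> - ln \<bar>D + Im (m \<i>)\<bar>)"
    if "h = h0 \<and> \<mu> = \<mu>0" for \<mu> h
    using that ent0 by (simp add: b_def)
  show ?thesis
    unfolding iff h0_def[symmetric] \<mu>0_def[symmetric] using val by blast
qed

end
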